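(* Let $-1<q<1$. Let $\mathcal H_{\mathbb R}=\mathbb R^2\oplus\mathcal K_{\mathbb R}$, where $\mathcal K_{\mathbb R}$ is a non-zero separable real Hilbert space, and let $(U_t)_{t\in\mathbb R}$ be a strongly continuous orthogonal representation of $\mathbb R$ on $\mathcal H_{\mathbb R}$ for which $\mathbb R^2$ is a reducing subspace with ergodic subrepresentation, i.e. for some $\lambda\in(0,1)$, $$U_t|_{\mathbb R^2}=\begin{pmatrix}\cos(t\log\lambda)&-\sin(t\log\lambda)\\ \sin(t\log\lambda)&\cos(t\log\lambda)\end{pmatrix},\quad t\in\mathbb R$$ (so that $\dim\mathcal H_{\mathbb R}\ge3$). Then the $q$-Araki-Woods von Neumann algebra $M_q=\Gamma_q(\mathcal H_{\mathbb R},U_t)''$ is a factor.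
   Context: Construction of $M_q$ (inner products are linear in the second variable). Let $\mathcal H_{\mathbb R}$ be a separable real Hilbert space with $\dim\mathcal H_{\mathbb R}\ge2$ and $(U_t)_{t\in\mathbb R}$ a strongly continuous orthogonal representation of $\mathbb R$ on it. Extend $U_t$ linearly to the complexification $\mathcal H_{\mathbb C}$ and let $A$ be its analytic generator (positive, nonsingular, self-adjoint, $U_t=A^{it}$). Put $\langle\xi,\eta\rangle_U=\langle\frac{2}{1+A^{-1}}\xi,\eta\rangle_{\mathcal H_{\mathbb C}}$ and let $\mathcal H$ be the completion of $\mathcal H_{\mathbb C}$ for this inner product; $\mathcal H_{\mathbb R}\subset\mathcal H$. The $q$-Fock space $\mathcal F_q(\mathcal H)$ is the completion of $\mathbb C\Omega\oplus\bigoplus_{n\ge1}\mathcal H^{\otimes n}$ (algebraic tensor powers; $\Omega$ is the unit vacuum vector) for $$\langle\xi_1\otimes\cdots\otimes\xi_n,\zeta_1\otimes\cdots\otimes\zeta_m\rangle_q=\delta_{m,n}\sum_{\pi\in S_n}q^{i(\pi)}\prod_{k=1}^n\langle\xi_k,\zeta_{\pi(k)}\rangle_U,$$ with $i(\pi)$ the number of inversions of $\pi$. For $\xi\in\mathcal H$, $c_q(\xi)$ is the bounded operator with $c_q(\xi)\Omega=\xi$, $c_q(\xi)(\xi_1\otimes\cdots\otimes\xi_n)=\xi\otimes\xi_1\otimes\cdots\otimes\xi_n$. Set $s_q(\xi)=c_q(\xi)+c_q(\xi)^*$ and $M_q=\Gamma_q(\mathcal H_{\mathbb R},U_t)''=\{s_q(\xi):\xi\in\mathcal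 H_{\mathbb R}\}''\subset\mathbf B(\mathcal F_q(\mathcal H))$. *)

theory Defs
  imports "HOL-Analysis.Analysis" "HOL-Library.Poly_Mapping" "HOL-Combinatorics.Permutations"
begin

section \<open>Complex Hilbert spaces\<close>

class complex_vector = real_vector +
  fixes scaleC :: "complex \<Rightarrow> 'a \<Rightarrow> 'a"  (infixr \<open>*\<^sub>C\<close> 75)
  assumes scaleC_add_right: "c *\<^sub>C (x + y) = c *\<^sub>C x + c *\<^sub>C y"
    and scaleC_add_left: "(c + d) *\<^sub>C x = c *\<^sub>C x + d *\<^sub>C x"
    and scaleC_scaleC: "c *\<^sub>C d *\<^sub>C x = (c * d) *\<^sub>C x"
    and scaleC_one: "1 *\<^sub>C x = x"
    and scaleR_scaleC: "r *\<^sub>R x = complex_of_real r *\<^sub>C x"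

text \<open>The inner product is linear in the second variable. The norm and topology are those of the
  underlying real inner product space, whose inner product is the real part of \<open>cinner\<close>.\<close>

class complex_inner = complex_vector + real_inner +
  fixes cinner :: "'a \<Rightarrow> 'a \<Rightarrow> complex"
  assumes cinner_commute: "cinner x y = cnj (cinner y x)"
    and cinner_add_right: "cinner x (y + z) = cinner x y + cinner x z"
    and cinner_scaleC_right: "cinner x (c *\<^sub>C y) = c * cinner x y"
    and inner_eq_Re_cinner: "inner x y = Re (cinner x y)"

class chilbert_space = complex_inner + complete_space

lemma cinner_add_left: "cinner (x + y) z = cinner x z + cinner y z"
  by (metis cinner_add_right cinner_commute complex_cnj_add)

lemma cinner_scaleC_left: "cinner (c *\<^sub>C x) y = cnj c * cinner x y"
  by (metis cinner_scaleC_right cinner_commute complex_cnj_mult)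

definition clinear :: "('a::complex_vector \<Rightarrow> 'b::complex_vector) \<Rightarrow> bool" where
  "clinear f \<longleftrightarrow> (\<forall>x y. f (x + y) = f x + f y) \<and> (\<forall>c x. f (c *\<^sub>C x) = c *\<^sub>C f x)"

definition bounded_clinear :: "('a::complex_inner \<Rightarrow> 'b::complex_inner) \<Rightarrow> bool" where
  "bounded_clinear f \<longleftrightarrow> clinear f \<and> (\<exists>K. \<forall>x. norm (f x) \<le> norm x * K)"

definition cadjoint :: "('a::complex_inner \<Rightarrow> 'b::complex_inner) \<Rightarrow> 'b \<Rightarrow> 'a" where
  "cadjoint T = (THE S. \<forall>x y. cinner (S x) y = cinner x (T y))"

text \<open>\<open>j\<close> exhibits its codomain as the completion of the complex vector space \<open>'v\<close> with respect
  to the inner product \<open>form\<close>. Completions are determined by this up to a unique unitary that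
  commutes with the embeddings of \<open>'v\<close>.\<close>

definition is_completion ::
    "('v::complex_vector \<Rightarrow> 'v \<Rightarrow> complex) \<Rightarrow> ('v \<Rightarrow> 'h::chilbert_space) \<Rightarrow> bool" where
  "is_completion form j \<longleftrightarrow>
     clinear j \<and> (\<forall>x y. cinner (j x) (j y) = form x y) \<and> closure (range j) = UNIV"

section \<open>Von Neumann algebras\<close>

definition commutant :: "('h::chilbert_space \<Rightarrow> 'h) set \<Rightarrow> ('h \<Rightarrow> 'h) set" where
  "commutant S = {T. bounded_clinear T \<and> (\<forall>X\<in>S. T \<circ> X = X \<circ> T)}"

definition von_neumann_algebra :: "('h::chilbert_space \<Rightarrow> 'h) set \<Rightarrow> bool" where
  "von_neumann_algebra M \<longleftrightarrow>
     (\<forall>T\<in>M. bounded_clinear T \<and> cadjoint T \<in> M) \<and> commutant (commutant M) = M"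

definition factor :: "('h::chilbert_space \<Rightarrow> 'h) set \<Rightarrow> bool" where
  "factor M \<longleftrightarrow> von_neumann_algebra M \<and> M \<inter> commutant M = range (\<lambda>c x. c *\<^sub>C x)"

section \<open>Complexification\<close>

datatype 'a complexification = Complexify (re: 'a) (im: 'a)

instantiation complexification :: (real_inner) complex_inner
begin

definition zero_complexification :: "'a complexification" where
  "0 = Complexify 0 0"
definition plus_complexification :: "'a complexification \<Rightarrow> 'a complexification \<Rightarrow> 'a complexification" where
  "x + y = Complexify (re x + re y) (im x + im y)"
definition minus_complexification :: "'a complexification \<Rightarrow> 'a complexification \<Rightarrow> 'a complexification" where
  "x - y = Complexify (re x - re y) (im x - im y)"
definition uminus_complexification :: "'a complexification \<Rightarrow> 'a complexification" where
  "- x = Complexify (- re x) (- im x)"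
definition scaleR_complexification :: "real \<Rightarrow> 'a complexification \<Rightarrow> 'a complexification" where
  "r *\<^sub>R x = Complexify (r *\<^sub>R re x) (r *\<^sub>R im x)"
definition scaleC_complexification :: "complex \<Rightarrow> 'a complexification \<Rightarrow> 'a complexification" where
  "c *\<^sub>C x =
    Complexify (Re c *\<^sub>R re x - Im c *\<^sub>R im x) (Re c *\<^sub>R im x + Im c *\<^sub>R re x)"
definition cinner_complexification :: "'a complexification \<Rightarrow> 'a complexification \<Rightarrow> complex" where
  "cinner x y =
    Complex (inner (re x) (re y) + inner (im x) (im y)) (inner (re x) (im y) - inner (im x) (re y))"
definition inner_complexification :: "'a complexification \<Rightarrow> 'a complexification \<Rightarrow> real" where
  "inner x y = Re (cinner x y)" for x y :: "'a complexification"
definition norm_complexification :: "'a complexification \<Rightarrow> real" where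
  "norm x = sqrt (inner x x)" for x :: "'a complexification"
definition sgn_complexification :: "'a complexification \<Rightarrow> 'a complexification" where
  "sgn x = inverse (norm x) *\<^sub>R x" for x :: "'a complexification"
definition dist_complexification :: "'a complexification \<Rightarrow> 'a complexification \<Rightarrow> real" where
  "dist x y = norm (x - y)" for x y :: "'a complexification"
definition uniformity_complexification :: "('a complexification \<times> 'a complexification) filter" where
  "uniformity = (INF e\<in>{0<..}. principal {(x, y :: 'a complexification). dist x y < e})"
definition open_complexification :: "'a complexification set \<Rightarrow> bool" where
  "open U \<longleftrightarrow> (\<forall>x\<in>U. eventually (\<lambda>(x', y). x' = x \<longrightarrow> y \<in> U) uniformity)"
  for U :: "'a complexification set"

lemmas complexification_defs = zero_complexification_def plus_complexification_def
  minus_complexification_def uminus_complexification_def scaleR_complexification_def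
  scaleC_complexification_def cinner_complexification_def inner_complexification_def

instance
proof
  show "inner x x = 0 \<longleftrightarrow> x = 0" for x :: "'a complexification"
    by (cases x) (simp add: complexification_defs add_nonneg_eq_0_iff)
qed (auto simp: complexification_defs norm_complexification_def sgn_complexification_def
    dist_complexification_def uniformity_complexification_def open_complexification_def
    complex_eq_iff inner_commute inner_add_left inner_add_right inner_diff_left inner_diff_right
    algebra_simps intro: complexification.expand)

end

instance complexification :: ("{real_inner, complete_space}") chilbert_space
proof
  fix X :: "nat \<Rightarrow> 'a complexification"
  assume X: "Cauchy X"
  have norm_eq: "norm x = sqrt ((norm (re x))\<^sup>2 + (norm (im x))\<^sup>2)" for x :: "'a complexification"
    by (simp add: norm_complexification_def complexification_defs power2_norm_eq_inner)
  have re_le: "dist (re x) (re y) \<le> dist x y" for x y :: "'a complexification"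
    by (simp add: dist_norm norm_eq complexification_defs)
  have im_le: "dist (im x) (im y) \<le> dist x y" for x y :: "'a complexification"
    by (simp add: dist_norm norm_eq complexification_defs)
  have "Cauchy (\<lambda>n. re (X n))" "Cauchy (\<lambda>n. im (X n))"
    using X unfolding Cauchy_def by (meson re_le im_le le_less_trans)+
  then obtain a b where "(\<lambda>n. re (X n)) \<longlonglongrightarrow> a" "(\<lambda>n. im (X n)) \<longlonglongrightarrow> b"
    using Cauchy_convergent_iff convergent_def by metis
  then have "(\<lambda>n. sqrt ((norm (re (X n) - a))\<^sup>2 + (norm (im (X n) - b))\<^sup>2)) \<longlonglongrightarrow>
      sqrt ((norm (a - a))\<^sup>2 + (norm (b - b))\<^sup>2)"
    by (intro tendsto_intros)
  then have "(\<lambda>n. dist (X n) (Complexify a b)) \<longlonglongrightarrow> 0"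
    by (simp add: dist_norm norm_eq complexification_defs)
  then show "convergent X"
    unfolding convergent_def using tendsto_dist_iff by blast
qed

definition complexify_map :: "('a \<Rightarrow> 'a) \<Rightarrow> 'a complexification \<Rightarrow> 'a complexification" where
  "complexify_map f x = Complexify (f (re x)) (f (im x))"

section \<open>The deformed inner product\<close>

definition strongly_continuous_orthogonal_rep :: "(real \<Rightarrow> 'a::real_inner \<Rightarrow> 'a) \<Rightarrow> bool" where
  "strongly_continuous_orthogonal_rep U \<longleftrightarrow>
     (\<forall>t. orthogonal_transformation (U t)) \<and> U 0 = id \<and> (\<forall>s t. U (s + t) = U s \<circ> U t) \<and>
     (\<forall>x. continuous_on UNIV (\<lambda>t. U t x))"

text \<open>The graph of the analytic generator \<open>A\<close> of a one-parameter unitary group \<open>V\<close>: a pair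
  \<open>(\<xi>, \<eta>)\<close> belongs to it iff \<open>t \<mapsto> V t \<xi>\<close> extends to a continuous function on the closed strip
  \<open>-1 \<le> Im z \<le> 0\<close> that is holomorphic in the interior and takes the value \<open>\<eta>\<close> at \<open>-\<i>\<close>.
  Since \<open>V t = A\<^sup>i\<^sup>t\<close>, this extension is \<open>z \<mapsto> A\<^sup>i\<^sup>z \<xi>\<close>, with value \<open>A \<xi>\<close> at \<open>-\<i>\<close>.\<close>

definition analytic_generator :: "(real \<Rightarrow> 'c::complex_inner \<Rightarrow> 'c) \<Rightarrow> ('c \<times> 'c) set" where
  "analytic_generator V = {(\<xi>, \<eta>). \<exists>f :: complex \<Rightarrow> 'c.
     continuous_on {z. -1 \<le> Im z \<and> Im z \<le> 0} f \<and>
     (\<forall>z. -1 < Im z \<and> Im z < 0 \<longrightarrow> (\<exists>D. (f has_derivative (\<lambda>h. h *\<^sub>C D)) (at z))) \<and>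
     (\<forall>t. f (complex_of_real t) = V t \<xi>) \<and> f (- \<i>) = \<eta>}"

text \<open>\<open>2 / (1 + T)\<close> for an operator \<open>T\<close> given by its graph.\<close>

definition two_over_one_plus :: "('c \<times> 'c) set \<Rightarrow> 'c \<Rightarrow> 'c::complex_inner" where
  "two_over_one_plus T \<xi> = 2 *\<^sub>R (THE \<zeta>. \<exists>\<omega>. (\<zeta>, \<omega>) \<in> T \<and> \<zeta> + \<omega> = \<xi>)"

definition inner_U :: "(real \<Rightarrow> 'a::real_inner \<Rightarrow> 'a) \<Rightarrow>
    'a complexification \<Rightarrow> 'a complexification \<Rightarrow> complex" where
  "inner_U U \<xi> \<eta> =
     cinner (two_over_one_plus ((analytic_generator (\<lambda>t. complexify_map (U t)))\<inverse>) \<xi>) \<eta>"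

section \<open>The algebraic Fock space\<close>

text \<open>The direct sum over \<open>n \<ge> 0\<close> of the algebraic tensor powers of a complex vector space, as the
  quotient of the free complex vector space on all finite words of vectors by the multilinearity
  relations. The class of a word \<open>[\<xi>\<^sub>1, \<dots>, \<xi>\<^sub>n]\<close> is the elementary tensor
  \<open>\<xi>\<^sub>1 \<otimes> \<dots> \<otimes> \<xi>\<^sub>n\<close>, and the class of the empty word is the vacuum vector.\<close>

definition free_scale :: "complex \<Rightarrow> ('w \<Rightarrow>\<^sub>0 complex) \<Rightarrow> ('w \<Rightarrow>\<^sub>0 complex)" where
  "free_scale c a = Poly_Mapping.map ((*) c) a"

inductive_set multilinear_relations :: "('h::complex_vector list \<Rightarrow>\<^sub>0 complex) set" where
  zero: "0 \<in> multilinear_relations"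
| plus: "a \<in> multilinear_relations \<Longrightarrow> b \<in> multilinear_relations \<Longrightarrow> a + b \<in> multilinear_relations"
| scale: "a \<in> multilinear_relations \<Longrightarrow> free_scale c a \<in> multilinear_relations"
| additive: "Poly_Mapping.single (xs @ (x + y) # ys) 1 - Poly_Mapping.single (xs @ x # ys) 1
    - Poly_Mapping.single (xs @ y # ys) 1 \<in> multilinear_relations"
| homogeneous: "Poly_Mapping.single (xs @ (c *\<^sub>C x) # ys) 1 - Poly_Mapping.single (xs @ x # ys) c
    \<in> multilinear_relations"

definition multilinear_equiv ::
    "('h::complex_vector list \<Rightarrow>\<^sub>0 complex) \<Rightarrow> ('h list \<Rightarrow>\<^sub>0 complex) \<Rightarrow> bool" where
  "multilinear_equiv a b \<longleftrightarrow> a - b \<in> multilinear_relations"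

lemma lookup_free_scale [simp]:
  "Poly_Mapping.lookup (free_scale c a) w = c * Poly_Mapping.lookup a w"
  by (simp add: free_scale_def Poly_Mapping.map.rep_eq when_def)

lemma multilinear_relations_uminus:
  assumes "a \<in> multilinear_relations"
  shows "- a \<in> multilinear_relations"
proof -
  have "free_scale (- 1) a = - a"
    by (rule poly_mapping_eqI) simp
  then show ?thesis
    using multilinear_relations.scale[OF assms, of "- 1"] by simp
qed

quotient_type (overloaded) 'h algebraic_fock = "'h::complex_vector list \<Rightarrow>\<^sub>0 complex" / multilinear_equiv
proof (rule equivpI)
  show "reflp multilinear_equiv"
    by (simp add: reflp_def multilinear_equiv_def multilinear_relations.zero)
  show "symp multilinear_equiv"
    unfolding symp_def multilinear_equiv_def
    by (metis minus_diff_eq multilinear_relations_uminus)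
  show "transp multilinear_equiv"
    unfolding transp_def multilinear_equiv_def
    by (metis (no_types, lifting) add.commute diff_add_cancel add_diff_eq multilinear_relations.plus)
qed

instantiation algebraic_fock :: (complex_vector) complex_vector
begin

lift_definition zero_algebraic_fock :: "'a algebraic_fock" is 0 .

lift_definition plus_algebraic_fock :: "'a algebraic_fock \<Rightarrow> 'a algebraic_fock \<Rightarrow> 'a algebraic_fock" is "(+)"
  unfolding multilinear_equiv_def
  by (metis add_diff_add multilinear_relations.plus)

lift_definition uminus_algebraic_fock :: "'a algebraic_fock \<Rightarrow> 'a algebraic_fock" is uminus
  unfolding multilinear_equiv_def
  by (metis minus_diff_minus multilinear_relations_uminus)

definition minus_algebraic_fock :: "'a algebraic_fock \<Rightarrow> 'a algebraic_fock \<Rightarrow> 'a algebraic_fock" where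
  "minus_algebraic_fock x y = x + - y"

lift_definition scaleC_algebraic_fock :: "complex \<Rightarrow> 'a algebraic_fock \<Rightarrow> 'a algebraic_fock" is free_scale
proof -
  fix c and a b :: "'a list \<Rightarrow>\<^sub>0 complex"
  assume "multilinear_equiv a b"
  moreover have "free_scale c a - free_scale c b = free_scale c (a - b)"
    by (rule poly_mapping_eqI) (simp add: lookup_minus algebra_simps)
  ultimately show "multilinear_equiv (free_scale c a) (free_scale c b)"
    by (simp add: multilinear_equiv_def multilinear_relations.scale)
qed

definition scaleR_algebraic_fock :: "real \<Rightarrow> 'a algebraic_fock \<Rightarrow> 'a algebraic_fock" where
  "scaleR_algebraic_fock r x = complex_of_real r *\<^sub>C x"

lemma multilinear_equivI: "a = b \<Longrightarrow> multilinear_equiv a b"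
  by (simp add: multilinear_equiv_def multilinear_relations.zero)

instance
proof
  fix x y z :: "'a algebraic_fock" and c d :: complex and r s :: real
  show "x + y + z = x + (y + z)"
    by transfer (simp add: multilinear_equivI ac_simps)
  show "x + y = y + x"
    by transfer (simp add: multilinear_equivI ac_simps)
  show "0 + x = x"
    by transfer (simp add: multilinear_equivI)
  show "- x + x = 0"
    by transfer (simp add: multilinear_equivI)
  show "x - y = x + - y"
    by (simp add: minus_algebraic_fock_def)
  show 1: "c *\<^sub>C (x + y) = c *\<^sub>C x + c *\<^sub>C y" for c x and y :: "'a algebraic_fock"
    by transfer (rule multilinear_equivI, rule poly_mapping_eqI, simp add: lookup_add algebra_simps)
  show 2: "(c + d) *\<^sub>C x = c *\<^sub>C x + d *\<^sub>C x" for c d and x :: "'a algebraic_fock"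
    by transfer (rule multilinear_equivI, rule poly_mapping_eqI, simp add: lookup_add algebra_simps)
  show 3: "c *\<^sub>C d *\<^sub>C x = (c * d) *\<^sub>C x" for c d and x :: "'a algebraic_fock"
    by transfer (rule multilinear_equivI, rule poly_mapping_eqI, simp)
  show 4: "1 *\<^sub>C x = x" for x :: "'a algebraic_fock"
    by transfer (rule multilinear_equivI, rule poly_mapping_eqI, simp)
  show "r *\<^sub>R (x + y) = r *\<^sub>R x + r *\<^sub>R y" "(r + s) *\<^sub>R x = r *\<^sub>R x + s *\<^sub>R x"
    "r *\<^sub>R s *\<^sub>R x = (r * s) *\<^sub>R x" "1 *\<^sub>R x = x" "r *\<^sub>R x = complex_of_real r *\<^sub>C x"
    by (simp_all add: scaleR_algebraic_fock_def 1 2 3 4)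
qed

end

lift_definition tensor :: "'h::complex_vector list \<Rightarrow> 'h algebraic_fock" is
  "\<lambda>xs. Poly_Mapping.single xs 1" .

section \<open>The q-deformed inner product\<close>

definition inversions :: "nat \<Rightarrow> (nat \<Rightarrow> nat) \<Rightarrow> nat" where
  "inversions n \<pi> = card {(i, j). i < j \<and> j < n \<and> \<pi> j < \<pi> i}"

definition q_gram :: "real \<Rightarrow> 'h::complex_inner list \<Rightarrow> 'h list \<Rightarrow> complex" where
  "q_gram q xs ys = (if length xs = length ys then
     \<Sum>\<pi> | \<pi> permutes {..<length xs}. complex_of_real q ^ inversions (length xs) \<pi> *
       (\<Prod>k<length xs. cinner (xs ! k) (ys ! \<pi> k)) else 0)"

definition free_q_inner ::
    "real \<Rightarrow> ('h::complex_inner list \<Rightarrow>\<^sub>0 complex) \<Rightarrow> ('h list \<Rightarrow>\<^sub>0 complex) \<Rightarrow> complex" where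
  "free_q_inner q a b = (\<Sum>xs\<in>Poly_Mapping.keys a. \<Sum>ys\<in>Poly_Mapping.keys b.
     cnj (Poly_Mapping.lookup a xs) * Poly_Mapping.lookup b ys * q_gram q xs ys)"

lemma q_gram_linear_right:
  "q_gram q ws (xs @ (x + y) # ys) = q_gram q ws (xs @ x # ys) + q_gram q ws (xs @ y # ys)"
  "q_gram q ws (xs @ (c *\<^sub>C x) # ys) = c * q_gram q ws (xs @ x # ys)"
proof -
  let ?n = "length ws" and ?i = "length xs"
  let ?P = "\<lambda>\<pi> z. \<Prod>k<?n. cinner (ws ! k) ((xs @ z # ys) ! \<pi> k)"
  have split: "?P \<pi> z = cinner (ws ! inv \<pi> ?i) z *
      (\<Prod>k\<in>{..<?n} - {inv \<pi> ?i}. cinner (ws ! k) ((xs @ 0 # ys) ! \<pi> k))"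
    if "\<pi> permutes {..<?n}" "?i < ?n" for \<pi> z
  proof -
    have bij: "\<pi> (inv \<pi> ?i) = ?i" "inv \<pi> ?i \<in> {..<?n}"
      using that permutes_inverses(1) permutes_in_image[OF permutes_inv[OF that(1)], of ?i] by auto
    have "(xs @ z # ys) ! \<pi> k = (xs @ 0 # ys) ! \<pi> k" if "k \<noteq> inv \<pi> ?i" for k
    proof -
      have "\<pi> k \<noteq> ?i"
        using that \<open>\<pi> permutes _\<close> by (metis permutes_inverses(2))
      then show ?thesis
        by (simp add: nth_append nth_Cons split: nat.split)
    qed
    then show ?thesis
      using bij by (subst prod.remove[of _ "inv \<pi> ?i"]) auto
  qed
  have len: "q_gram q ws (xs @ z # ys) = (if Suc (?i + length ys) = ?n then
      \<Sum>\<pi> | \<pi> permutes {..<?n}. complex_of_real q ^ inversions ?n \<pi> * ?P \<pi> z else 0)" for z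
    unfolding q_gram_def by (intro if_cong refl) auto
  show "q_gram q ws (xs @ (x + y) # ys) = q_gram q ws (xs @ x # ys) + q_gram q ws (xs @ y # ys)"
    by (auto simp: len sum.distrib[symmetric] split cinner_add_right algebra_simps
        intro!: sum.cong)
  show "q_gram q ws (xs @ (c *\<^sub>C x) # ys) = c * q_gram q ws (xs @ x # ys)"
    by (auto simp: len sum_distrib_left split cinner_scaleC_right algebra_simps
        intro!: sum.cong)
qed

lemma q_gram_antilinear_left:
  "q_gram q (xs @ (x + y) # ys) ws = q_gram q (xs @ x # ys) ws + q_gram q (xs @ y # ys) ws"
  "q_gram q (xs @ (c *\<^sub>C x) # ys) ws = cnj c * q_gram q (xs @ x # ys) ws"
proof -
  let ?n = "length ws" and ?i = "length xs"
  let ?P = "\<lambda>\<pi> z. \<Prod>k<?n. cinner ((xs @ z # ys) ! k) (ws ! \<pi> k)"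
  have split: "?P \<pi> z = cinner z (ws ! \<pi> ?i) *
      (\<Prod>k\<in>{..<?n} - {?i}. cinner ((xs @ 0 # ys) ! k) (ws ! \<pi> k))"
    if "?i < ?n" for \<pi> z
  proof -
    have "(xs @ z # ys) ! k = (xs @ 0 # ys) ! k" if "k \<noteq> ?i" for k
      using that by (simp add: nth_append nth_Cons split: nat.split)
    then show ?thesis
      using that by (subst prod.remove[of _ ?i]) auto
  qed
  have len: "q_gram q (xs @ z # ys) ws = (if Suc (?i + length ys) = ?n then
      \<Sum>\<pi> | \<pi> permutes {..<?n}. complex_of_real q ^ inversions ?n \<pi> * ?P \<pi> z else 0)" for z
    by (simp add: q_gram_def)
  show "q_gram q (xs @ (x + y) # ys) ws = q_gram q (xs @ x # ys) ws + q_gram q (xs @ y # ys) ws"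
    by (auto simp: len sum.distrib[symmetric] split cinner_add_left algebra_simps intro!: sum.cong)
  show "q_gram q (xs @ (c *\<^sub>C x) # ys) ws = cnj c * q_gram q (xs @ x # ys) ws"
    by (auto simp: len sum_distrib_left split cinner_scaleC_left algebra_simps intro!: sum.cong)
qed

lemma free_q_inner_superset:
  assumes "finite S" "finite T" "Poly_Mapping.keys a \<subseteq> S" "Poly_Mapping.keys b \<subseteq> T"
  shows "free_q_inner q a b = (\<Sum>xs\<in>S. \<Sum>ys\<in>T.
     cnj (Poly_Mapping.lookup a xs) * Poly_Mapping.lookup b ys * q_gram q xs ys)"
proof -
  have "free_q_inner q a b = (\<Sum>xs\<in>Poly_Mapping.keys a. \<Sum>ys\<in>T.
     cnj (Poly_Mapping.lookup a xs) * Poly_Mapping.lookup b ys * q_gram q xs ys)"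
    unfolding free_q_inner_def
    by (intro sum.cong refl sum.mono_neutral_left) (use assms in \<open>auto simp: in_keys_iff\<close>)
  also have "\<dots> = (\<Sum>xs\<in>S. \<Sum>ys\<in>T.
     cnj (Poly_Mapping.lookup a xs) * Poly_Mapping.lookup b ys * q_gram q xs ys)"
    by (intro sum.mono_neutral_left) (use assms in \<open>auto simp: in_keys_iff\<close>)
  finally show ?thesis .
qed

lemma free_q_inner_add_right: "free_q_inner q a (b + c) = free_q_inner q a b + free_q_inner q a c"
proof -
  let ?T = "Poly_Mapping.keys b \<union> Poly_Mapping.keys c"
  show ?thesis
    by (simp add: free_q_inner_superset[of "Poly_Mapping.keys a" ?T] Poly_Mapping.keys_add
        lookup_add sum.distrib[symmetric] algebra_simps)
qed

lemma free_q_inner_add_left: "free_q_inner q (b + c) a = free_q_inner q b a + free_q_inner q c a"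
proof -
  let ?T = "Poly_Mapping.keys b \<union> Poly_Mapping.keys c"
  show ?thesis
    by (simp add: free_q_inner_superset[of ?T "Poly_Mapping.keys a"] Poly_Mapping.keys_add
        lookup_add sum.distrib[symmetric] algebra_simps)
qed

lemma keys_free_scale: "Poly_Mapping.keys (free_scale c a) \<subseteq> Poly_Mapping.keys a"
  by (auto simp: in_keys_iff)

lemma free_q_inner_scale_right: "free_q_inner q a (free_scale c b) = c * free_q_inner q a b"
  by (simp add: free_q_inner_superset[of "Poly_Mapping.keys a" "Poly_Mapping.keys b"]
      keys_free_scale sum_distrib_left algebra_simps)

lemma free_q_inner_scale_left: "free_q_inner q (free_scale c b) a = cnj c * free_q_inner q b a"
  by (simp add: free_q_inner_superset[of "Poly_Mapping.keys b" "Poly_Mapping.keys a"]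
      keys_free_scale sum_distrib_left algebra_simps)

lemma free_q_inner_diff_right: "free_q_inner q a (b - c) = free_q_inner q a b - free_q_inner q a c"
  using free_q_inner_add_right[of q a "b - c" c] by simp

lemma free_q_inner_diff_left: "free_q_inner q (b - c) a = free_q_inner q b a - free_q_inner q c a"
  using free_q_inner_add_left[of q "b - c" c a] by simp

lemma free_q_inner_single_right: "free_q_inner q a (Poly_Mapping.single w c) =
    (\<Sum>xs\<in>Poly_Mapping.keys a. cnj (Poly_Mapping.lookup a xs) * c * q_gram q xs w)"
  by (simp add: free_q_inner_superset[of "Poly_Mapping.keys a" "{w}"])

lemma free_q_inner_single_left: "free_q_inner q (Poly_Mapping.single w c) a =
    (\<Sum>xs\<in>Poly_Mapping.keys a. cnj c * Poly_Mapping.lookup a xs * q_gram q w xs)"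
  by (simp add: free_q_inner_superset[of "{w}" "Poly_Mapping.keys a"])

lemma free_q_inner_relations:
  assumes "r \<in> multilinear_relations"
  shows "free_q_inner q a r = 0" "free_q_inner q r a = 0"
proof -
  have "free_q_inner q a r = 0 \<and> free_q_inner q r a = 0"
    using assms
  proof induction
    case zero
    show ?case by (simp add: free_q_inner_def)
  next
    case (plus b c)
    then show ?case by (simp add: free_q_inner_add_left free_q_inner_add_right)
  next
    case (scale b c)
    then show ?case by (simp add: free_q_inner_scale_left free_q_inner_scale_right)
  next
    case additive
    show ?case
      by (simp add: free_q_inner_diff_left free_q_inner_diff_right
          free_q_inner_add_left free_q_inner_add_right free_q_inner_single_left
          free_q_inner_single_right q_gram_linear_right(1) q_gram_antilinear_left(1)
          algebra_simps sum.distrib)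
  next
    case homogeneous
    show ?case
      by (simp add: free_q_inner_diff_left free_q_inner_diff_right free_q_inner_single_left
          free_q_inner_single_right q_gram_linear_right(2) q_gram_antilinear_left(2)
          algebra_simps)
  qed
  then show "free_q_inner q a r = 0" "free_q_inner q r a = 0" by auto
qed

lift_definition q_inner ::
    "real \<Rightarrow> 'h::complex_inner algebraic_fock \<Rightarrow> 'h algebraic_fock \<Rightarrow> complex" is free_q_inner
proof -
  fix q and a a' b b' :: "'h list \<Rightarrow>\<^sub>0 complex"
  assume "multilinear_equiv a a'" "multilinear_equiv b b'"
  then have "free_q_inner q (a - a') b = 0" "free_q_inner q a' (b - b') = 0"
    by (auto simp: multilinear_equiv_def free_q_inner_relations)
  then show "free_q_inner q a b = free_q_inner q a' b'"
    by (simp add: free_q_inner_diff_left free_q_inner_diff_right)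
qed

lemma q_inner_tensor: "q_inner q (tensor xs) (tensor ys) = q_gram q xs ys"
  by transfer (simp add: free_q_inner_def)

section \<open>The q-Araki-Woods von Neumann algebra\<close>

text \<open>Below, \<open>jF\<close> is the embedding of the algebraic Fock space over \<open>\<H>\<close> into the \<open>q\<close>-Fock space,
  and \<open>jH\<close> is the embedding of the complexification of \<open>\<H>\<^sub>\<real>\<close> into its completion \<open>\<H>\<close>.\<close>

definition creation :: "('h::chilbert_space algebraic_fock \<Rightarrow> 'f::chilbert_space) \<Rightarrow> 'h \<Rightarrow> 'f \<Rightarrow> 'f" where
  "creation jF \<xi> =
     (THE C. bounded_clinear C \<and> (\<forall>xs. C (jF (tensor xs)) = jF (tensor (\<xi> # xs))))"

definition q_gaussian :: "('h::chilbert_space algebraic_fock \<Rightarrow> 'f::chilbert_space) \<Rightarrow> 'h \<Rightarrow> 'f \<Rightarrow> 'f" where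
  "q_gaussian jF \<xi> = (\<lambda>x. creation jF \<xi> x + cadjoint (creation jF \<xi>) x)"

definition q_araki_woods :: "('a::real_inner complexification \<Rightarrow> 'h::chilbert_space) \<Rightarrow>
    ('h algebraic_fock \<Rightarrow> 'f::chilbert_space) \<Rightarrow> ('f \<Rightarrow> 'f) set" where
  "q_araki_woods jH jF =
     commutant (commutant (range (\<lambda>\<xi>. q_gaussian jF (jH (Complexify \<xi> 0)))))"

end

(* Let e and e1 be eigenvectors of the analytic generator that span the complexified plane. They are
   conjugate to each other and orthogonal, and e1 is the shorter one in the deformed norm. The left
   operator a = c(e) + c(e1)^* belongs to the algebra, and b = r(e) + mu r(e1)^*, built from right
   creations, belongs to its commutant. For mu = |e|^2 / |e1|^2 the commuting positive operators
   h = a^* a and k = b b^* / mu agree on the vacuum, so a central T satisfies h v = k v for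
   v = T Omega.

   Let u_m be the m-th Chebyshev polynomial of h (equivalently of k), scaled, applied to Omega.
   Averages of <u_m, [Y, h] u_m> telescope to zero. The commutators [r(e)^*, h], together with the
   q-commutation relations, then force a u_m to converge weakly to zero on average. On words
   containing letters outside {e, e1} the left and right actions mix up to compact operators, so the
   component v1 of v in the span of those words satisfies a v1 = 0, and a^* v1 = 0 with e and e1
   exchanged. Since |e1| < |e|, v1 = 0, that is, v lies in the Fock space of the plane. For a vector f
   orthogonal to the plane the left and right generators of f agree on Omega, hence c(f) v = r(f) v,
   which leaves only multiples of Omega for v. *)
theory Submission
  imports Defs "HOL-Complex_Analysis.Conformal_Mappings"
begin

section \<open>Complex Hilbert spaces\<close>

text \<open>The obstacle is that H may have infinite dimension, so that q^N (\<open>dil q\<close>),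
  by which left and right operators fail to commute, need not be compact. On the Fock space
  \<open>F0\<close> of the plane it is, since only finitely many words over {e, e1} have a given
  length; hence the projection \<open>E\<close> onto \<open>F0\<close> and the interest in operators
  that end in \<open>E\<close>. Chebyshev polynomials serve because 2 g u_m = u_(m+1) + u_(m-1)
  makes commutators telescope, while a conserved quantity keeps the orbit of a nonzero vector from
  decaying: a mean square that tends to zero forces a vector to vanish. A commutator with h yields
  only \<open>star a * y * dil q * y'\<close> with y, y' words in b and its adjoint. To replace q^N
  by the vacuum projection, all polynomials in the right creators and annihilators are shown to be
  insertable in front of q^N, and powers of one of them converge strongly to that projection on
  \<open>F0\<close>. Both h and k are needed because functions of h commute with right words and
  functions of k with left words: v is approximated by right words in one slot of an inner product
  and by left words in the other.\<close>

lemma scaleC_zero_right [simp]: "c *\<^sub>C (0::'a::complex_vector) = 0"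
  by (metis add_cancel_right_right scaleC_add_right)

lemma scaleC_zero_left [simp]: "0 *\<^sub>C (x::'a::complex_vector) = 0"
  by (metis add_cancel_right_right scaleC_add_left)

lemma scaleC_one' [simp]: "1 *\<^sub>C (x::'a::complex_vector) = x"
  by (rule scaleC_one)

lemma scaleC_minus_right: "c *\<^sub>C (- x) = - (c *\<^sub>C (x::'a::complex_vector))"
  by (metis add_eq_0_iff2 add.right_inverse scaleC_add_right scaleC_zero_right)

lemma scaleC_minus_left: "(- c) *\<^sub>C x = - (c *\<^sub>C (x::'a::complex_vector))"
  by (metis add_eq_0_iff2 add.right_inverse scaleC_add_left scaleC_zero_left)

lemma scaleC_diff_right: "c *\<^sub>C (x - y) = c *\<^sub>C x - c *\<^sub>C (y::'a::complex_vector)"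
  by (metis diff_conv_add_uminus scaleC_add_right scaleC_minus_right)

lemma scaleC_diff_left: "(c - d) *\<^sub>C x = c *\<^sub>C x - d *\<^sub>C (x::'a::complex_vector)"
  by (metis diff_conv_add_uminus scaleC_add_left scaleC_minus_left)

lemma scaleC_sum_right: "c *\<^sub>C sum f A = (\<Sum>x\<in>A. c *\<^sub>C (f x :: 'a::complex_vector))"
  by (induction A rule: infinite_finite_induct) (auto simp: scaleC_add_right)

lemma scaleC_eq_0_iff [simp]: "c *\<^sub>C (x::'a::complex_vector) = 0 \<longleftrightarrow> c = 0 \<or> x = 0"
proof
  assume "c *\<^sub>C x = 0"
  then have "c \<noteq> 0 \<Longrightarrow> x = 0"
    by (metis left_inverse scaleC_scaleC scaleC_one scaleC_zero_right)
  then show "c = 0 \<or> x = 0" by blast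
qed auto

lemma cinner_zero_right [simp]: "cinner x 0 = 0"
  by (metis cinner_scaleC_right mult_zero_left scaleC_zero_left)

lemma cinner_zero_left [simp]: "cinner 0 x = 0"
  by (metis cinner_commute cinner_zero_right complex_cnj_zero)

lemma cinner_minus_right: "cinner x (- y) = - cinner x y"
  by (metis add_eq_0_iff2 add.right_inverse cinner_add_right cinner_zero_right)

lemma cinner_minus_left: "cinner (- x) y = - cinner x y"
  by (metis add_eq_0_iff2 add.right_inverse cinner_add_left cinner_zero_left)

lemma cinner_diff_right: "cinner x (y - z) = cinner x y - cinner x z"
  by (metis diff_conv_add_uminus cinner_add_right cinner_minus_right)

lemma cinner_diff_left: "cinner (x - y) z = cinner x z - cinner y z"
  by (metis diff_conv_add_uminus cinner_add_left cinner_minus_left)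

lemma cinner_sum_right: "cinner x (sum f A) = (\<Sum>a\<in>A. cinner x (f a))"
  by (induction A rule: infinite_finite_induct) (auto simp: cinner_add_right)

lemma cinner_scaleR_right: "cinner x (r *\<^sub>R y) = of_real r * cinner x y"
  by (simp add: scaleR_scaleC cinner_scaleC_right)

lemma cinner_scaleR_left: "cinner (r *\<^sub>R x) y = of_real r * cinner x y"
  by (simp add: scaleR_scaleC cinner_scaleC_left)

lemmas cinner_simps = cinner_add_right cinner_add_left cinner_diff_right cinner_diff_left
  cinner_minus_right cinner_minus_left cinner_scaleC_right cinner_scaleC_left

lemma cinner_self: "cinner x x = of_real ((norm x)\<^sup>2)"
proof -
  have "Im (cinner x x) = 0"
    using cinner_commute[of x x] by (simp add: complex_eq_iff)
  moreover have "Re (cinner x x) = (norm x)\<^sup>2"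
    by (simp add: power2_norm_eq_inner inner_eq_Re_cinner)
  ultimately show ?thesis
    by (simp add: complex_eq_iff)
qed

lemma norm_scaleC: "norm (c *\<^sub>C x) = cmod c * norm (x::'a::complex_inner)"
proof -
  have "of_real ((norm (c *\<^sub>C x))\<^sup>2) = (of_real ((cmod c * norm x)\<^sup>2) :: complex)"
    by (simp add: cinner_self[symmetric] cinner_scaleC_left cinner_scaleC_right power_mult_distrib
        complex_norm_square[symmetric] mult_ac del: of_real_power of_real_mult)
       (simp add: complex_norm_square[symmetric] cinner_self)
  then have "(norm (c *\<^sub>C x))\<^sup>2 = (cmod c * norm x)\<^sup>2"
    using of_real_eq_iff by blast
  then show ?thesis
    by (simp add: power2_eq_iff_nonneg)
qed

lemma cinner_cauchy_schwarz: "cmod (cinner x y) \<le> norm x * norm y"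
proof (cases "cinner x y = 0")
  case False
  let ?u = "cnj (sgn (cinner x y))"
  have "cinner x (?u *\<^sub>C y) = of_real (cmod (cinner x y))"
    using False by (simp add: cinner_scaleC_right sgn_div_norm scaleR_conv_of_real field_simps
        complex_norm_square[symmetric] power2_eq_square)
  then have "cmod (cinner x y) = inner x (?u *\<^sub>C y)"
    by (simp add: inner_eq_Re_cinner)
  also have "\<dots> \<le> norm x * norm (?u *\<^sub>C y)"
    by (rule norm_cauchy_schwarz)
  also have "norm (?u *\<^sub>C y) = norm y"
    using False by (simp add: norm_scaleC norm_sgn)
  finally show ?thesis .
qed simp

lemma cinner_ext: "(\<And>y. cinner y x = cinner y z) \<Longrightarrow> x = z"
  by (metis cinner_diff_right cinner_self diff_self eq_iff_diff_eq_0 norm_eq_zero of_real_eq_0_iff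
      zero_eq_power2)

lemma cinner_eq_0_iff [simp]: "cinner x x = 0 \<longleftrightarrow> x = 0"
  by (simp add: cinner_self)

lemma bounded_bilinear_cinner: "bounded_bilinear (cinner :: 'a::complex_inner \<Rightarrow> _)"
  by (rule bounded_bilinear.intro)
    (auto simp: cinner_simps cinner_scaleR_left cinner_scaleR_right scaleR_conv_of_real
      intro!: exI[of _ 1] cinner_cauchy_schwarz)

lemmas tendsto_cinner [tendsto_intros] = bounded_bilinear.tendsto[OF bounded_bilinear_cinner]
lemmas continuous_on_cinner [continuous_intros] =
  bounded_bilinear.continuous_on[OF bounded_bilinear_cinner]

lemma bounded_linear_scaleC: "bounded_linear (\<lambda>x::'a::complex_inner. c *\<^sub>C x)"
  by (rule bounded_linear_intro[of _ "cmod c"])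
    (auto simp: scaleC_add_right norm_scaleC mult.commute scaleR_scaleC scaleC_scaleC)

lemmas tendsto_scaleC [tendsto_intros] = bounded_linear.tendsto[OF bounded_linear_scaleC]

lemma norm_add_orthogonal:
  assumes "cinner x y = 0"
  shows "(norm (x + y))\<^sup>2 = (norm x)\<^sup>2 + (norm y)\<^sup>2"
  using assms by (simp add: power2_norm_eq_inner inner_add_left inner_add_right inner_commute[of y x])
    (simp add: inner_eq_Re_cinner)

lemma bounded_clinear_bounded_linear: "bounded_clinear f \<Longrightarrow> bounded_linear f"
  unfolding bounded_clinear_def clinear_def
  by (metis bounded_linear_intro scaleR_scaleC)

section \<open>Closed subspaces\<close>

inductive_set cspan :: "'a::complex_vector set \<Rightarrow> 'a set" for S where
  cspan_zero: "0 \<in> cspan S"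
| cspan_base: "x \<in> S \<Longrightarrow> x \<in> cspan S"
| cspan_add: "x \<in> cspan S \<Longrightarrow> y \<in> cspan S \<Longrightarrow> x + y \<in> cspan S"
| cspan_scale: "x \<in> cspan S \<Longrightarrow> c *\<^sub>C x \<in> cspan S"

definition csubspace :: "'a::complex_vector set \<Rightarrow> bool" where
  "csubspace V \<longleftrightarrow> 0 \<in> V \<and> (\<forall>x\<in>V. \<forall>y\<in>V. x + y \<in> V) \<and> (\<forall>c. \<forall>x\<in>V. c *\<^sub>C x \<in> V)"

lemma csubspaceD:
  assumes "csubspace V"
  shows "0 \<in> V" "x \<in> V \<Longrightarrow> y \<in> V \<Longrightarrow> x + y \<in> V" "x \<in> V \<Longrightarrow> c *\<^sub>C x \<in> V"
    "x \<in> V \<Longrightarrow> - x \<in> V" "x \<in> V \<Longrightarrow> y \<in> V \<Longrightarrow> x - y \<in> V"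
proof -
  show *: "0 \<in> V" "x \<in> V \<Longrightarrow> y \<in> V \<Longrightarrow> x + y \<in> V" "x \<in> V \<Longrightarrow> c *\<^sub>C x \<in> V" for x y c
    using assms by (auto simp: csubspace_def)
  show **: "x \<in> V \<Longrightarrow> - x \<in> V" for x
    using *(3)[of x "-1"] by (simp add: scaleC_minus_left)
  show "x \<in> V \<Longrightarrow> y \<in> V \<Longrightarrow> x - y \<in> V"
    using *(2)[of x "-y"] ** by simp
qed

lemma csubspace_sum: "csubspace V \<Longrightarrow> (\<And>i. i \<in> A \<Longrightarrow> f i \<in> V) \<Longrightarrow> sum f A \<in> V"
  by (induction A rule: infinite_finite_induct) (auto simp: csubspaceD)

lemma csubspace_cspan: "csubspace (cspan S)"
  by (auto simp: csubspace_def intro: cspan.intros)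

lemma cspan_minimal: "csubspace V \<Longrightarrow> S \<subseteq> V \<Longrightarrow> cspan S \<subseteq> V"
proof
  fix x assume "csubspace V" "S \<subseteq> V" "x \<in> cspan S"
  from this(3,1,2) show "x \<in> V"
    by induction (auto simp: csubspaceD)
qed

lemma csubspace_closure:
  fixes V :: "'a::complex_inner set"
  assumes "csubspace V"
  shows "csubspace (closure V)"
  unfolding csubspace_def
proof (intro conjI ballI allI)
  show "0 \<in> closure V"
    using csubspaceD(1)[OF assms] closure_subset by blast
next
  fix x y assume "x \<in> closure V" "y \<in> closure V"
  then obtain f g where "\<forall>n. f n \<in> V" "f \<longlonglongrightarrow> x" "\<forall>n. g n \<in> V" "g \<longlonglongrightarrow> y"
    unfolding closure_sequential by metis
  then show "x + y \<in> closure V"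
    unfolding closure_sequential
    by (intro exI[of _ "\<lambda>n. f n + g n"]) (auto intro!: tendsto_intros csubspaceD[OF assms])
next
  fix c x assume "x \<in> closure V"
  then obtain f where "\<forall>n. f n \<in> V" "f \<longlonglongrightarrow> x"
    unfolding closure_sequential by metis
  then show "c *\<^sub>C x \<in> closure V"
    unfolding closure_sequential
    by (intro exI[of _ "\<lambda>n. c *\<^sub>C f n"]) (auto intro!: tendsto_intros csubspaceD[OF assms])
qed

lemma closure_cspan_minimal:
  fixes V :: "'a::complex_inner set"
  shows "csubspace V \<Longrightarrow> closed V \<Longrightarrow> S \<subseteq> V \<Longrightarrow> closure (cspan S) \<subseteq> V"
  by (simp add: closure_minimal cspan_minimal)

lemma csubspace_orthogonal: "csubspace {x. \<forall>s\<in>S. cinner s x = 0}"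
  by (auto simp: csubspace_def cinner_simps)

lemma closed_orthogonal: "closed {x. \<forall>s\<in>S. cinner s x = 0}"
proof -
  have "closed {x. cinner s x = 0}" for s :: 'a
    by (intro closed_Collect_eq continuous_intros)
  then have "closed (\<Inter>s\<in>S. {x. cinner s x = 0})"
    by (intro closed_INT) auto
  moreover have "(\<Inter>s\<in>S. {x. cinner s x = 0}) = {x. \<forall>s\<in>S. cinner s x = 0}"
    by auto
  ultimately show ?thesis by simp
qed

lemma orthogonal_closure_cspan:
  assumes "\<And>s. s \<in> S \<Longrightarrow> cinner x s = 0" and "y \<in> closure (cspan S)"
  shows "cinner x y = 0" "cinner y x = 0"
proof -
  have "closure (cspan S) \<subseteq> {y. \<forall>s\<in>{x}. cinner s y = 0}"
    by (rule closure_cspan_minimal[OF csubspace_orthogonal closed_orthogonal]) (use assms in auto)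
  then show "cinner x y = 0" using assms(2) by auto
  then show "cinner y x = 0" by (metis cinner_commute complex_cnj_zero)
qed

theorem orthogonal_projection:
  fixes V :: "'a::chilbert_space set"
  assumes V: "csubspace V" and cl: "closed V"
  shows "\<exists>y\<in>V. \<forall>v\<in>V. cinner v (x - y) = 0"
proof -
  define d where "d = Inf ((\<lambda>v. (norm (x - v))\<^sup>2) ` V)"
  have bdd: "bdd_below ((\<lambda>v. (norm (x - v))\<^sup>2) ` V)"
    by (rule bdd_belowI[of _ 0]) auto
  have d_le: "d \<le> (norm (x - v))\<^sup>2" if "v \<in> V" for v
    unfolding d_def by (rule cINF_lower[OF bdd that])
  have "\<exists>v\<in>V. (norm (x - v))\<^sup>2 < d + inverse (real (Suc n))" for n
  proof (rule ccontr)
    assume "\<not> ?thesis"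
    then have "d + inverse (real (Suc n)) \<le> (norm (x - v))\<^sup>2" if "v \<in> V" for v
      using that by force
    then have "d + inverse (real (Suc n)) \<le> d"
      unfolding d_def by (intro cINF_greatest) (use csubspaceD(1)[OF V] in auto)
    then show False by simp
  qed
  then obtain f where f: "\<And>n. f n \<in> V" "\<And>n. (norm (x - f n))\<^sup>2 < d + inverse (real (Suc n))"
    by metis
  \<comment> \<open>Parallelogram law: the midpoint of \<open>f m\<close> and \<open>f n\<close>
    lies in V, so its squared distance from x is at least d.\<close>
  have par: "(norm (f m - f n))\<^sup>2 \<le> 2 * inverse (real (Suc m)) + 2 * inverse (real (Suc n))" for m n
  proof -
    have "(1/2) *\<^sub>R (f m + f n) \<in> V"
      using f(1) by (auto simp: scaleR_scaleC intro!: csubspaceD(2,3)[OF V])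
    then have "d \<le> (norm (x - (1/2) *\<^sub>R (f m + f n)))\<^sup>2"
      by (rule d_le)
    moreover have "(norm (f m - f n))\<^sup>2 + 4 * (norm (x - (1/2) *\<^sub>R (f m + f n)))\<^sup>2 =
        2 * (norm (x - f m))\<^sup>2 + 2 * (norm (x - f n))\<^sup>2"
      by (simp add: power2_norm_eq_inner inner_diff_left inner_diff_right inner_add_left
          inner_add_right inner_commute algebra_simps)
    ultimately show ?thesis
      using f(2)[of m] f(2)[of n] by linarith
  qed
  have "Cauchy f"
  proof (rule metric_CauchyI)
    fix e :: real assume "e > 0"
    then obtain N where N: "inverse (real (Suc N)) < e\<^sup>2 / 4"
      using reals_Archimedean[of "e\<^sup>2 / 4"] by auto
    have "dist (f m) (f n) < e" if "m \<ge> N" "n \<ge> N" for m n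
    proof -
      have "inverse (real (Suc m)) \<le> inverse (real (Suc N))"
        "inverse (real (Suc n)) \<le> inverse (real (Suc N))"
        using that by (auto simp: field_simps)
      then have "(norm (f m - f n))\<^sup>2 < e\<^sup>2"
        using par[of m n] N by argo
      then show ?thesis
        using \<open>e > 0\<close> by (simp add: dist_norm power_less_imp_less_base)
    qed
    then show "\<exists>M. \<forall>m\<ge>M. \<forall>n\<ge>M. dist (f m) (f n) < e" by blast
  qed
  then obtain y where y: "f \<longlonglongrightarrow> y"
    using Cauchy_convergent convergent_def by blast
  have "y \<in> V"
    using closed_sequentially[OF cl] f(1) y by blast
  have "(norm (x - y))\<^sup>2 \<le> d"
  proof (rule LIMSEQ_le)
    show "(\<lambda>n. (norm (x - f n))\<^sup>2) \<longlonglongrightarrow> (norm (x - y))\<^sup>2"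
      by (intro tendsto_intros y)
    show "(\<lambda>n. d + inverse (real (Suc n))) \<longlonglongrightarrow> d"
      using tendsto_add[OF tendsto_const LIMSEQ_inverse_real_of_nat, of d] by simp
  qed (use f(2) in \<open>auto intro: less_imp_le\<close>)
  have "cinner v (x - y) = 0" if "v \<in> V" for v
  proof (cases "v = 0")
    case False
    \<comment> \<open>The component of x - y along v. Adding it to y cannot lower the minimal
      distance, so by Pythagoras it is zero.\<close>
    define c where "c = cinner v (x - y) / of_real ((norm v)\<^sup>2)"
    have "y + c *\<^sub>C v \<in> V"
      using \<open>y \<in> V\<close> that by (intro csubspaceD[OF V])
    then have "(norm (x - y))\<^sup>2 \<le> (norm (x - y - c *\<^sub>C v))\<^sup>2"
      using d_le[of "y + c *\<^sub>C v"] \<open>(norm (x - y))\<^sup>2 \<le> d\<close> by (metis diff_diff_add order_trans)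
    moreover have "(norm (x - y))\<^sup>2 = (norm (x - y - c *\<^sub>C v))\<^sup>2 + (norm (c *\<^sub>C v))\<^sup>2"
    proof -
      have "cinner (c *\<^sub>C v) (x - y - c *\<^sub>C v) = 0"
        using False by (simp only: cinner_diff_right[of _ "x - y"] cinner_scaleC_left
            cinner_scaleC_right cinner_self[of v] c_def) simp
      then show ?thesis
        using norm_add_orthogonal[of "c *\<^sub>C v" "x - y - c *\<^sub>C v"] by simp
    qed
    ultimately have "c *\<^sub>C v = 0" by simp
    then show ?thesis
      using False by (simp add: c_def)
  qed simp
  with \<open>y \<in> V\<close> show ?thesis by blast
qed

theorem riesz_representation:
  fixes \<phi> :: "'a::chilbert_space \<Rightarrow> complex"
  assumes add: "\<And>x y. \<phi> (x + y) = \<phi> x + \<phi> y" and scale: "\<And>c x. \<phi> (c *\<^sub>C x) = c * \<phi> x"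
    and bdd: "\<And>x. cmod (\<phi> x) \<le> norm x * K"
  shows "\<exists>g. \<forall>x. \<phi> x = cinner g x"
proof (cases "\<forall>x. \<phi> x = 0")
  case True
  then show ?thesis by (intro exI[of _ 0]) simp
next
  case False
  then obtain x where x: "\<phi> x \<noteq> 0" by blast
  have "bounded_linear \<phi>"
    by (rule bounded_linear_intro[of _ K]) (auto simp: add scale bdd scaleR_scaleC scaleR_conv_of_real)
  then have "closed {x. \<phi> x = 0}"
    by (intro closed_Collect_eq continuous_intros linear_continuous_on)
  moreover have "\<phi> 0 = 0" using scale[of 0 0] by simp
  then have "csubspace {x. \<phi> x = 0}"
    by (auto simp: csubspace_def add scale)
  ultimately obtain y where y: "\<phi> y = 0" "\<And>v. \<phi> v = 0 \<Longrightarrow> cinner v (x - y) = 0"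
    using orthogonal_projection[of "{x. \<phi> x = 0}" x] by auto
  define u where "u = x - y"
  have diff: "\<phi> (a - b) = \<phi> a - \<phi> b" for a b
    using add[of "a - b" b] by simp
  have u: "\<phi> u \<noteq> 0" "u \<noteq> 0"
    using x y \<open>\<phi> 0 = 0\<close> by (auto simp: u_def diff)
  have "\<phi> z = cinner (cnj (\<phi> u / cinner u u) *\<^sub>C u) z" for z
  proof -
    have "cinner (z - (\<phi> z / \<phi> u) *\<^sub>C u) u = 0"
      unfolding u_def by (rule y(2)) (use u in \<open>auto simp: diff scale u_def\<close>)
    then have "cinner u (z - (\<phi> z / \<phi> u) *\<^sub>C u) = 0"
      by (metis cinner_commute complex_cnj_zero)
    then show ?thesis
      using u by (simp add: cinner_simps field_simps)
  qed
  then show ?thesis by blast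
qed

lemma adjoint_exists:
  fixes T :: "'a::chilbert_space \<Rightarrow> 'b::complex_inner"
  assumes "bounded_clinear T"
  shows "\<exists>S. bounded_clinear S \<and> (\<forall>x y. cinner (S x) y = cinner x (T y))"
proof -
  obtain K where K: "\<And>x. norm (T x) \<le> norm x * K" and lin: "clinear T"
    using assms by (auto simp: bounded_clinear_def)
  have K': "norm (T x) \<le> norm x * max K 0" for x
    using K[of x] mult_left_mono[of K "max K 0" "norm x"] by simp
  have "\<exists>g. \<forall>y. cinner x (T y) = cinner g y" for x
  proof (rule riesz_representation[of _ "norm x * max K 0"])
    show "cmod (cinner x (T y)) \<le> norm y * (norm x * max K 0)" for y
      using cinner_cauchy_schwarz[of x "T y"] mult_left_mono[OF K'[of y] norm_ge_zero[of x]]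
      by (simp add: mult_ac)
  qed (use lin in \<open>auto simp: clinear_def cinner_simps\<close>)
  then obtain S where S: "\<And>x y. cinner x (T y) = cinner (S x) y"
    by metis
  have 1: "S (x + y) = S x + S y" "S (c *\<^sub>C x) = c *\<^sub>C S x" for x y c
    by (metis (no_types, opaque_lifting) S cinner_add_left cinner_commute cinner_ext,
        metis (no_types, opaque_lifting) S cinner_scaleC_left cinner_commute cinner_ext)
  have "norm (S x) \<le> norm x * max K 0" for x
  proof -
    have "(norm (S x))\<^sup>2 = cmod (cinner x (T (S x)))"
      by (simp add: S cinner_self norm_power)
    also have "\<dots> \<le> norm x * (norm (S x) * max K 0)"
      using cinner_cauchy_schwarz[of x "T (S x)"] mult_left_mono[OF K'[of "S x"] norm_ge_zero[of x]]
      by simp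
    finally have "norm (S x) * norm (S x) \<le> norm (S x) * (norm x * max K 0)"
      by (simp add: power2_eq_square mult_ac)
    then show ?thesis
      by (cases "norm (S x) = 0") auto
  qed
  then show ?thesis
    using S 1 by (intro exI[of _ S]) (auto simp: bounded_clinear_def clinear_def)
qed

lemma cadjoint_eqI:
  assumes "\<And>x y. cinner (S x) y = cinner x (T y)"
  shows "cadjoint T = S"
  unfolding cadjoint_def
proof (rule the_equality)
  fix S' assume *: "\<forall>x y. cinner (S' x) y = cinner x (T y)"
  show "S' = S"
    by (rule ext, rule cinner_ext) (metis * assms cinner_commute)
qed (use assms in auto)

section \<open>The algebra of bounded operators\<close>

lemma bounded_clinearI:
  assumes "\<And>x y. f (x + y) = f x + f y" "\<And>c x. f (c *\<^sub>C x) = c *\<^sub>C f x"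
    and "\<And>x. norm (f x) \<le> norm x * K"
  shows "bounded_clinear f"
  using assms by (auto simp: bounded_clinear_def clinear_def)

text \<open>Bundling the bounded operators into a type gives them ring laws and powers, so that
  operator identities become algebra; \<open>app\<close> leads back to the plain functions of
  \<open>commutant\<close>.\<close>

typedef (overloaded) 'a bop = "{f :: 'a::chilbert_space \<Rightarrow> 'a. bounded_clinear f}"
  morphisms app Bop
  by (rule exI[of _ "\<lambda>_. 0"]) (auto intro: bounded_clinearI[of _ 0])

setup_lifting type_definition_bop

lemma bounded_clinear_bound:
  assumes "bounded_clinear f"
  obtains K where "K \<ge> 0" "\<And>x. norm (f x) \<le> norm x * K"
proof -
  obtain K where K: "\<And>x. norm (f x) \<le> norm x * K"
    using assms by (auto simp: bounded_clinear_def)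
  have "norm (f x) \<le> norm x * max K 0" for x
    using K[of x] mult_left_mono[of K "max K 0" "norm x"] by simp
  then show ?thesis using that[of "max K 0"] by auto
qed

instantiation bop :: (chilbert_space) complex_vector
begin

lift_definition zero_bop :: "'a bop" is "\<lambda>_. 0"
  by (rule bounded_clinearI[of _ 0]) auto

lift_definition plus_bop :: "'a bop \<Rightarrow> 'a bop \<Rightarrow> 'a bop" is "\<lambda>f g x. f x + g x"
proof -
  fix f g :: "'a \<Rightarrow> 'a" assume fg: "bounded_clinear f" "bounded_clinear g"
  obtain K L where K: "\<And>x. norm (f x) \<le> norm x * K" and L: "\<And>x. norm (g x) \<le> norm x * L"
    using fg by (meson bounded_clinear_bound)
  show "bounded_clinear (\<lambda>x. f x + g x)"
  proof (rule bounded_clinearI)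
    show "norm (f x + g x) \<le> norm x * (K + L)" for x
      using K[of x] L[of x] norm_triangle_ineq[of "f x" "g x"] by (simp add: distrib_left)
  qed (use fg in \<open>auto simp: bounded_clinear_def clinear_def scaleC_add_right\<close>)
qed

lift_definition scaleC_bop :: "complex \<Rightarrow> 'a bop \<Rightarrow> 'a bop" is "\<lambda>c f x. c *\<^sub>C f x"
proof -
  fix c and f :: "'a \<Rightarrow> 'a" assume f: "bounded_clinear f"
  obtain K where K: "\<And>x. norm (f x) \<le> norm x * K"
    using f by (meson bounded_clinear_bound)
  show "bounded_clinear (\<lambda>x. c *\<^sub>C f x)"
  proof (rule bounded_clinearI)
    show "norm (c *\<^sub>C f x) \<le> norm x * (cmod c * K)" for x
      using mult_left_mono[OF K[of x], of "cmod c"] by (simp add: norm_scaleC mult_ac)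
  qed (use f in \<open>auto simp: bounded_clinear_def clinear_def scaleC_add_right scaleC_scaleC mult.commute\<close>)
qed

definition uminus_bop :: "'a bop \<Rightarrow> 'a bop" where "uminus_bop f = (-1) *\<^sub>C f"
definition minus_bop :: "'a bop \<Rightarrow> 'a bop \<Rightarrow> 'a bop" where "minus_bop f g = f + (-1) *\<^sub>C g"
definition scaleR_bop :: "real \<Rightarrow> 'a bop \<Rightarrow> 'a bop" where
  "scaleR_bop r f = complex_of_real r *\<^sub>C f"

instance
proof
  fix a b c :: "'a bop" and u v :: complex and r s :: real
  show "a + b + c = a + (b + c)" "a + b = b + a" "0 + a = a"
    by (transfer, auto simp: ac_simps)+
  show "- a + a = 0" unfolding uminus_bop_def
    by transfer (auto simp: scaleC_minus_left)
  show "a - b = a + - b" by (simp add: minus_bop_def uminus_bop_def)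
  show *: "u *\<^sub>C (a + b) = u *\<^sub>C a + u *\<^sub>C b" "(u + v) *\<^sub>C a = u *\<^sub>C a + v *\<^sub>C a"
    "u *\<^sub>C v *\<^sub>C a = (u * v) *\<^sub>C a" "1 *\<^sub>C a = a" for u v and a b :: "'a bop"
    by (transfer, auto simp: scaleC_add_right scaleC_add_left scaleC_scaleC)+
  show "r *\<^sub>R (a + b) = r *\<^sub>R a + r *\<^sub>R b" "(r + s) *\<^sub>R a = r *\<^sub>R a + s *\<^sub>R a"
    "r *\<^sub>R s *\<^sub>R a = (r * s) *\<^sub>R a" "1 *\<^sub>R a = a" "r *\<^sub>R a = complex_of_real r *\<^sub>C a"
    by (simp_all add: scaleR_bop_def *)
qed

end

instantiation bop :: (chilbert_space) "{ring, monoid_mult}"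
begin

lift_definition one_bop :: "'a bop" is "\<lambda>x. x"
  by (rule bounded_clinearI[of _ 1]) auto

lift_definition times_bop :: "'a bop \<Rightarrow> 'a bop \<Rightarrow> 'a bop" is "\<lambda>f g x. f (g x)"
proof -
  fix f g :: "'a \<Rightarrow> 'a" assume fg: "bounded_clinear f" "bounded_clinear g"
  obtain K L where K: "K \<ge> 0" "\<And>x. norm (f x) \<le> norm x * K" and L: "\<And>x. norm (g x) \<le> norm x * L"
    using fg by (meson bounded_clinear_bound)
  show "bounded_clinear (\<lambda>x. f (g x))"
  proof (rule bounded_clinearI)
    show "norm (f (g x)) \<le> norm x * (L * K)" for x
      using K(2)[of "g x"] mult_right_mono[OF L[of x] K(1)] by (simp add: mult_ac)
  qed (use fg in \<open>auto simp: bounded_clinear_def clinear_def\<close>)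
qed

instance
proof
  fix a b c :: "'a bop"
  show "a * b * c = a * (b * c)" "1 * a = a" "a * 1 = a" "(a + b) * c = a * c + b * c"
    by (transfer, auto)+
  show "a * (b + c) = a * b + a * c"
    by transfer (auto simp: bounded_clinear_def clinear_def)
qed

end

lemma app_clinear: "bounded_clinear (app a)"
  using app by blast

lemma app_add_right: "app a (x + y) = app a x + app a y"
  and app_scaleC_right: "app a (c *\<^sub>C x) = c *\<^sub>C app a x"
  using app_clinear[of a] by (auto simp: bounded_clinear_def clinear_def)

lemma app_zero_right [simp]: "app a 0 = 0"
  using app_scaleC_right[of a 0 0] by simp

lemma app_minus_right: "app a (- x) = - app a x"
  using app_scaleC_right[of a "-1" x] by (simp add: scaleC_minus_left)

lemma app_diff_right: "app a (x - y) = app a x - app a y"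
  using app_add_right[of a "x - y" y] by simp

lemma app_sum_right: "app a (sum f A) = (\<Sum>i\<in>A. app a (f i))"
  by (induction A rule: infinite_finite_induct) (auto simp: app_add_right)

lemma app_mult [simp]: "app (a * b) x = app a (app b x)"
  by transfer simp

lemma app_one [simp]: "app 1 x = x"
  by transfer simp

lemma app_zero [simp]: "app 0 x = 0"
  by transfer simp

lemma app_add: "app (a + b) x = app a x + app b x"
  by transfer simp

lemma app_scaleC: "app (c *\<^sub>C a) x = c *\<^sub>C app a x"
  by transfer simp

lemma app_minus: "app (- a) x = - app a x"
  using scaleC_minus_left[of 1 "app a x"] by (simp add: uminus_bop_def app_scaleC)

lemma app_diff: "app (a - b) x = app a x - app b x"
  using app_add[of a "-b" x] by (simp add: app_minus)

lemmas app_simps = app_add app_scaleC app_minus app_diff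
  app_add_right app_scaleC_right app_minus_right app_diff_right

lemma bop_eqI: "(\<And>x. app a x = app b x) \<Longrightarrow> a = b"
  by (rule iffD1[OF app_inject], rule ext)

lemma app_Bop: "bounded_clinear f \<Longrightarrow> app (Bop f) = f"
  by (simp add: Bop_inverse)

lemma scaleC_mult_left [simp]: "(c *\<^sub>C a) * b = c *\<^sub>C (a * b)" for a b :: "'a::chilbert_space bop"
  by (rule bop_eqI) (simp add: app_simps)

lemma scaleC_mult_right [simp]: "a * (c *\<^sub>C b) = c *\<^sub>C (a * b)" for a b :: "'a::chilbert_space bop"
  by (rule bop_eqI) (simp add: app_simps)

lemma app_bounded: obtains K where "K > 0" "\<And>x. norm (app a x) \<le> K * norm x"
proof -
  obtain K where K: "K \<ge> 0" "\<And>x. norm (app a x) \<le> norm x * K"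
    using bounded_clinear_bound[OF app_clinear] by blast
  have "norm (app a x) \<le> (K + 1) * norm x" for x
    by (rule order_trans[OF K(2)]) (simp add: algebra_simps)
  then show ?thesis using that[of "K + 1"] K(1) by auto
qed

lemma bounded_linear_app: "bounded_linear (app a)"
  by (rule bounded_clinear_bounded_linear[OF app_clinear])

lemmas tendsto_app [tendsto_intros] = bounded_linear.tendsto[OF bounded_linear_app]

lift_definition star :: "'a::chilbert_space bop \<Rightarrow> 'a bop" is cadjoint
proof -
  fix f :: "'a \<Rightarrow> 'a" assume "bounded_clinear f"
  then obtain S where "bounded_clinear S" "\<And>x y. cinner (S x) y = cinner x (f y)"
    using adjoint_exists by blast
  then show "bounded_clinear (cadjoint f)"
    using cadjoint_eqI[of S f] by simp
qed

lemma cinner_star_left: "cinner (app (star a) x) y = cinner x (app a y)"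
proof transfer
  fix f :: "'a \<Rightarrow> 'a" and x y assume "bounded_clinear f"
  then obtain S where S: "\<And>x y. cinner (S x) y = cinner x (f y)"
    using adjoint_exists by blast
  then show "cinner (cadjoint f x) y = cinner x (f y)"
    using cadjoint_eqI[of S f] by simp
qed

lemma cinner_star_right: "cinner x (app (star a) y) = cinner (app a x) y"
  by (metis cinner_commute cinner_star_left)

lemma star_eqI: "(\<And>x y. cinner (app b x) y = cinner x (app a y)) \<Longrightarrow> star a = b"
  by (rule bop_eqI, rule cinner_ext) (metis cinner_commute cinner_star_left)

lemma star_star [simp]: "star (star a) = a"
  by (rule star_eqI) (simp add: cinner_star_right)

lemma star_add: "star (a + b) = star a + star b"
  by (rule star_eqI) (simp add: app_simps cinner_simps cinner_star_left)

lemma star_scaleC: "star (c *\<^sub>C a) = cnj c *\<^sub>C star a"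
  by (rule star_eqI) (simp add: app_simps cinner_simps cinner_star_left)

lemma star_diff: "star (a - b) = star a - star b"
  by (rule star_eqI) (simp add: app_simps cinner_simps cinner_star_left)

lemma star_mult: "star (a * b) = star b * star a"
  by (rule star_eqI) (simp add: cinner_star_left)

lemma star_one [simp]: "star 1 = 1"
  by (rule star_eqI) simp

lemma star_zero [simp]: "star 0 = 0"
  by (rule star_eqI) simp

lemma app_closure_cspan:
  assumes "\<And>s. s \<in> S \<Longrightarrow> app a s \<in> V" "csubspace V" "closed V" "x \<in> closure (cspan S)"
  shows "app a x \<in> V"
proof -
  have "closed (app a -` V)"
    by (rule continuous_closed_vimage[OF assms(3)])
      (use bounded_linear_app linear_continuous_at in blast)
  moreover have "csubspace (app a -` V)"
    using assms(2) by (auto simp: csubspace_def app_simps)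
  ultimately show ?thesis
    using closure_cspan_minimal[of "app a -` V" S] assms(1,4) by auto
qed

lemma app_eq_closure_cspan:
  assumes "\<And>s. s \<in> S \<Longrightarrow> app a s = app b s" "x \<in> closure (cspan S)"
  shows "app a x = app b x"
proof -
  have "app (a - b) x \<in> {0}"
    by (rule app_closure_cspan[of S]) (use assms in \<open>auto simp: app_simps csubspace_def\<close>)
  then show ?thesis by (simp add: app_simps)
qed

lemma bop_eq_dense:
  assumes "closure (cspan S) = UNIV" "\<And>s. s \<in> S \<Longrightarrow> app a s = app b s"
  shows "a = b"
  by (rule bop_eqI, rule app_eq_closure_cspan[of S]) (use assms in auto)

lemma projection_bop:
  fixes V :: "'a::chilbert_space set"
  assumes V: "csubspace V" and cl: "closed V"
  obtains E where "\<And>x. app E x \<in> V" "\<And>x. x \<in> V \<Longrightarrow> app E x = x"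
    "\<And>v x. v \<in> V \<Longrightarrow> cinner v (x - app E x) = 0" "star E = E" "\<And>x. norm (app E x) \<le> norm x"
proof -
  obtain P where P: "\<And>x. P x \<in> V" "\<And>v x. v \<in> V \<Longrightarrow> cinner v (x - P x) = 0"
    using orthogonal_projection[OF V cl] by metis
  have uniq: "P x = y" if "y \<in> V" "\<And>v. v \<in> V \<Longrightarrow> cinner v (x - y) = 0" for x y
  proof -
    have "cinner (P x - y) (P x - y) = cinner (P x - y) (x - y) - cinner (P x - y) (x - P x)"
      by (simp add: cinner_simps)
    also have "\<dots> = 0"
      using P that csubspaceD(5)[OF V] by simp
    finally show ?thesis by simp
  qed
  have le: "norm (P x) \<le> norm x" for x
  proof -
    have "(norm x)\<^sup>2 = (norm (P x))\<^sup>2 + (norm (x - P x))\<^sup>2"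
      using norm_add_orthogonal[of "P x" "x - P x"] P by simp
    then show ?thesis
      by (intro power2_le_imp_le[OF _ norm_ge_zero]) simp
  qed
  have bl: "bounded_clinear P"
  proof (rule bounded_clinearI[of _ 1])
    show "P (x + y) = P x + P y" for x y :: 'a
    proof (rule uniq)
      show "cinner v (x + y - (P x + P y)) = 0" if "v \<in> V" for v
        using P(2)[OF that, of x] P(2)[OF that, of y]
        by (simp only: add_diff_add cinner_add_right) simp
    qed (simp add: P(1) csubspaceD(2)[OF V])
    show "P (c *\<^sub>C x) = c *\<^sub>C P x" for c x
    proof (rule uniq)
      show "cinner v (c *\<^sub>C x - c *\<^sub>C P x) = 0" if "v \<in> V" for v
        using P(2)[OF that, of x] by (simp only: scaleC_diff_right[symmetric] cinner_scaleC_right) simp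
    qed (simp add: P(1) csubspaceD(3)[OF V])
  qed (use le in auto)
  show ?thesis
  proof (rule that[of "Bop P"])
    show "star (Bop P) = Bop P"
    proof (rule star_eqI)
      fix x y
      have "cinner (P x) (y - P y) = 0" "cinner (P y) (x - P x) = 0"
        using P by auto
      then have "cinner (P x) y = cinner (P x) (P y)" "cinner (P y) x = cinner (P y) (P x)"
        by (simp_all add: cinner_diff_right)
      then have "cinner (P x) y = cinner x (P y)"
        by (metis cinner_commute)
      then show "cinner (app (Bop P) x) y = cinner x (app (Bop P) y)"
        by (simp add: app_Bop bl)
    qed
  qed (use P le uniq in \<open>auto simp: app_Bop bl\<close>)
qed

section \<open>The q-deformed Gram matrix\<close>

definition del :: "nat \<Rightarrow> 'a list \<Rightarrow> 'a list" where
  "del k xs = take k xs @ drop (Suc k) xs"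

lemma length_del: "k < length xs \<Longrightarrow> length (del k xs) = length xs - 1"
  by (simp add: del_def)

definition skip :: "nat \<Rightarrow> nat \<Rightarrow> nat" where
  "skip j i = (if i < j then i else Suc i)"

lemma nth_del: "j < length xs \<Longrightarrow> i < length xs - 1 \<Longrightarrow> del j xs ! i = xs ! skip j i"
  by (auto simp: del_def skip_def nth_append min_def)

lemma skip_inj [simp]: "skip j i = skip j i' \<longleftrightarrow> i = i'"
  by (auto simp: skip_def)

lemma skip_neq [simp]: "skip j i \<noteq> j" "j \<noteq> skip j i"
  by (auto simp: skip_def)

lemma skip_less [simp]: "skip j i < skip j i' \<longleftrightarrow> i < i'"
  by (auto simp: skip_def)

lemma skip_less_self [simp]: "skip j i < j \<longleftrightarrow> i < j"
  by (auto simp: skip_def)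

text \<open>The permutation of n + 1 points with first value j whose remaining values, renumbered
  without j, form \<sigma>. Every permutation arises exactly once, which allows the Gram sum to be
  expanded along its first row.\<close>

definition ins_perm :: "nat \<Rightarrow> nat \<Rightarrow> (nat \<Rightarrow> nat) \<Rightarrow> nat \<Rightarrow> nat" where
  "ins_perm n j \<sigma> k = (if k = 0 then j else if k \<le> n then skip j (\<sigma> (k - 1)) else k)"

lemma ins_perm_simps [simp]:
  "ins_perm n j \<sigma> 0 = j"
  "i < n \<Longrightarrow> ins_perm n j \<sigma> (Suc i) = skip j (\<sigma> i)"
  by (auto simp: ins_perm_def)

lemma ins_perm_permutes:
  assumes "j \<le> n" "\<sigma> permutes {..<n}"
  shows "ins_perm n j \<sigma> permutes {..<Suc n}"
proof (rule bij_imp_permutes)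
  have lt: "\<sigma> i < n" if "i < n" for i
    using permutes_in_image[OF assms(2), of i] that by auto
  have "inj_on (ins_perm n j \<sigma>) {..<Suc n}"
  proof (rule inj_onI)
    fix x y assume *: "x \<in> {..<Suc n}" "y \<in> {..<Suc n}" "ins_perm n j \<sigma> x = ins_perm n j \<sigma> y"
    then show "x = y"
      using permutes_inj[OF assms(2)] by (cases x; cases y) (auto simp: inj_eq)
  qed
  moreover have "ins_perm n j \<sigma> ` {..<Suc n} \<subseteq> {..<Suc n}"
  proof
    fix y assume "y \<in> ins_perm n j \<sigma> ` {..<Suc n}"
    then obtain x where x: "x < Suc n" "y = ins_perm n j \<sigma> x" by auto
    then show "y \<in> {..<Suc n}"
      using assms(1) lt[of "x - 1"] by (cases x) (auto simp: skip_def)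
  qed
  ultimately show "bij_betw (ins_perm n j \<sigma>) {..<Suc n} {..<Suc n}"
    by (simp add: bij_betw_def endo_inj_surj)
qed (auto simp: ins_perm_def)

lemma bij_ins_perm:
  "bij_betw (\<lambda>(j, \<sigma>). ins_perm n j \<sigma>) ({..n} \<times> {\<sigma>. \<sigma> permutes {..<n}}) {\<pi>. \<pi> permutes {..<Suc n}}"
proof -
  let ?A = "{..n} \<times> {\<sigma>. \<sigma> permutes {..<n}}" and ?f = "\<lambda>(j, \<sigma>). ins_perm n j \<sigma>"
  have inj: "inj_on ?f ?A"
  proof (rule inj_onI, clarsimp)
    fix j \<sigma> j' \<sigma>' assume *: "\<sigma> permutes {..<n}" "\<sigma>' permutes {..<n}"
      "ins_perm n j \<sigma> = ins_perm n j' \<sigma>'"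
    have "j = j'" using fun_cong[OF *(3), of 0] by simp
    moreover have "\<sigma> i = \<sigma>' i" for i
    proof (cases "i < n")
      case True
      then show ?thesis
        using fun_cong[OF *(3), of "Suc i"] \<open>j = j'\<close> by simp
    next
      case False
      then show ?thesis
        using *(1,2) by (simp add: permutes_not_in)
    qed
    ultimately show "j = j' \<and> \<sigma> = \<sigma>'" by auto
  qed
  have "card ?A = card {\<pi>. \<pi> permutes {..<Suc n}}"
    by (simp add: card_cartesian_product card_permutations[OF refl])
  moreover have "?f ` ?A \<subseteq> {\<pi>. \<pi> permutes {..<Suc n}}"
    using ins_perm_permutes by auto
  ultimately have "?f ` ?A = {\<pi>. \<pi> permutes {..<Suc n}}"
    by (intro card_subset_eq) (auto simp: card_image[OF inj] finite_permutations)
  then show ?thesis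
    using inj by (simp add: bij_betw_def)
qed

text \<open>Position 0 is inverted with exactly the positions that carry the j smaller values. The
  other inversions are those of \<sigma>, because \<open>skip j\<close> is increasing.\<close>

lemma inversions_ins_perm:
  assumes "j \<le> n" "\<sigma> permutes {..<n}"
  shows "inversions (Suc n) (ins_perm n j \<sigma>) = j + inversions n \<sigma>"
proof -
  let ?\<pi> = "ins_perm n j \<sigma>"
  let ?A = "{(0::nat, k) | k. k \<in> Suc ` {i. i < n \<and> \<sigma> i < j}}"
  let ?B = "map_prod Suc Suc ` {(i, k). i < k \<and> k < n \<and> \<sigma> k < \<sigma> i}"
  have "{(i, k). i < k \<and> k < Suc n \<and> ?\<pi> k < ?\<pi> i} = ?A \<union> ?B"
  proof (rule set_eqI, clarify)
    fix i k
    show "(i, k) \<in> {(i, k). i < k \<and> k < Suc n \<and> ?\<pi> k < ?\<pi> i} \<longleftrightarrow> (i, k) \<in> ?A \<union> ?B"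
      by (cases i; cases k) (auto simp: map_prod_def image_iff)
  qed
  moreover have "?A \<inter> ?B = {}" by auto
  moreover have "finite ?A"
    by (rule finite_subset[of _ "{0} \<times> {..n}"]) auto
  moreover have "finite {(i, k). i < k \<and> k < n \<and> \<sigma> k < \<sigma> i}"
    by (rule finite_subset[of _ "{..n} \<times> {..n}"]) auto
  ultimately have "inversions (Suc n) ?\<pi> = card ?A + card ?B"
    unfolding inversions_def by (simp only: card_Un_disjoint finite_imageI)
  moreover have "card ?B = inversions n \<sigma>"
    unfolding inversions_def by (intro card_image) (auto simp: inj_on_def)
  moreover have "card ?A = card {i. i < n \<and> \<sigma> i < j}"
  proof -
    have "?A = (\<lambda>i. (0, Suc i)) ` {i. i < n \<and> \<sigma> i < j}" by auto
    then show ?thesis by (simp add: card_image inj_on_def)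
  qed
  moreover have "card {i. i < n \<and> \<sigma> i < j} = j"
  proof -
    have "\<sigma> ` {i. i < n \<and> \<sigma> i < j} = {..<j}"
    proof (intro equalityI subsetI)
      fix y assume "y \<in> {..<j}"
      then have "y \<in> \<sigma> ` {..<n}"
        using permutes_image[OF assms(2)] assms(1) by auto
      then show "y \<in> \<sigma> ` {i. i < n \<and> \<sigma> i < j}"
        using \<open>y \<in> {..<j}\<close> by auto
    qed auto
    moreover have "inj_on \<sigma> {i. i < n \<and> \<sigma> i < j}"
      using permutes_inj[OF assms(2)] by (auto simp: inj_on_def)
    ultimately show ?thesis
      by (metis card_image card_lessThan)
  qed
  ultimately show ?thesis by simp
qed

text \<open>A Laplace expansion with q^k in place of the sign. It makes the annihilation formula
  \<open>anw\<close> adjoint to creation.\<close>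

lemma q_gram_Cons:
  "q_gram q (x # xs) ys = (\<Sum>k<length ys. of_real q ^ k * cinner x (ys ! k) * q_gram q xs (del k ys))"
proof (cases "length ys = Suc (length xs)")
  case False
  then have "q_gram q xs (del k ys) = 0" if "k < length ys" for k
    using that by (auto simp: q_gram_def length_del)
  then show ?thesis
    using False by (auto simp: q_gram_def)
next
  case True
  define n where "n = length xs"
  have ys: "length ys = Suc n" using True by (simp add: n_def)
  let ?t = "\<lambda>\<pi>. of_real q ^ inversions (Suc n) \<pi> * (\<Prod>k<Suc n. cinner ((x # xs) ! k) (ys ! \<pi> k))"
  have "q_gram q (x # xs) ys = (\<Sum>\<pi> | \<pi> permutes {..<Suc n}. ?t \<pi>)"
    using ys by (simp add: q_gram_def n_def)
  also have "\<dots> = (\<Sum>(j, \<sigma>)\<in>{..n} \<times> {\<sigma>. \<sigma> permutes {..<n}}. ?t (ins_perm n j \<sigma>))"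
    by (subst sum.reindex_bij_betw[OF bij_ins_perm, symmetric]) (simp add: case_prod_unfold)
  also have "\<dots> = (\<Sum>j\<le>n. \<Sum>\<sigma> | \<sigma> permutes {..<n}. ?t (ins_perm n j \<sigma>))"
    by (rule sum.cartesian_product[symmetric])
  also have "\<dots> = (\<Sum>j\<le>n. of_real q ^ j * cinner x (ys ! j) * q_gram q xs (del j ys))"
  proof (rule sum.cong[OF refl])
    fix j assume "j \<in> {..n}"
    then have j: "j \<le> n" by simp
    have "?t (ins_perm n j \<sigma>) = of_real q ^ j * cinner x (ys ! j) *
        (of_real q ^ inversions n \<sigma> * (\<Prod>k<n. cinner (xs ! k) (del j ys ! \<sigma> k)))"
      if "\<sigma> permutes {..<n}" for \<sigma>
    proof -
      have "\<sigma> k < n" if "k < n" for k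
        using permutes_in_image[OF \<open>\<sigma> permutes _\<close>, of k] that by auto
      then have "(\<Prod>k<n. cinner (xs ! k) (ys ! skip j (\<sigma> k))) =
          (\<Prod>k<n. cinner (xs ! k) (del j ys ! \<sigma> k))"
        using j ys by (intro prod.cong refl) (auto simp: nth_del)
      then show ?thesis
        by (simp add: inversions_ins_perm[OF j that] prod.lessThan_Suc_shift power_add
            del: prod.lessThan_Suc)
    qed
    then have "(\<Sum>\<sigma> | \<sigma> permutes {..<n}. ?t (ins_perm n j \<sigma>)) = of_real q ^ j * cinner x (ys ! j) *
       (\<Sum>\<sigma> | \<sigma> permutes {..<n}. of_real q ^ inversions n \<sigma> * (\<Prod>k<n. cinner (xs ! k) (del j ys ! \<sigma> k)))"
      by (simp add: sum_distrib_left)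
    moreover have "length (del j ys) = n"
      using j ys by (simp add: length_del)
    ultimately show "(\<Sum>\<sigma> | \<sigma> permutes {..<n}. ?t (ins_perm n j \<sigma>)) =
        of_real q ^ j * cinner x (ys ! j) * q_gram q xs (del j ys)"
      by (simp add: q_gram_def n_def)
  qed
  finally show ?thesis
    by (simp add: ys lessThan_Suc_atMost)
qed

lemma q_gram_Nil [simp]: "q_gram q [] [] = 1"
  by (simp add: q_gram_def inversions_def)

lemma q_gram_length: "length xs \<noteq> length ys \<Longrightarrow> q_gram q xs ys = 0"
  by (simp add: q_gram_def)

text \<open>Conjugation by the order reversal \<rho> permutes the summands and keeps the number of
  inversions, since the orders of positions and of values are both reversed. This is what makes
  \<open>flip\<close> isometric and the right operators available.\<close>

lemma q_gram_rev: "q_gram q (rev xs) (rev ys) = q_gram q xs ys"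
proof (cases "length xs = length ys")
  case False
  then show ?thesis by (simp add: q_gram_length)
next
  case True
  define n where "n = length ys"
  define \<rho> where "\<rho> k = (if k < n then n - Suc k else k)" for k
  have \<rho>: "\<rho> (\<rho> k) = k" "\<rho> k < n \<longleftrightarrow> k < n" for k
    by (auto simp: \<rho>_def)
  have \<rho>_perm: "\<rho> permutes {..<n}"
    by (rule bij_imp_permutes, rule bij_betw_byWitness[of _ \<rho>]) (auto simp: \<rho>, simp add: \<rho>_def)
  let ?\<phi> = "\<lambda>\<pi>. \<rho> \<circ> \<pi> \<circ> \<rho>"
  let ?t = "\<lambda>as bs \<pi>. of_real q ^ inversions n \<pi> * (\<Prod>k<n. cinner (as ! k) (bs ! \<pi> k))"
  have \<rho>_less: "\<rho> a < \<rho> b \<longleftrightarrow> b < a" if "a < n" "b < n" for a b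
    using that by (auto simp: \<rho>_def)
  have inv: "inversions n (?\<phi> \<pi>) = inversions n \<pi>" if "\<pi> permutes {..<n}" for \<pi>
  proof -
    have lt: "\<pi> k < n" if "k < n" for k
      using permutes_in_image[OF \<open>\<pi> permutes _\<close>, of k] that by auto
    have iff: "i < j \<and> j < n \<and> ?\<phi> \<pi> j < ?\<phi> \<pi> i \<longleftrightarrow> \<rho> j < \<rho> i \<and> \<rho> i < n \<and> \<pi> (\<rho> i) < \<pi> (\<rho> j)" for i j
    proof (cases "i < n \<and> j < n")
      case True
      then show ?thesis by (simp add: \<rho> \<rho>_less lt)
    next
      case False
      then show ?thesis
        using \<rho>(2) by (meson order_less_trans)
    qed
    have "{(i, j). i < j \<and> j < n \<and> ?\<phi> \<pi> j < ?\<phi> \<pi> i} =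
        (\<lambda>(i, j). (\<rho> j, \<rho> i)) ` {(i, j). i < j \<and> j < n \<and> \<pi> j < \<pi> i}" (is "?A = ?g ` ?B")
    proof (intro equalityI subsetI)
      fix p assume "p \<in> ?A"
      then have B: "?g p \<in> ?B" and p: "p = ?g (?g p)"
        using iff by (auto simp: \<rho>(1))
      show "p \<in> ?g ` ?B"
        by (rule image_eqI[where x = "?g p"], rule p, rule B)
    next
      fix p assume "p \<in> ?g ` ?B"
      then obtain i j where "p = (\<rho> j, \<rho> i)" "i < j" "j < n" "\<pi> j < \<pi> i" by auto
      then show "p \<in> ?A"
        using iff[of "\<rho> j" "\<rho> i"] by (simp add: \<rho>(1))
    qed
    moreover have "inj_on ?g ?B"
      by (rule inj_on_inverseI[of _ ?g]) (auto simp: \<rho>)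
    ultimately show ?thesis
      unfolding inversions_def by (simp add: card_image)
  qed
  have "q_gram q (rev xs) (rev ys) = (\<Sum>\<pi> | \<pi> permutes {..<n}. ?t (rev xs) (rev ys) \<pi>)"
    using True by (simp add: q_gram_def n_def)
  also have "\<dots> = (\<Sum>\<pi> | \<pi> permutes {..<n}. ?t xs ys \<pi>)"
  proof (rule sum.reindex_bij_witness[of _ ?\<phi> ?\<phi>])
    fix \<pi> assume "\<pi> \<in> {\<pi>. \<pi> permutes {..<n}}"
    then have \<pi>: "\<pi> permutes {..<n}" by simp
    have lt: "\<pi> k < n" if "k < n" for k
      using permutes_in_image[OF \<pi>, of k] that by auto
    show "?\<phi> (?\<phi> \<pi>) = \<pi>" by (auto simp: \<rho>)
    show "?\<phi> \<pi> \<in> {\<pi>. \<pi> permutes {..<n}}"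
      using \<pi> \<rho>_perm by (simp add: permutes_compose)
    have "(\<Prod>k<n. cinner (xs ! k) (ys ! ?\<phi> \<pi> k)) = (\<Prod>k<n. cinner (rev xs ! k) (rev ys ! \<pi> k))"
      by (rule prod.reindex_bij_witness[of _ \<rho> \<rho>])
        (use True lt in \<open>auto simp: \<rho> rev_nth n_def \<rho>_def\<close>)
    then show "?t xs ys (?\<phi> \<pi>) = ?t (rev xs) (rev ys) \<pi>"
      using inv[OF \<pi>] by simp
  qed (auto simp: \<rho>, use \<rho>_perm permutes_compose in blast)
  also have "\<dots> = q_gram q xs ys"
    using True by (simp add: q_gram_def n_def)
  finally show ?thesis .
qed

section \<open>Operators defined on a spanning family\<close>

text \<open>Coefficients and indices are kept apart from the family in which they are evaluated.
  That an operator given on a spanning family is well defined and bounded then becomes one norm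
  inequality between two evaluations of the same list.\<close>

definition comb :: "('b \<Rightarrow> 'a::complex_vector) \<Rightarrow> (complex \<times> 'b) list \<Rightarrow> 'a" where
  "comb \<phi> l = (\<Sum>p\<leftarrow>l. fst p *\<^sub>C \<phi> (snd p))"

lemma comb_simps [simp]:
  "comb \<phi> [] = 0" "comb \<phi> (p # l) = fst p *\<^sub>C \<phi> (snd p) + comb \<phi> l"
  "comb \<phi> (l @ l') = comb \<phi> l + comb \<phi> l'"
  by (auto simp: comb_def)

lemma comb_scale: "comb \<phi> (map (\<lambda>p. (c * fst p, snd p)) l) = c *\<^sub>C comb \<phi> l"
  by (induction l) (auto simp: scaleC_add_right scaleC_scaleC)

lemma comb_add: "comb (\<lambda>x. \<phi> x + \<psi> x) l = comb \<phi> l + comb \<psi> l"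
  by (induction l) (auto simp: scaleC_add_right)

lemma comb_scaleC: "comb (\<lambda>x. c *\<^sub>C \<phi> x) l = c *\<^sub>C comb \<phi> l"
  by (induction l) (auto simp: scaleC_add_right scaleC_scaleC mult.commute)

lemma comb_in_csubspace: "csubspace V \<Longrightarrow> (\<And>p. p \<in> set l \<Longrightarrow> \<phi> (snd p) \<in> V) \<Longrightarrow> comb \<phi> l \<in> V"
  by (induction l) (auto simp: csubspaceD)

lemma cspan_comb:
  assumes "x \<in> cspan (\<phi> ` S)"
  shows "\<exists>l. x = comb \<phi> l \<and> snd ` set l \<subseteq> S"
  using assms
proof induction
  case cspan_zero
  show ?case by (rule exI[of _ "[]"]) simp
next
  case (cspan_base x)
  then obtain s where "s \<in> S" "x = \<phi> s" by auto
  then show ?case by (intro exI[of _ "[(1, s)]"]) simp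
next
  case (cspan_add x y)
  then obtain l l' where "x = comb \<phi> l" "y = comb \<phi> l'" "snd ` set l \<subseteq> S" "snd ` set l' \<subseteq> S"
    by auto
  then show ?case by (intro exI[of _ "l @ l'"]) auto
next
  case (cspan_scale x c)
  then obtain l where "x = comb \<phi> l" "snd ` set l \<subseteq> S" by auto
  then show ?case
    by (intro exI[of _ "map (\<lambda>p. (c * fst p, snd p)) l"]) (auto simp: comb_scale)
qed

lemma cinner_comb_adjoint:
  fixes \<phi> \<psi> :: "'b \<Rightarrow> 'a::complex_inner"
  assumes "\<And>x y. cinner (\<phi> x) (\<psi> y) = cinner (\<phi>' x) (\<psi>' y)"
  shows "cinner (comb \<phi> l) (comb \<psi> l') = cinner (comb \<phi>' l) (comb \<psi>' l')"
proof -
  have "cinner (\<phi> x) (comb \<psi> l') = cinner (\<phi>' x) (comb \<psi>' l')" for x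
    using assms by (induction l') (auto simp: cinner_simps)
  then show ?thesis
    by (induction l) (auto simp: cinner_simps)
qed

text \<open>The bound, applied to the difference of two lists, shows that the value depends only on
  the vector represented; Lipschitz continuity carries it to the closure.\<close>

lemma bop_extension:
  fixes \<phi> \<omega> :: "'b \<Rightarrow> 'a::chilbert_space"
  assumes dense: "closure (cspan (range \<omega>)) = UNIV"
    and bdd: "\<And>l. norm (comb \<phi> l) \<le> K * norm (comb \<omega> l)"
  shows "\<exists>T. (\<forall>x. app T (\<omega> x) = \<phi> x) \<and> (\<forall>x. norm (app T x) \<le> K * norm x)"
proof -
  let ?V = "cspan (range \<omega>)"
  have V: "csubspace ?V" by (rule csubspace_cspan)
  have bdd': "norm (comb \<phi> l) \<le> max K 0 * norm (comb \<omega> l)" for l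
    using bdd[of l] mult_right_mono[of K "max K 0" "norm (comb \<omega> l)"] by simp
  define T0 where "T0 x = comb \<phi> (SOME l. comb \<omega> l = x)" for x
  have diff: "norm (comb \<phi> l - comb \<phi> l') \<le> max K 0 * norm (comb \<omega> l - comb \<omega> l')" for l l'
    using bdd'[of "l @ map (\<lambda>p. ((-1) * fst p, snd p)) l'"]
    unfolding comb_simps comb_scale by (simp add: scaleC_minus_left)
  have T0: "T0 (comb \<omega> l) = comb \<phi> l" for l
  proof -
    have "comb \<omega> (SOME l'. comb \<omega> l' = comb \<omega> l) = comb \<omega> l"
      by (rule someI) auto
    then show ?thesis
      using diff[of "SOME l'. comb \<omega> l' = comb \<omega> l" l] by (simp add: T0_def)
  qed
  have V_iff: "x \<in> ?V \<Longrightarrow> \<exists>l. x = comb \<omega> l" for x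
    using cspan_comb[of x \<omega> UNIV] by auto
  have "(max K 0)-lipschitz_on ?V T0"
  proof (rule lipschitz_onI)
    fix x y assume "x \<in> ?V" "y \<in> ?V"
    then obtain l l' where "x = comb \<omega> l" "y = comb \<omega> l'" using V_iff by metis
    then show "dist (T0 x) (T0 y) \<le> max K 0 * dist x y"
      using diff by (simp add: T0 dist_norm)
  qed simp
  then obtain g where g: "(max K 0)-lipschitz_on (closure ?V) g" "\<And>x. x \<in> ?V \<Longrightarrow> g x = T0 x"
    using lipschitz_extend_closure[of "max K 0" ?V T0] by blast
  then have cont: "continuous_on UNIV g"
    using dense lipschitz_on_continuous_on by fastforce
  then have lim: "(\<lambda>n. g (f n)) \<longlonglongrightarrow> g x" if "f \<longlonglongrightarrow> x" for f :: "nat \<Rightarrow> 'a" and x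
    using that by (metis continuous_on_tendsto_compose UNIV_I eventually_sequentially)
  have seq: "\<exists>f. (\<forall>n. f n \<in> ?V) \<and> f \<longlonglongrightarrow> x" for x
    using dense closure_sequential[of x ?V] by auto
  have gl: "g (comb \<omega> l) = comb \<phi> l" for l
    using g(2)[of "comb \<omega> l"] T0 comb_in_csubspace[OF V, of l \<omega>] by (auto intro: cspan_base)
  have add: "g (x + y) = g x + g y" for x y
  proof -
    obtain f h where f: "\<And>n. f n \<in> ?V" "f \<longlonglongrightarrow> x" "\<And>n. h n \<in> ?V" "h \<longlonglongrightarrow> y"
      using seq[of x] seq[of y] by blast
    have "g (f n + h n) = g (f n) + g (h n)" for n
    proof -
      obtain l l' where "f n = comb \<omega> l" "h n = comb \<omega> l'" using V_iff f by metis
      then show ?thesis using gl[of "l @ l'"] by (simp add: gl)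
    qed
    moreover have "(\<lambda>n. g (f n + h n)) \<longlonglongrightarrow> g (x + y)"
      by (intro lim tendsto_intros f)
    moreover have "(\<lambda>n. g (f n) + g (h n)) \<longlonglongrightarrow> g x + g y"
      by (intro lim tendsto_intros f)
    ultimately show ?thesis using LIMSEQ_unique by fastforce
  qed
  have scale: "g (c *\<^sub>C x) = c *\<^sub>C g x" for c x
  proof -
    obtain f where f: "\<And>n. f n \<in> ?V" "f \<longlonglongrightarrow> x"
      using seq[of x] by blast
    have "g (c *\<^sub>C f n) = c *\<^sub>C g (f n)" for n
    proof -
      obtain l where "f n = comb \<omega> l" using V_iff f by metis
      then show ?thesis using gl[of "map (\<lambda>p. (c * fst p, snd p)) l"] by (simp add: gl comb_scale)
    qed
    moreover have "(\<lambda>n. g (c *\<^sub>C f n)) \<longlonglongrightarrow> g (c *\<^sub>C x)"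
      by (intro lim tendsto_intros f)
    moreover have "(\<lambda>n. c *\<^sub>C g (f n)) \<longlonglongrightarrow> c *\<^sub>C g x"
      by (intro lim tendsto_intros f)
    ultimately show ?thesis using LIMSEQ_unique by fastforce
  qed
  have le: "norm (g x) \<le> K * norm x" for x
  proof -
    obtain f where f: "\<And>n. f n \<in> ?V" "f \<longlonglongrightarrow> x"
      using seq[of x] by blast
    have "norm (g (f n)) \<le> K * norm (f n)" for n
      using V_iff[OF f(1)[of n]] bdd gl by metis
    moreover have "(\<lambda>n. norm (g (f n))) \<longlonglongrightarrow> norm (g x)" "(\<lambda>n. K * norm (f n)) \<longlonglongrightarrow> K * norm x"
      by (intro lim tendsto_intros f)+
    ultimately show ?thesis
      by (meson LIMSEQ_le)
  qed
  have bc: "bounded_clinear g"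
    by (rule bounded_clinearI[of _ K]) (use add scale le in \<open>auto simp: mult.commute\<close>)
  have "g (\<omega> x) = \<phi> x" for x
    using gl[of "[(1, x)]"] by simp
  then show ?thesis
    using le by (intro exI[of _ "Bop g"]) (simp add: app_Bop[OF bc])
qed

definition rk :: "'a::chilbert_space \<Rightarrow> 'a \<Rightarrow> 'a bop" where
  "rk a b = Bop (\<lambda>x. cinner b x *\<^sub>C a)"

lemma app_rk [simp]: "app (rk a b) x = cinner b x *\<^sub>C a"
proof -
  have "bounded_clinear (\<lambda>x. cinner b x *\<^sub>C a)"
  proof (rule bounded_clinearI[of _ "norm b * norm a"])
    show "norm (cinner b x *\<^sub>C a) \<le> norm x * (norm b * norm a)" for x
      using mult_right_mono[OF cinner_cauchy_schwarz[of b x] norm_ge_zero[of a]]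
      by (simp add: norm_scaleC mult_ac)
  qed (auto simp: cinner_simps scaleC_add_left scaleC_scaleC)
  then show ?thesis
    by (simp add: rk_def app_Bop)
qed

lemma mult_rk: "a * rk x y = rk (app a x) y" "rk x y * a = rk x (app (star a) y)"
  by (rule bop_eqI, simp add: app_simps cinner_star_left)+

section \<open>The q-Fock space\<close>

text \<open>All that is kept of the Fock space is a family of vectors with the deformed Gram matrix
  and dense span. Positivity of the form comes from the ambient Hilbert space, and multilinearity of
  \<open>w\<close> is recovered from the Gram matrix.\<close>

locale q_fock =
  fixes q :: real and w :: "'h::chilbert_space list \<Rightarrow> 'f::chilbert_space"
  assumes q_bounds: "-1 < q" "q < 1"
    and cinner_w: "cinner (w xs) (w ys) = q_gram q xs ys"
    and dense_w: "closure (cspan (range w)) = UNIV"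
begin

abbreviation (input) \<Omega> where "\<Omega> \<equiv> w []"

lemma w_ext: "(\<And>zs. cinner (w zs) u = cinner (w zs) v) \<Longrightarrow> u = v"
proof -
  assume *: "\<And>zs. cinner (w zs) u = cinner (w zs) v"
  have "cinner (u - v) (u - v) = 0"
  proof (rule orthogonal_closure_cspan(1)[of "range w"])
    fix s assume "s \<in> range w"
    then obtain zs where s: "s = w zs" by auto
    have "cinner s (u - v) = 0" using * by (simp add: cinner_simps s)
    then show "cinner (u - v) s = 0" by (metis cinner_commute complex_cnj_zero)
  qed (simp add: dense_w)
  then show "u = v" by simp
qed

lemma w_bop_eqI: "(\<And>xs. app a (w xs) = app b (w xs)) \<Longrightarrow> a = b"
  using bop_eq_dense[OF dense_w] by auto

lemma w_Cons_add: "w ((x + y) # xs) = w (x # xs) + w (y # xs)"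
  by (rule w_ext) (use q_gram_linear_right(1)[of q _ "[]"] in \<open>simp add: cinner_w cinner_simps\<close>)

lemma w_Cons_scale: "w ((c *\<^sub>C x) # xs) = c *\<^sub>C w (x # xs)"
  by (rule w_ext) (use q_gram_linear_right(2)[of q _ "[]"] in \<open>simp add: cinner_w cinner_simps\<close>)

text \<open>The action of the left annihilator on a word: the letter at position k is contracted
  after passing k letters, each at the price q.\<close>

definition anw :: "'h \<Rightarrow> 'h list \<Rightarrow> 'f" where
  "anw \<xi> xs = (\<Sum>k<length xs. (of_real q ^ k * cinner \<xi> (xs ! k)) *\<^sub>C w (del k xs))"

lemma cinner_w_Cons: "cinner (w (\<xi> # ys)) (w xs) = cinner (w ys) (anw \<xi> xs)"
  by (simp add: cinner_w q_gram_Cons anw_def cinner_sum_right cinner_scaleC_right)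

lemma cinner_w_Cons': "cinner (w xs) (w (\<xi> # ys)) = cinner (anw \<xi> xs) (w ys)"
  by (metis cinner_commute cinner_w_Cons)

lemma anw_Nil [simp]: "anw \<xi> [] = 0"
  by (simp add: anw_def)

lemma anw_Cons: "anw \<xi> (x # xs) = cinner \<xi> x *\<^sub>C w xs +
   of_real q *\<^sub>C (\<Sum>k<length xs. (of_real q ^ k * cinner \<xi> (xs ! k)) *\<^sub>C w (x # del k xs))"
  by (simp add: anw_def sum.lessThan_Suc_shift del_def scaleC_sum_right scaleC_scaleC mult.assoc
      del: sum.lessThan_Suc)

lemma anw_in: "length xs \<le> N \<Longrightarrow> anw \<xi> xs \<in> cspan (w ` {ys. length ys < N})"
  unfolding anw_def
  by (intro csubspace_sum[OF csubspace_cspan] cspan_scale cspan_base imageI) (auto simp: length_del)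

text \<open>Write g for the vector, l for the creator and h for the annihilated vector. The
  q-commutation relation gives |l g|^2 = |\<xi>|^2 |g|^2 + q |h|^2. Since h consists of shorter
  words, the bound already known for these gives, by duality, |h| <= C |g|. Induction on the length
  avoids presupposing that l is bounded.\<close>

lemma creation_bound:
  assumes "\<forall>p\<in>set l. length (snd p) < N"
  shows "norm (comb (\<lambda>xs. w (\<xi> # xs)) l) \<le> norm \<xi> / sqrt (1 - \<bar>q\<bar>) * norm (comb w l)"
  using assms
proof (induction N arbitrary: l)
  case 0
  then show ?case by (cases l) auto
next
  case (Suc N)
  \<comment> \<open>The solution of C^2 = |\<xi>|^2 + |q| C^2, the equation under which the
    induction reproduces its own bound.\<close>
  define C where "C = norm \<xi> / sqrt (1 - \<bar>q\<bar>)"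
  have C: "C \<ge> 0" "(norm \<xi>)\<^sup>2 + \<bar>q\<bar> * C\<^sup>2 = C\<^sup>2"
    using q_bounds by (auto simp: C_def power_divide field_simps)
  let ?g = "comb w l" and ?cg = "comb (\<lambda>xs. w (\<xi> # xs)) l" and ?h = "comb (anw \<xi>) l"
  have "cinner ?cg ?cg = cinner ?g (comb (\<lambda>xs. anw \<xi> (\<xi> # xs)) l)"
    by (rule cinner_comb_adjoint) (rule cinner_w_Cons)
  also have "\<dots> = cinner \<xi> \<xi> * cinner ?g ?g + of_real q * cinner ?g
      (comb (\<lambda>xs. \<Sum>k<length xs. (of_real q ^ k * cinner \<xi> (xs ! k)) *\<^sub>C w (\<xi> # del k xs)) l)"
    by (simp add: anw_Cons comb_add comb_scaleC cinner_simps)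
  also have "cinner ?g
      (comb (\<lambda>xs. \<Sum>k<length xs. (of_real q ^ k * cinner \<xi> (xs ! k)) *\<^sub>C w (\<xi> # del k xs)) l) =
      cinner ?h ?h"
    by (rule cinner_comb_adjoint)
      (simp add: cinner_sum_right cinner_scaleC_right cinner_w_Cons' anw_def[of _ "_ :: 'h list"])
  finally have "complex_of_real ((norm ?cg)\<^sup>2) = of_real ((norm \<xi>)\<^sup>2 * (norm ?g)\<^sup>2 + q * (norm ?h)\<^sup>2)"
    by (simp add: cinner_self)
  then have eq: "(norm ?cg)\<^sup>2 = (norm \<xi>)\<^sup>2 * (norm ?g)\<^sup>2 + q * (norm ?h)\<^sup>2"
    using of_real_eq_iff by blast
  have "?h \<in> cspan (w ` {ys. length ys < N})"
    by (rule comb_in_csubspace[OF csubspace_cspan], rule anw_in) (use Suc.prems in auto)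
  then obtain l' where l': "?h = comb w l'" "\<forall>p\<in>set l'. length (snd p) < N"
    using cspan_comb by force
  have "cinner ?h ?h = cinner (comb (\<lambda>xs. w (\<xi> # xs)) l') ?g"
    unfolding l'(1)[symmetric]
    by (subst l'(1)) (rule cinner_comb_adjoint, rule cinner_w_Cons[symmetric])
  then have "(norm ?h)\<^sup>2 = cmod (cinner (comb (\<lambda>xs. w (\<xi> # xs)) l') ?g)"
    by (metis cinner_self norm_of_real abs_power2)
  also have "\<dots> \<le> norm (comb (\<lambda>xs. w (\<xi> # xs)) l') * norm ?g"
    by (rule cinner_cauchy_schwarz)
  also have "\<dots> \<le> (C * norm ?h) * norm ?g"
    using Suc.IH[OF l'(2)] l'(1) by (intro mult_right_mono) (auto simp: C_def)
  finally have "norm ?h * norm ?h \<le> norm ?h * (C * norm ?g)"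
    by (simp add: power2_eq_square mult_ac)
  then have "norm ?h \<le> C * norm ?g"
    using C(1) by (cases "norm ?h = 0") auto
  then have "(norm ?h)\<^sup>2 \<le> C\<^sup>2 * (norm ?g)\<^sup>2"
    by (metis norm_ge_zero power_mono power_mult_distrib)
  then have "q * (norm ?h)\<^sup>2 \<le> \<bar>q\<bar> * (C\<^sup>2 * (norm ?g)\<^sup>2)"
    by (intro mult_mono) auto
  then have "(norm ?cg)\<^sup>2 \<le> ((norm \<xi>)\<^sup>2 + \<bar>q\<bar> * C\<^sup>2) * (norm ?g)\<^sup>2"
    by (simp add: eq distrib_right)
  then have "(norm ?cg)\<^sup>2 \<le> (C * norm ?g)\<^sup>2"
    by (simp add: C power_mult_distrib)
  then show ?case
    unfolding C_def[symmetric] by (rule power2_le_imp_le) (simp add: C(1))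
qed

definition cr :: "'h \<Rightarrow> 'f bop" where
  "cr \<xi> = (SOME T. (\<forall>xs. app T (w xs) = w (\<xi> # xs)) \<and> (\<forall>x. norm (app T x) \<le> norm \<xi> / sqrt (1 - \<bar>q\<bar>) * norm x))"

lemma cr_w: "app (cr \<xi>) (w xs) = w (\<xi> # xs)"
  and norm_cr: "norm (app (cr \<xi>) x) \<le> norm \<xi> / sqrt (1 - \<bar>q\<bar>) * norm x"
proof -
  have "\<exists>T. (\<forall>xs. app T (w xs) = w (\<xi> # xs)) \<and> (\<forall>x. norm (app T x) \<le> norm \<xi> / sqrt (1 - \<bar>q\<bar>) * norm x)"
  proof (rule bop_extension[OF dense_w])
    fix l :: "(complex \<times> 'h list) list"
    have "\<forall>p\<in>set l. length (snd p) < Suc (Max (insert 0 ((\<lambda>p. length (snd p)) ` set l)))"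
      by (auto simp: less_Suc_eq_le intro!: Max_ge)
    then show "norm (comb (\<lambda>xs. w (\<xi> # xs)) l) \<le> norm \<xi> / sqrt (1 - \<bar>q\<bar>) * norm (comb w l)"
      by (rule creation_bound)
  qed
  from someI_ex[OF this] show "app (cr \<xi>) (w xs) = w (\<xi> # xs)"
    "norm (app (cr \<xi>) x) \<le> norm \<xi> / sqrt (1 - \<bar>q\<bar>) * norm x"
    unfolding cr_def by blast+
qed

section \<open>Reversal of words and the right creation operators\<close>

definition flip :: "'f bop" where
  "flip = (SOME T. (\<forall>xs. app T (w xs) = w (rev xs)))"

lemma flip_w: "app flip (w xs) = w (rev xs)"
proof -
  have "\<exists>T. (\<forall>xs. app T (w xs) = w (rev xs)) \<and> (\<forall>x. norm (app T x) \<le> 1 * norm x)"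
  proof (rule bop_extension[OF dense_w])
    fix l :: "(complex \<times> 'h list) list"
    have "cinner (comb (\<lambda>xs. w (rev xs)) l) (comb (\<lambda>xs. w (rev xs)) l) = cinner (comb w l) (comb w l)"
      by (rule cinner_comb_adjoint) (simp add: cinner_w q_gram_rev)
    then have "norm (comb (\<lambda>xs. w (rev xs)) l) = norm (comb w l)"
      by (simp add: cinner_self flip: of_real_power)
    then show "norm (comb (\<lambda>xs. w (rev xs)) l) \<le> 1 * norm (comb w l)" by simp
  qed
  then have "\<exists>T. \<forall>xs. app T (w xs) = w (rev xs)" by blast
  from someI_ex[OF this] show ?thesis
    unfolding flip_def by blast
qed

lemma flip_flip: "flip * flip = 1"
  by (rule w_bop_eqI) (simp add: flip_w)

lemma star_eq_w:
  assumes "\<And>xs ys. cinner (app b (w xs)) (w ys) = cinner (w xs) (app a (w ys))"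
  shows "star a = b"
proof (rule w_bop_eqI)
  fix xs show "app (star a) (w xs) = app b (w xs)"
    by (rule w_ext) (metis assms cinner_commute cinner_star_left)
qed

lemma star_flip [simp]: "star flip = flip"
proof (rule star_eq_w)
  show "cinner (app flip (w xs)) (w ys) = cinner (w xs) (app flip (w ys))" for xs ys
    using q_gram_rev[of q xs "rev ys"] by (simp add: flip_w cinner_w)
qed

definition rc :: "'h \<Rightarrow> 'f bop" where
  "rc \<xi> = flip * cr \<xi> * flip"

lemma rc_w: "app (rc \<xi>) (w xs) = w (xs @ [\<xi>])"
  by (simp add: rc_def flip_w cr_w)

abbreviation an :: "'h \<Rightarrow> 'f bop" where "an \<xi> \<equiv> star (cr \<xi>)"
abbreviation ra :: "'h \<Rightarrow> 'f bop" where "ra \<xi> \<equiv> star (rc \<xi>)"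

lemma ra_eq: "ra \<xi> = flip * an \<xi> * flip"
  by (simp add: rc_def star_mult mult.assoc)

lemma an_w: "app (an \<xi>) (w xs) = anw \<xi> xs"
  by (rule w_ext) (simp add: cinner_star_right cr_w cinner_w_Cons)

text \<open>Words of different lengths are orthogonal, so the combination splits into orthogonal
  layers \<open>g n\<close>, on each of which the operator is the scalar \<open>f n\<close>.\<close>

lemma diagonal_bound:
  assumes "\<And>p. p \<in> set l \<Longrightarrow> \<bar>f (length (snd p))\<bar> \<le> K" "K \<ge> 0"
  shows "norm (comb (\<lambda>xs. of_real (f (length xs)) *\<^sub>C w xs) l) \<le> K * norm (comb w l)"
proof -
  define g where "g n = comb w (filter (\<lambda>p. length (snd p) = n) l)" for n
  obtain N where N: "\<forall>p\<in>set l. length (snd p) < N"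
  proof
    show "\<forall>p\<in>set l. length (snd p) < Suc (Max (insert 0 ((\<lambda>p. length (snd p)) ` set l)))"
      by (auto simp: less_Suc_eq_le intro!: Max_ge)
  qed
  have split: "comb (\<lambda>xs. of_real (f (length xs)) *\<^sub>C w xs) l = (\<Sum>n<N. of_real (f n) *\<^sub>C g n)" for f
  proof -
    have "comb (\<lambda>xs. of_real (f (length xs)) *\<^sub>C w xs) l' =
        (\<Sum>n<N. of_real (f n) *\<^sub>C comb w (filter (\<lambda>p. length (snd p) = n) l'))"
      if "\<forall>p\<in>set l'. length (snd p) < N" for l'
      using that
    proof (induction l')
      case (Cons p l')
      have "(\<Sum>n<N. of_real (f n) *\<^sub>C comb w (filter (\<lambda>p. length (snd p) = n) (p # l'))) =
        (\<Sum>n<N. (if n = length (snd p) then (of_real (f n) * fst p) *\<^sub>C w (snd p) else 0) +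
          of_real (f n) *\<^sub>C comb w (filter (\<lambda>p. length (snd p) = n) l'))"
        by (rule sum.cong) (auto simp: scaleC_add_right scaleC_scaleC)
      also have "\<dots> = (of_real (f (length (snd p))) * fst p) *\<^sub>C w (snd p) +
          comb (\<lambda>xs. of_real (f (length xs)) *\<^sub>C w xs) l'"
        using Cons by (simp add: sum.distrib)
      finally show ?case
        by (simp add: scaleC_scaleC mult.commute)
    qed simp
    then show ?thesis using N unfolding g_def by blast
  qed
  have orth: "cinner (g m) (g n) = 0" if "m \<noteq> n" for m n
  proof (rule orthogonal_closure_cspan(1)[of "w ` {xs. length xs = n}"])
    have "g n \<in> cspan (w ` {xs. length xs = n})" for n
      unfolding g_def by (rule comb_in_csubspace[OF csubspace_cspan]) (auto intro!: cspan_base)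
    then have g: "g n \<in> closure (cspan (w ` {xs. length xs = n}))" for n
      using closure_subset by blast
    then show "g n \<in> closure (cspan (w ` {xs. length xs = n}))" .
    fix s assume "s \<in> w ` {xs. length xs = n}"
    then obtain xs where xs: "s = w xs" "length xs = n" by auto
    show "cinner (g m) s = 0"
      by (rule orthogonal_closure_cspan(2)[of "w ` {xs. length xs = m}"])
        (use g that xs in \<open>auto simp: cinner_w q_gram_length\<close>)
  qed
  have pyth: "(norm (\<Sum>n<M. of_real (f n) *\<^sub>C g n))\<^sup>2 = (\<Sum>n<M. (f n)\<^sup>2 * (norm (g n))\<^sup>2)" for M f
  proof (induction M)
    case (Suc M)
    have "cinner (of_real (f M) *\<^sub>C g M) (\<Sum>n<M. of_real (f n) *\<^sub>C g n) = 0"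
      by (auto simp: cinner_sum_right cinner_simps orth intro!: sum.neutral)
    then show ?case
      using Suc norm_add_orthogonal[of "of_real (f M) *\<^sub>C g M" "\<Sum>n<M. of_real (f n) *\<^sub>C g n"]
      by (simp add: add.commute norm_scaleC power_mult_distrib)
  qed simp
  have zero: "g n = 0" if "\<not> \<bar>f n\<bar> \<le> K" for n
  proof -
    have "filter (\<lambda>p. length (snd p) = n) l = []"
      using assms(1) that by (auto simp: filter_empty_conv)
    then show ?thesis by (simp add: g_def)
  qed
  have "(\<Sum>n<N. (f n)\<^sup>2 * (norm (g n))\<^sup>2) \<le> (\<Sum>n<N. K\<^sup>2 * (norm (g n))\<^sup>2)"
  proof (rule sum_mono)
    fix n show "(f n)\<^sup>2 * (norm (g n))\<^sup>2 \<le> K\<^sup>2 * (norm (g n))\<^sup>2"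
    proof (cases "\<bar>f n\<bar> \<le> K")
      case True
      then show ?thesis
        using abs_le_square_iff[of "f n" K] assms(2) by (intro mult_right_mono) auto
    qed (simp add: zero)
  qed
  also have "\<dots> = K\<^sup>2 * (norm (\<Sum>n<N. of_real 1 *\<^sub>C g n))\<^sup>2"
    by (subst pyth[of "\<lambda>_. 1"]) (simp add: sum_distrib_left)
  also have "(\<Sum>n<N. of_real 1 *\<^sub>C g n) = comb w l"
    using split[of "\<lambda>_. 1"] by simp
  finally have "(norm (\<Sum>n<N. of_real (f n) *\<^sub>C g n))\<^sup>2 \<le> (K * norm (comb w l))\<^sup>2"
    by (simp add: pyth power_mult_distrib)
  then show ?thesis
    unfolding split by (rule power2_le_imp_le) (simp add: assms(2))
qed

text \<open>The operator t^N with N the word length, that is, the second quantization of the scalar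
  t. The value t = q measures how left and right operators fail to commute, t = 0 gives the vacuum
  projection (0^0 = 1), and t = -1 the parity operator.\<close>

definition dil :: "real \<Rightarrow> 'f bop" where
  "dil t = (SOME T. \<forall>xs. app T (w xs) = of_real (t ^ length xs) *\<^sub>C w xs)"

lemma dil_w: "\<bar>t\<bar> \<le> 1 \<Longrightarrow> app (dil t) (w xs) = of_real (t ^ length xs) *\<^sub>C w xs"
proof -
  assume t: "\<bar>t\<bar> \<le> 1"
  have "\<exists>T. (\<forall>xs. app T (w xs) = of_real (t ^ length xs) *\<^sub>C w xs) \<and> (\<forall>x. norm (app T x) \<le> 1 * norm x)"
    by (rule bop_extension[OF dense_w], rule diagonal_bound) (auto simp: power_abs power_le_one t)
  then have "\<exists>T. \<forall>xs. app T (w xs) = of_real (t ^ length xs) *\<^sub>C w xs" by blast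
  from someI_ex[OF this] show ?thesis
    unfolding dil_def by blast
qed

lemma abs_q [simp]: "\<bar>q\<bar> \<le> 1"
  using q_bounds by auto

lemma norm_w_Nil: "cinner \<Omega> \<Omega> = 1"
  by (simp add: cinner_w)

section \<open>Commutation relations of left operators, right operators and dilations\<close>

lemma cr_add: "cr (x + y) = cr x + cr y"
  by (rule w_bop_eqI) (simp add: cr_w app_simps w_Cons_add)

lemma cr_scaleC: "cr (c *\<^sub>C x) = c *\<^sub>C cr x"
  by (rule w_bop_eqI) (simp add: cr_w app_simps w_Cons_scale)

lemma rc_scaleC: "rc (c *\<^sub>C x) = c *\<^sub>C rc x"
  by (simp add: rc_def cr_scaleC)

lemma an_cr: "an x * cr y = of_real q *\<^sub>C (cr y * an x) + cinner x y *\<^sub>C 1"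
proof (rule w_bop_eqI)
  fix xs
  show "app (an x * cr y) (w xs) = app (of_real q *\<^sub>C (cr y * an x) + cinner x y *\<^sub>C 1) (w xs)"
    by (simp add: app_simps cr_w an_w anw_Cons) (simp add: anw_def app_sum_right app_simps cr_w)
qed

lemma ra_rc: "ra x * rc y = of_real q *\<^sub>C (rc y * ra x) + cinner x y *\<^sub>C 1"
proof -
  have "ra x * rc y = flip * (an x * (flip * flip) * cr y) * flip"
    by (simp only: ra_eq) (simp only: rc_def mult.assoc)
  also have "\<dots> = flip * (an x * cr y) * flip"
    by (simp add: flip_flip)
  also have "\<dots> = of_real q *\<^sub>C (flip * cr y * an x * flip) + cinner x y *\<^sub>C 1"
    by (simp add: an_cr algebra_simps flip_flip)
  also have "flip * cr y * an x * flip = flip * cr y * (flip * flip) * an x * flip"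
    by (simp add: flip_flip)
  also have "\<dots> = rc y * ra x"
    by (simp only: ra_eq) (simp only: rc_def mult.assoc)
  finally show ?thesis .
qed

lemma cr_rc: "cr x * rc y = rc y * cr x"
  by (rule w_bop_eqI) (simp add: cr_w rc_w)

lemma an_ra: "an x * ra y = ra y * an x"
  using arg_cong[OF cr_rc, of star] by (metis star_mult)

text \<open>The appended letter y is contracted only after all letters of the word have been passed,
  whence the factor q^N.\<close>

lemma an_rc: "an x * rc y = rc y * an x + cinner x y *\<^sub>C dil q"
proof (rule w_bop_eqI)
  fix xs
  have "anw x (xs @ [y]) = app (rc y) (anw x xs) + (of_real q ^ length xs * cinner x y) *\<^sub>C w xs"
    by (simp add: anw_def app_sum_right app_simps rc_w nth_append del_def)
  then show "app (an x * rc y) (w xs) = app (rc y * an x + cinner x y *\<^sub>C dil q) (w xs)"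
    by (simp add: app_simps rc_w an_w dil_w scaleC_scaleC mult.commute)
qed

lemma dil_cr: "\<bar>t\<bar> \<le> 1 \<Longrightarrow> dil t * cr x = of_real t *\<^sub>C (cr x * dil t)"
  by (rule w_bop_eqI) (simp add: app_simps cr_w dil_w scaleC_scaleC)

lemma dil_rc: "\<bar>t\<bar> \<le> 1 \<Longrightarrow> dil t * rc x = of_real t *\<^sub>C (rc x * dil t)"
  by (rule w_bop_eqI) (simp add: app_simps rc_w dil_w scaleC_scaleC)

lemma dil_dil: "\<bar>t\<bar> \<le> 1 \<Longrightarrow> \<bar>s\<bar> \<le> 1 \<Longrightarrow> dil t * dil s = dil (t * s)"
  by (rule w_bop_eqI)
    (simp add: app_simps dil_w scaleC_scaleC power_mult_distrib mult.commute abs_mult mult_le_one)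

lemma star_dil: "\<bar>t\<bar> \<le> 1 \<Longrightarrow> star (dil t) = dil t"
proof (rule star_eq_w)
  show "cinner (app (dil t) (w xs)) (w ys) = cinner (w xs) (app (dil t) (w ys))" if "\<bar>t\<bar> \<le> 1" for xs ys
    using that by (cases "length xs = length ys") (auto simp: dil_w cinner_simps cinner_w q_gram_length)
qed

lemma ra_cr: "ra x * cr y = cr y * ra x + cinner x y *\<^sub>C dil q"
proof -
  have "star (an y * rc x) = star (rc x * an y + cinner y x *\<^sub>C dil q)"
    by (simp add: an_rc)
  then show ?thesis
    by (simp add: star_mult star_add star_scaleC star_dil cinner_commute[of x y])
qed

lemma an_dil: "\<bar>t\<bar> \<le> 1 \<Longrightarrow> an x * dil t = of_real t *\<^sub>C (dil t * an x)"
  using arg_cong[OF dil_cr[of t x], of star] by (simp add: star_mult star_scaleC star_dil)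

lemma ra_dil: "\<bar>t\<bar> \<le> 1 \<Longrightarrow> ra x * dil t = of_real t *\<^sub>C (dil t * ra x)"
  using arg_cong[OF dil_rc[of t x], of star] by (simp add: star_mult star_scaleC star_dil)

lemma dil_0: "dil 0 = rk \<Omega> \<Omega>"
proof (rule w_bop_eqI)
  fix xs :: "'h list"
  show "app (dil 0) (w xs) = app (rk \<Omega> \<Omega>) (w xs)"
    by (cases xs) (auto simp: dil_w cinner_w q_gram_length)
qed

lemma dil_Nil [simp]: "\<bar>t\<bar> \<le> 1 \<Longrightarrow> app (dil t) \<Omega> = \<Omega>"
  by (simp add: dil_w)

lemma an_Nil [simp]: "app (an x) \<Omega> = 0"
  by (simp add: an_w)

lemma ra_Nil [simp]: "app (ra x) \<Omega> = 0"
  by (simp add: ra_eq flip_w)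

lemma dil_injective:
  assumes "\<bar>t\<bar> \<le> 1" "t \<noteq> 0" "app (dil t) x = 0"
  shows "x = 0"
proof (rule w_ext)
  fix xs
  have "0 = cinner (w xs) (app (dil t) x)" by (simp add: assms)
  also have "\<dots> = cinner (app (dil t) (w xs)) x"
    by (metis assms(1) cinner_star_left star_dil)
  also have "\<dots> = of_real (t ^ length xs) * cinner (w xs) x"
    using assms(1) by (simp add: dil_w cinner_simps)
  finally show "cinner (w xs) x = cinner (w xs) 0"
    using assms(2) by simp
qed

text \<open>Dropping the words shorter than N from an approximation of y only improves it, because
  that part is orthogonal to y and to the remaining words. On what remains the operator is bounded
  by |t|^N.\<close>

lemma norm_dil_high:
  assumes "\<bar>t\<bar> \<le> 1" and y: "y \<in> closure (cspan (w ` lists L))"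
    and orth: "\<And>xs. xs \<in> lists L \<Longrightarrow> length xs < N \<Longrightarrow> cinner (w xs) y = 0"
  shows "norm (app (dil t) y) \<le> \<bar>t\<bar> ^ N * norm y"
proof -
  obtain f where f: "\<And>n. f n \<in> cspan (w ` lists L)" "f \<longlonglongrightarrow> y"
    using y unfolding closure_sequential by blast
  have "\<exists>g. norm (y - g) \<le> norm (y - f n) \<and> norm (app (dil t) g) \<le> \<bar>t\<bar> ^ N * norm g" for n
  proof -
    obtain l where l: "f n = comb w l" "snd ` set l \<subseteq> lists L"
      using cspan_comb[OF f(1)] by blast
    define lo where "lo = filter (\<lambda>p. length (snd p) < N) l"
    define hi where "hi = filter (\<lambda>p. \<not> length (snd p) < N) l"
    have split: "comb w l = comb w lo + comb w hi"
      unfolding lo_def hi_def by (induction l) (auto simp: algebra_simps)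
    have lo: "comb w lo \<in> closure (cspan (w ` {xs. xs \<in> lists L \<and> length xs < N}))"
    proof -
      have "comb w lo \<in> cspan (w ` {xs. xs \<in> lists L \<and> length xs < N})"
        by (rule comb_in_csubspace[OF csubspace_cspan]) (use l in \<open>auto intro!: cspan_base simp: lo_def\<close>)
      then show ?thesis using closure_subset by blast
    qed
    have "cinner y (comb w lo) = 0"
    proof (rule orthogonal_closure_cspan(1)[OF _ lo])
      fix s assume "s \<in> w ` {xs. xs \<in> lists L \<and> length xs < N}"
      then show "cinner y s = 0"
        using orth by (metis (mono_tags, lifting) cinner_commute complex_cnj_zero imageE mem_Collect_eq)
    qed
    moreover have "cinner (comb w hi) (comb w lo) = 0"
    proof (rule orthogonal_closure_cspan(1)[OF _ lo])
      fix s assume "s \<in> w ` {xs. xs \<in> lists L \<and> length xs < N}"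
      then obtain xs where s: "s = w xs" "length xs < N" by auto
      have "comb w hi \<in> cspan (w ` {xs. \<not> length xs < N})"
        by (rule comb_in_csubspace[OF csubspace_cspan]) (auto intro!: cspan_base simp: hi_def)
      then have "comb w hi \<in> closure (cspan (w ` {xs. \<not> length xs < N}))"
        using closure_subset by blast
      then show "cinner (comb w hi) s = 0"
        by (rule orthogonal_closure_cspan(2)[rotated]) (use s in \<open>auto simp: cinner_w intro!: q_gram_length\<close>)
    qed
    ultimately have "(norm ((y - comb w hi) + - comb w lo))\<^sup>2 = (norm (y - comb w hi))\<^sup>2 + (norm (comb w lo))\<^sup>2"
      by (subst norm_add_orthogonal) (auto simp: cinner_simps)
    moreover have "(y - comb w hi) + - comb w lo = y - f n"
      by (simp add: l split)
    ultimately have "(norm (y - f n))\<^sup>2 = (norm (y - comb w hi))\<^sup>2 + (norm (comb w lo))\<^sup>2"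
      by (simp only:)
    then have "(norm (y - comb w hi))\<^sup>2 \<le> (norm (y - f n))\<^sup>2"
      by simp
    then have 1: "norm (y - comb w hi) \<le> norm (y - f n)"
      by (rule power2_le_imp_le) simp
    have *: "app (dil t) (comb w l') = comb (\<lambda>xs. of_real (t ^ length xs) *\<^sub>C w xs) l'" for l'
      by (induction l') (auto simp: app_simps dil_w assms(1))
    have "norm (app (dil t) (comb w hi)) \<le> \<bar>t\<bar> ^ N * norm (comb w hi)"
    proof -
      have "\<bar>t ^ length (snd p)\<bar> \<le> \<bar>t\<bar> ^ N" if "p \<in> set hi" for p
        using that assms(1) by (auto simp: hi_def power_abs intro!: power_decreasing)
      then show ?thesis
        using diagonal_bound[of hi "\<lambda>n. t ^ n" "\<bar>t\<bar> ^ N"] * by simp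
    qed
    with 1 show ?thesis by blast
  qed
  then obtain g where g: "\<And>n. norm (y - g n) \<le> norm (y - f n)"
      "\<And>n. norm (app (dil t) (g n)) \<le> \<bar>t\<bar> ^ N * norm (g n)"
    by metis
  have "(\<lambda>n. norm (y - f n)) \<longlonglongrightarrow> norm (y - y)"
    by (intro tendsto_intros f)
  then have lim0: "(\<lambda>n. norm (y - f n)) \<longlonglongrightarrow> 0"
    by simp
  have "(\<lambda>n. norm (y - g n)) \<longlonglongrightarrow> 0"
    by (rule tendsto_sandwich[OF _ _ tendsto_const lim0]) (simp_all add: g(1))
  then have "(\<lambda>n. y - (y - g n)) \<longlonglongrightarrow> y - 0"
    by (intro tendsto_diff tendsto_const) (simp add: tendsto_norm_zero_iff)
  then have lim: "g \<longlonglongrightarrow> y" by simp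
  show ?thesis
  proof (rule LIMSEQ_le)
    show "(\<lambda>n. norm (app (dil t) (g n))) \<longlonglongrightarrow> norm (app (dil t) y)"
      "(\<lambda>n. \<bar>t\<bar> ^ N * norm (g n)) \<longlonglongrightarrow> \<bar>t\<bar> ^ N * norm y"
      by (intro tendsto_intros lim)+
  qed (use g(2) in auto)
qed

end

section \<open>Averages along Chebyshev sequences\<close>

text \<open>Cesaro convergence to zero. Telescoping bounds sums of matrix elements and not single
  ones, so only averages can be controlled.\<close>

definition average_null :: "(nat \<Rightarrow> complex) \<Rightarrow> bool" where
  "average_null s \<longleftrightarrow> (\<lambda>M. (\<Sum>m<M. s m) / of_nat M) \<longlonglongrightarrow> 0"

lemma average_null_zero [simp]: "average_null (\<lambda>_. 0)"
  by (simp add: average_null_def)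

lemma average_null_add: "average_null s \<Longrightarrow> average_null t \<Longrightarrow> average_null (\<lambda>m. s m + t m)"
  unfolding average_null_def using tendsto_add[of _ 0 _ _ 0]
  by (fastforce simp: sum.distrib add_divide_distrib)

lemma average_null_cmult: "average_null s \<Longrightarrow> average_null (\<lambda>m. c * s m)"
  unfolding average_null_def using tendsto_mult_right_zero[of _ _ c]
  by (fastforce simp: sum_distrib_left[symmetric])

lemma average_null_bounded_sums:
  assumes "\<And>M. cmod (\<Sum>m<M. s m) \<le> K"
  shows "average_null s"
  unfolding average_null_def
proof (rule tendsto_norm_zero_cancel, rule tendsto_sandwich[OF _ _ tendsto_const])
  show "(\<lambda>M. K * inverse (real M)) \<longlonglongrightarrow> 0"
    using tendsto_mult_right_zero[OF lim_inverse_n, of K] by simp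
  show "\<forall>\<^sub>F M in sequentially. cmod ((\<Sum>m<M. s m) / of_nat M) \<le> K * inverse (real M)"
    using assms by (auto simp: norm_mult norm_inverse divide_inverse intro!: always_eventually mult_right_mono)
qed auto

text \<open>The error may contain a null sequence \<open>s2\<close>, because estimates such as 2 x y
  <= x^2 + y^2 leave squares that are small only on average.\<close>

lemma average_null_dominated:
  assumes "\<And>e. e > 0 \<Longrightarrow> \<exists>s1 s2. average_null s1 \<and> average_null s2 \<and> (\<forall>m. cmod (s m - s1 m) \<le> e + Re (s2 m))"
  shows "average_null s"
  unfolding average_null_def
proof (rule LIMSEQ_I)
  fix r :: real assume "r > 0"
  then obtain s1 s2 where s: "average_null s1" "average_null s2" "\<And>m. cmod (s m - s1 m) \<le> r / 4 + Re (s2 m)"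
    using assms[of "r / 4"] by auto
  let ?A = "\<lambda>s M. (\<Sum>m<M. s m) / of_nat M :: complex"
  obtain N1 where N1: "\<And>M. M \<ge> N1 \<Longrightarrow> norm (?A s1 M - 0) < r / 4"
    using LIMSEQ_D[OF s(1)[unfolded average_null_def], of "r / 4"] \<open>r > 0\<close> by auto
  obtain N2 where N2: "\<And>M. M \<ge> N2 \<Longrightarrow> norm (?A s2 M - 0) < r / 4"
    using LIMSEQ_D[OF s(2)[unfolded average_null_def], of "r / 4"] \<open>r > 0\<close> by auto
  have "norm (?A s M - 0) < r" if M: "M \<ge> max 1 (max N1 N2)" for M
  proof -
    have "cmod (\<Sum>m<M. s m - s1 m) \<le> (\<Sum>m<M. r / 4 + Re (s2 m))"
      by (rule order_trans[OF norm_sum sum_mono]) (rule s(3))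
    also have "\<dots> = real M * (r / 4) + Re (\<Sum>m<M. s2 m)"
      by (simp add: sum.distrib)
    finally have "cmod (\<Sum>m<M. s m - s1 m) / real M \<le> (real M * (r / 4) + Re (\<Sum>m<M. s2 m)) / real M"
      by (rule divide_right_mono) simp
    also have "\<dots> = r / 4 + Re (?A s2 M)"
      using M by (simp add: add_divide_distrib)
    also have "\<dots> < r / 4 + r / 4"
      using N2[of M] M complex_Re_le_cmod[of "?A s2 M"] by simp
    finally have "cmod (?A s M - ?A s1 M) < r / 4 + r / 4"
      by (simp add: diff_divide_distrib[symmetric] sum_subtractf[symmetric] norm_divide)
    then show ?thesis
      using N1[of M] M norm_triangle_ineq[of "?A s M - ?A s1 M" "?A s1 M"] \<open>r > 0\<close> by simp
  qed
  then show "\<exists>no. \<forall>n\<ge>no. norm (?A s n - 0) < r" by blast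
qed

lemma average_null_approx:
  assumes "\<And>e. e > 0 \<Longrightarrow> \<exists>s1. average_null s1 \<and> (\<forall>m. cmod (s m - s1 m) \<le> e)"
  shows "average_null s"
proof (rule average_null_dominated)
  fix e :: real assume "e > 0"
  then obtain s1 where "average_null s1" "\<forall>m. cmod (s m - s1 m) \<le> e" using assms by blast
  then show "\<exists>s1 s2. average_null s1 \<and> average_null s2 \<and> (\<forall>m. cmod (s m - s1 m) \<le> e + Re (s2 m))"
    by (intro exI[of _ s1] exI[of _ "\<lambda>_. 0"]) auto
qed

text \<open>Small mean squares give small means: K t <= e + (K^2 / e) t^2 for every e > 0.\<close>

lemma average_null_sq_le:
  assumes "average_null (\<lambda>m. of_real ((cmod (t m))\<^sup>2))" "\<And>m. cmod (s m) \<le> K * cmod (t m)"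
  shows "average_null s"
proof (rule average_null_dominated)
  fix e :: real assume "e > 0"
  have "cmod (s m - 0) \<le> e + Re (of_real (K\<^sup>2 / e) * of_real ((cmod (t m))\<^sup>2))" for m
  proof -
    have "0 \<le> (e - K * cmod (t m))\<^sup>2" by simp
    then have "e * (2 * K * cmod (t m)) \<le> e\<^sup>2 + K\<^sup>2 * (cmod (t m))\<^sup>2"
      by (simp add: power2_eq_square algebra_simps)
    moreover have "e * (K * cmod (t m)) \<le> e * (2 * K * cmod (t m))"
      using \<open>e > 0\<close> order_trans[OF norm_ge_zero assms(2)[of m]] by simp
    ultimately have "e * (K * cmod (t m)) \<le> e * (e + K\<^sup>2 / e * (cmod (t m))\<^sup>2)"
      using \<open>e > 0\<close> by (simp add: power2_eq_square algebra_simps)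
    then have "K * cmod (t m) \<le> e + K\<^sup>2 / e * (cmod (t m))\<^sup>2"
      using \<open>e > 0\<close> by simp
    then show ?thesis
      using assms(2)[of m] by (simp flip: of_real_mult of_real_power)
  qed
  then show "\<exists>s1 s2. average_null s1 \<and> average_null s2 \<and> (\<forall>m. cmod (s m - s1 m) \<le> e + Re (s2 m))"
    using average_null_cmult[OF assms(1)] average_null_zero by blast
qed

text \<open>Chebyshev polynomials of the first kind: cos (n \<theta>) for g = cos \<theta>.\<close>

fun cheb :: "'a::chilbert_space bop \<Rightarrow> nat \<Rightarrow> 'a bop" where
  "cheb g 0 = 1"
| "cheb g (Suc 0) = g"
| "cheb g (Suc (Suc n)) = g * cheb g (Suc n) + g * cheb g (Suc n) - cheb g n"

lemma cheb_intertwine: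
  assumes "a * g = g' * a"
  shows "a * cheb g n = cheb g' n * a"
proof (induction n rule: induct_nat_012)
  case (ge2 n)
  have "a * cheb g (Suc (Suc n)) =
      (a * g) * cheb g (Suc n) + (a * g) * cheb g (Suc n) - a * cheb g n"
    by (simp only: cheb.simps right_diff_distrib distrib_left mult.assoc)
  also have "\<dots> = g' * (a * cheb g (Suc n)) + g' * (a * cheb g (Suc n)) - a * cheb g n"
    by (simp only: assms mult.assoc)
  also have "\<dots> = cheb g' (Suc (Suc n)) * a"
    by (simp only: ge2 cheb.simps left_diff_distrib distrib_right mult.assoc)
  finally show ?case .
qed (use assms in auto)

lemma cheb_commute: "a * g = g * a \<Longrightarrow> a * cheb g n = cheb g n * a"
  by (rule cheb_intertwine)

text \<open>In the recursion g is moved through \<open>cheb k\<close> to reach x, is replaced there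
  by k, and returns as k.\<close>

lemma cheb_agree:
  assumes "app g x = app k x" "g * k = k * g"
  shows "app (cheb g n) x = app (cheb k n) x"
proof (induction n rule: induct_nat_012)
  case (ge2 n)
  have "app g (app (cheb k (Suc n)) x) = app (cheb k (Suc n)) (app g x)"
    using arg_cong[OF cheb_commute[OF assms(2), of "Suc n"], of "\<lambda>c. app c x"] by simp
  also have "\<dots> = app k (app (cheb k (Suc n)) x)"
    using arg_cong[OF cheb_commute[of k k "Suc n"], of "\<lambda>c. app c x"] by (simp add: assms)
  finally show ?case
    using ge2 by (simp add: app_simps)
qed (use assms in auto)

text \<open>The bound 1/2 keeps the spectrum away from 1 and -1, where the conserved quantity |x|^2
  - |g x|^2 degenerates (it is the square of sin \<theta> for g = cos \<theta>).\<close>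

locale half_contraction =
  fixes g :: "'a::chilbert_space bop"
  assumes sa: "star g = g" and half: "\<And>x. norm (app g x) \<le> norm x / 2"
begin

lemma cinner_g: "cinner (app g x) y = cinner x (app g y)"
  by (metis cinner_star_left sa)

lemma inner_g: "inner (app g x) y = inner x (app g y)"
  by (simp add: inner_eq_Re_cinner cinner_g)

text \<open>A conserved quantity of the recursion \<open>u (n + 2) = 2 g u (n + 1) - u n\<close>. It bounds the
  Chebyshev sequence from above and from below.\<close>

lemma energy:
  fixes x defines "u \<equiv> \<lambda>n. app (cheb g n) x"
  shows "(norm (u (Suc n)))\<^sup>2 + (norm (u n))\<^sup>2 - 2 * inner (app g (u n)) (u (Suc n)) =
    (norm x)\<^sup>2 - (norm (app g x))\<^sup>2"
proof (induction n)
  case 0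
  show ?case by (simp add: u_def power2_norm_eq_inner)
next
  case (Suc n)
  have u: "u (Suc (Suc n)) = app g (u (Suc n)) + app g (u (Suc n)) - u n"
    by (simp add: u_def app_simps)
  have "inner (u (Suc n)) (app g (u n)) = inner (u n) (app g (u (Suc n)))"
    by (metis inner_commute inner_g)
  then show ?case
    using Suc unfolding u
    by (simp add: power2_norm_eq_inner inner_add_left inner_add_right inner_diff_left
        inner_diff_right inner_g inner_commute)
qed

text \<open>By the bound on g the cross term is at most half of the sum of the two squares, and the
  conserved quantity lies between 3/4 and 1 times |x|^2.\<close>

lemma energy_bounds:
  shows cheb_upper: "norm (app (cheb g n) x) \<le> 2 * norm x"
    and cheb_lower: "(norm x)\<^sup>2 / 2 \<le> (norm (app (cheb g (Suc n)) x))\<^sup>2 + (norm (app (cheb g n) x))\<^sup>2"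
proof -
  let ?u = "\<lambda>n. app (cheb g n) x"
  let ?S = "(norm (?u (Suc n)))\<^sup>2 + (norm (?u n))\<^sup>2"
  have "\<bar>2 * inner (app g (?u n)) (?u (Suc n))\<bar> \<le> norm (?u n) * norm (?u (Suc n))"
  proof -
    have "\<bar>inner (app g (?u n)) (?u (Suc n))\<bar> \<le> norm (app g (?u n)) * norm (?u (Suc n))"
      by (rule Cauchy_Schwarz_ineq2)
    also have "\<dots> \<le> (norm (?u n) / 2) * norm (?u (Suc n))"
      by (intro mult_right_mono half) auto
    finally show ?thesis by simp
  qed
  moreover have "norm (?u n) * norm (?u (Suc n)) \<le> ?S / 2"
    using sum_squares_bound[of "norm (?u n)" "norm (?u (Suc n))"] by simp
  ultimately have b: "\<bar>2 * inner (app g (?u n)) (?u (Suc n))\<bar> \<le> ?S / 2" by linarith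
  have "(norm (app g x))\<^sup>2 \<le> (norm x / 2)\<^sup>2"
    by (intro power_mono half) auto
  then have c: "(norm (app g x))\<^sup>2 \<le> (norm x)\<^sup>2 / 4"
    by (simp add: power_divide)
  have e: "?S - 2 * inner (app g (?u n)) (?u (Suc n)) = (norm x)\<^sup>2 - (norm (app g x))\<^sup>2"
    by (rule energy)
  show "(norm x)\<^sup>2 / 2 \<le> ?S"
  proof -
    have "n / 2 \<le> S" if "- X \<le> S / 2" "G \<le> n / 4" "S - X = n - G" for S X G n :: real
      using that by linarith
    from this[OF abs_le_D2[OF b] c e] show ?thesis .
  qed
  have "?S \<le> 2 * (norm x)\<^sup>2"
  proof -
    have "S \<le> 2 * n" if "X \<le> S / 2" "0 \<le> G" "S - X = n - G" for S X G n :: real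
      using that by linarith
    from this[OF abs_le_D1[OF b] zero_le_power2 e] show ?thesis .
  qed
  then have "(norm (?u n))\<^sup>2 \<le> (2 * norm x)\<^sup>2"
  proof -
    have "a \<le> 4 * n" if "b + a \<le> 2 * n" "0 \<le> b" "0 \<le> n" for a b n :: real
      using that by linarith
    from this[OF \<open>?S \<le> 2 * (norm x)\<^sup>2\<close> zero_le_power2 zero_le_power2] show ?thesis
      by (simp add: power_mult_distrib)
  qed
  then show "norm (?u n) \<le> 2 * norm x"
    by (rule power2_le_imp_le) simp
qed

text \<open>Two consecutive squares add up to at least |x|^2 / 2, so the averages cannot fall below
  |x|^2 / 8 in the long run.\<close>

lemma cheb_average_null_imp_zero:
  assumes "average_null (\<lambda>m. of_real ((norm (app (cheb g m) x))\<^sup>2))"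
  shows "x = 0"
proof (rule ccontr)
  assume "x \<noteq> 0"
  let ?s = "\<lambda>m. (norm (app (cheb g m) x))\<^sup>2"
  define r where "r = (norm x)\<^sup>2 / 8"
  have "r > 0" using \<open>x \<noteq> 0\<close> by (simp add: r_def)
  then obtain N where N: "\<And>M. M \<ge> N \<Longrightarrow> norm ((\<Sum>m<M. complex_of_real (?s m)) / of_nat M - 0) < r"
    using LIMSEQ_D[OF assms[unfolded average_null_def]] by blast
  define M where "M = Suc N"
  have "real M * ((norm x)\<^sup>2 / 2) = (\<Sum>m<M. (norm x)\<^sup>2 / 2)" by simp
  also have "\<dots> \<le> (\<Sum>m<M. ?s (Suc m) + ?s m)"
    by (intro sum_mono cheb_lower)
  also have "\<dots> = (\<Sum>m<M. ?s (Suc m)) + (\<Sum>m<M. ?s m)"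
    by (rule sum.distrib)
  also have "\<dots> \<le> (\<Sum>m<Suc M. ?s m) + (\<Sum>m<Suc M. ?s m)"
  proof (rule add_mono)
    show "(\<Sum>m<M. ?s (Suc m)) \<le> (\<Sum>m<Suc M. ?s m)"
      by (subst sum.lessThan_Suc_shift) simp
  qed simp
  finally have 1: "real M * ((norm x)\<^sup>2 / 4) \<le> (\<Sum>m<Suc M. ?s m)" by simp
  have "(\<Sum>m<Suc M. complex_of_real (?s m)) = of_real (\<Sum>m<Suc M. ?s m)"
    by (simp only: of_real_sum)
  then have "(\<Sum>m<Suc M. ?s m) / real (Suc M) < r"
    using N[of "Suc M"] sum_nonneg[of "{..<Suc M}" ?s]
    by (simp only: diff_0_right norm_divide norm_of_real norm_of_nat) (auto simp: M_def)
  then have "(\<Sum>m<Suc M. ?s m) < r * real (Suc M)"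
    by (simp add: divide_less_eq)
  also have "r * real (Suc M) \<le> r * (2 * real M)"
    using \<open>r > 0\<close> by (intro mult_left_mono) (auto simp: M_def)
  finally have "(\<Sum>m<Suc M. ?s m) < real M * ((norm x)\<^sup>2 / 4)"
    by (simp add: r_def algebra_simps)
  with 1 show False by simp
qed

text \<open>For m > 0 the relation 2 g u_m = u_(m+1) + u_(m-1) turns twice the m-th term into G m -
  G (m - 1), so the partial sums stay bounded.\<close>

lemma average_null_commutator:
  "average_null (\<lambda>m. cinner (app (cheb g m) x) (app (Y * g - g * Y) (app (cheb g m) x)))"
proof -
  let ?u = "\<lambda>n. app (cheb g n) x"
  let ?s = "\<lambda>m. cinner (?u m) (app (Y * g - g * Y) (?u m))"
  define G where "G m = cinner (?u m) (app Y (?u (Suc m))) - cinner (?u (Suc m)) (app Y (?u m))" for m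
  \<comment> \<open>The start u_1 = g u_0 has no factor two, so the term at m = 0 contributes 2 G 0;
    this is why G 0 survives with a plus sign.\<close>
  have sum: "2 * (\<Sum>m<Suc M. ?s m) = G 0 + G M" for M
  proof (induction M)
    case 0
    show ?case by (simp add: G_def app_simps cinner_simps cinner_g[symmetric])
  next
    case (Suc M)
    have "app g (?u (Suc M)) + app g (?u (Suc M)) = ?u (Suc (Suc M)) + ?u M"
      by (simp add: app_simps)
    then have *: "2 * cinner y (app g (?u (Suc M))) = cinner y (?u (Suc (Suc M))) + cinner y (?u M)"
      "2 * cinner (app g (?u (Suc M))) y = cinner (?u (Suc (Suc M))) y + cinner (?u M) y" for y
      by (metis cinner_add_right mult_2, metis cinner_add_left mult_2)
    have **: "2 * cinner y (app Y (app g (?u (Suc M)))) = cinner y (app Y (?u (Suc (Suc M)))) + cinner y (app Y (?u M))" for y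
      using *(1)[of "app (star Y) y"] by (simp only: cinner_star_left)
    have "2 * ?s (Suc M) = G (Suc M) - G M"
    proof -
      have "?s (Suc M) = cinner (?u (Suc M)) (app Y (app g (?u (Suc M)))) - cinner (app g (?u (Suc M))) (app Y (?u (Suc M)))"
        by (simp only: app_diff app_mult cinner_diff_right cinner_g)
      then show ?thesis
        using *(2)[of "app Y (?u (Suc M))"] **[of "?u (Suc M)"] unfolding G_def
        by (simp only: right_diff_distrib) simp
    qed
    then show ?case
      using Suc by (simp only: sum.lessThan_Suc[of _ "Suc M"] distrib_left) simp
  qed
  obtain K where K: "K > 0" "\<And>x. norm (app Y x) \<le> K * norm x"
    using app_bounded by blast
  define B where "B = (2 * norm x) * (K * (2 * norm x))"
  have "cmod (cinner (?u m) (app Y (?u n))) \<le> B" for m n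
  proof -
    have "cmod (cinner (?u m) (app Y (?u n))) \<le> norm (?u m) * norm (app Y (?u n))"
      by (rule cinner_cauchy_schwarz)
    also have "\<dots> \<le> (2 * norm x) * (K * (2 * norm x))"
      using cheb_upper K by (intro mult_mono order_trans[OF K(2)] mult_left_mono) (auto intro: less_imp_le)
    finally show ?thesis by (simp add: B_def)
  qed
  then have G: "cmod (G m) \<le> 2 * B" for m
    unfolding G_def mult_2 by (intro norm_triangle_le_diff add_mono)
  have "0 \<le> B" using K(1) by (simp add: B_def)
  have "cmod (\<Sum>m<M. ?s m) \<le> 2 * B" for M
  proof (cases M)
    case 0
    then show ?thesis using \<open>0 \<le> B\<close> by simp
  next
    case (Suc M')
    have "2 * cmod (\<Sum>m<M. ?s m) = cmod (2 * (\<Sum>m<M. ?s m))"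
      by (simp only: norm_mult) simp
    also have "\<dots> = cmod (G 0 + G M')"
      by (simp only: Suc sum)
    also have "\<dots> \<le> 2 * B + 2 * B"
      by (intro norm_triangle_le add_mono G)
    finally show ?thesis by simp
  qed
  then show ?thesis by (rule average_null_bounded_sums)
qed

end

section \<open>Norm limits of finite rank operators\<close>

text \<open>The compact operators of a Hilbert space in the form in which they are used below: norm
  limits of finite sums of rank-one operators.\<close>

definition compact_op :: "'a::chilbert_space bop \<Rightarrow> bool" where
  "compact_op Y \<longleftrightarrow> (\<forall>e>0. \<exists>l. \<forall>x. norm (app (Y - (\<Sum>(a, b)\<leftarrow>l. rk a b)) x) \<le> e * norm x)"

lemma compact_op_rk: "compact_op (rk a b)"
  unfolding compact_op_def
proof (intro allI impI)
  fix e :: real assume "e > 0"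
  then show "\<exists>l. \<forall>x. norm (app (rk a b - (\<Sum>(a, b)\<leftarrow>l. rk a b)) x) \<le> e * norm x"
    by (intro exI[of _ "[(a, b)]"]) simp
qed

lemma compact_op_zero [simp]: "compact_op 0"
  using compact_op_rk[of 0 0] by (simp add: rk_def zero_bop_def)

lemma compact_op_add:
  assumes "compact_op A" "compact_op B"
  shows "compact_op (A + B)"
  unfolding compact_op_def
proof (intro allI impI)
  fix e :: real assume "e > 0"
  then obtain l l' where l: "\<And>x. norm (app (A - (\<Sum>(a, b)\<leftarrow>l. rk a b)) x) \<le> e / 2 * norm x"
      "\<And>x. norm (app (B - (\<Sum>(a, b)\<leftarrow>l'. rk a b)) x) \<le> e / 2 * norm x"
    using assms unfolding compact_op_def by (meson half_gt_zero)
  have "norm (app (A + B - (\<Sum>(a, b)\<leftarrow>l @ l'. rk a b)) x) \<le> e * norm x" for x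
  proof -
    have "A + B - (\<Sum>(a, b)\<leftarrow>l @ l'. rk a b) = (A - (\<Sum>(a, b)\<leftarrow>l. rk a b)) + (B - (\<Sum>(a, b)\<leftarrow>l'. rk a b))"
      by simp
    then show ?thesis
      using norm_triangle_le[OF add_mono[OF l(1)[of x] l(2)[of x]]] by (simp only: app_add)
  qed
  then show "\<exists>l. \<forall>x. norm (app (A + B - (\<Sum>(a, b)\<leftarrow>l. rk a b)) x) \<le> e * norm x" by blast
qed

lemma compact_op_left:
  assumes "compact_op A"
  shows "compact_op (C * A)"
  unfolding compact_op_def
proof (intro allI impI)
  fix e :: real assume "e > 0"
  obtain K where K: "K > 0" "\<And>x. norm (app C x) \<le> K * norm x" using app_bounded by blast
  obtain l where l: "\<And>x. norm (app (A - (\<Sum>(a, b)\<leftarrow>l. rk a b)) x) \<le> e / K * norm x"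
    using assms \<open>e > 0\<close> K(1) unfolding compact_op_def by (meson divide_pos_pos)
  have "(\<Sum>(a, b)\<leftarrow>map (\<lambda>(a, b). (app C a, b)) l. rk a b) = C * (\<Sum>(a, b)\<leftarrow>l. rk a b)"
    by (induction l) (auto simp: distrib_left mult_rk)
  then have "C * A - (\<Sum>(a, b)\<leftarrow>map (\<lambda>(a, b). (app C a, b)) l. rk a b) = C * (A - (\<Sum>(a, b)\<leftarrow>l. rk a b))"
    by (simp add: right_diff_distrib)
  moreover have "norm (app (C * (A - (\<Sum>(a, b)\<leftarrow>l. rk a b))) x) \<le> e * norm x" for x
    using order_trans[OF K(2) mult_left_mono[OF l[of x]]] K(1) by simp
  ultimately show "\<exists>l. \<forall>x. norm (app (C * A - (\<Sum>(a, b)\<leftarrow>l. rk a b)) x) \<le> e * norm x"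
    by (intro exI[of _ "map (\<lambda>(a, b). (app C a, b)) l"]) (simp only: simp_thms)
qed

lemma compact_op_right:
  assumes "compact_op A"
  shows "compact_op (A * C)"
  unfolding compact_op_def
proof (intro allI impI)
  fix e :: real assume "e > 0"
  obtain K where K: "K > 0" "\<And>x. norm (app C x) \<le> K * norm x" using app_bounded by blast
  obtain l where l: "\<And>x. norm (app (A - (\<Sum>(a, b)\<leftarrow>l. rk a b)) x) \<le> e / K * norm x"
    using assms \<open>e > 0\<close> K(1) unfolding compact_op_def by (meson divide_pos_pos)
  have "(\<Sum>(a, b)\<leftarrow>map (\<lambda>(a, b). (a, app (star C) b)) l. rk a b) = (\<Sum>(a, b)\<leftarrow>l. rk a b) * C"
    by (induction l) (auto simp: distrib_right mult_rk)
  then have "A * C - (\<Sum>(a, b)\<leftarrow>map (\<lambda>(a, b). (a, app (star C) b)) l. rk a b) = (A - (\<Sum>(a, b)\<leftarrow>l. rk a b)) * C"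
    by (simp add: left_diff_distrib)
  moreover have "norm (app ((A - (\<Sum>(a, b)\<leftarrow>l. rk a b)) * C) x) \<le> e * norm x" for x
  proof -
    have "norm (app (A - (\<Sum>(a, b)\<leftarrow>l. rk a b)) (app C x)) \<le> e / K * (K * norm x)"
      using K(1) \<open>e > 0\<close> by (intro order_trans[OF l] mult_left_mono K(2)) auto
    then show ?thesis using K(1) by simp
  qed
  ultimately show "\<exists>l. \<forall>x. norm (app (A * C - (\<Sum>(a, b)\<leftarrow>l. rk a b)) x) \<le> e * norm x"
    by (intro exI[of _ "map (\<lambda>(a, b). (a, app (star C) b)) l"]) (simp only: simp_thms)
qed

lemma compact_op_scaleC: "compact_op A \<Longrightarrow> compact_op (c *\<^sub>C A)"
  using compact_op_left[of A "c *\<^sub>C 1"] by simp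

lemma compact_op_diff: "compact_op A \<Longrightarrow> compact_op B \<Longrightarrow> compact_op (A - B)"
  using compact_op_add[of A "(-1) *\<^sub>C B"] compact_op_scaleC[of B "-1"] by (simp add: minus_bop_def)

text \<open>On the range of a finite-rank approximant of Y strong convergence is uniform, and the
  rest is small because the \<open>K j\<close> have a common bound.\<close>

lemma compact_op_mult_strong_limit:
  assumes Y: "compact_op Y" and bdd: "\<And>j x. norm (app (K j) x) \<le> B * norm x"
    and lim: "\<And>x. (\<lambda>j. app (K j) x) \<longlonglongrightarrow> 0" and "e > 0"
  shows "\<exists>j. \<forall>x. norm (app (K j * Y) x) \<le> e * norm x"
proof -
  define C where "C = \<bar>B\<bar> + 1"
  have "C > 0" by (simp add: C_def)
  have B: "norm (app (K j) x) \<le> C * norm x" for j x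
    unfolding C_def by (rule order_trans[OF bdd]) (intro mult_right_mono, auto)
  define d where "d = e / 2 / C"
  have "d > 0" using \<open>e > 0\<close> \<open>C > 0\<close> by (simp add: d_def)
  then obtain l where l: "\<And>x. norm (app (Y - (\<Sum>(a, b)\<leftarrow>l. rk a b)) x) \<le> d * norm x"
    using Y unfolding compact_op_def by blast
  have bnd: "norm (app (K j * (\<Sum>(a, b)\<leftarrow>l. rk a b)) x) \<le> (\<Sum>(a, b)\<leftarrow>l. norm b * norm (app (K j) a)) * norm x" for j x l
  proof (induction l)
    case (Cons p l)
    obtain a b where p: "p = (a, b)" by (cases p)
    have "norm (cinner b x *\<^sub>C app (K j) a) \<le> (norm b * norm x) * norm (app (K j) a)"
      unfolding norm_scaleC by (intro mult_right_mono cinner_cauchy_schwarz) auto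
    then have "norm (cinner b x *\<^sub>C app (K j) a + app (K j * (\<Sum>(a, b)\<leftarrow>l. rk a b)) x)
       \<le> (norm b * norm x) * norm (app (K j) a) + (\<Sum>(a, b)\<leftarrow>l. norm b * norm (app (K j) a)) * norm x"
      by (intro norm_triangle_le add_mono Cons)
    then show ?case
      by (simp add: p distrib_left app_simps algebra_simps)
  qed simp
  have lim0: "(\<lambda>j. \<Sum>(a, b)\<leftarrow>l. norm b * norm (app (K j) a)) \<longlonglongrightarrow> 0" for l
  proof (induction l)
    case (Cons p l)
    obtain a b where p: "p = (a, b)" by (cases p)
    have "(\<lambda>j. norm b * norm (app (K j) a) + (\<Sum>(a, b)\<leftarrow>l. norm b * norm (app (K j) a))) \<longlonglongrightarrow> norm b * norm (0::'a) + 0"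
      by (intro tendsto_intros lim Cons)
    then show ?case by (simp add: p)
  qed simp
  obtain j where "norm ((\<Sum>(a, b)\<leftarrow>l. norm b * norm (app (K j) a)) - 0) < e / 2"
    using LIMSEQ_D[OF lim0[of l], of "e / 2"] \<open>e > 0\<close> by auto
  then have j: "(\<Sum>(a, b)\<leftarrow>l. norm b * norm (app (K j) a)) \<le> e / 2" by simp
  have "norm (app (K j * Y) x) \<le> e * norm x" for x
  proof -
    let ?F = "\<Sum>(a, b)\<leftarrow>l. rk a b"
    have "norm (app (K j * (Y - ?F)) x) \<le> C * (d * norm x)"
      using order_trans[OF B mult_left_mono[OF l[of x]]] \<open>C > 0\<close> by simp
    also have "\<dots> = e / 2 * norm x"
      using \<open>C > 0\<close> by (simp add: d_def)
    finally have "norm (app (K j * (Y - ?F)) x + app (K j * ?F) x) \<le> e / 2 * norm x + e / 2 * norm x"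
      by (intro norm_triangle_le add_mono order_trans[OF bnd] mult_right_mono j) auto
    then show ?thesis
      by (simp add: app_simps)
  qed
  then show ?thesis by blast
qed

text \<open>Gram-Schmidt: a new vector a adds the rank-one projection onto its residue d = a - P a,
  unless d = 0.\<close>

lemma finite_rank_projection:
  fixes A :: "'a::chilbert_space set"
  assumes "finite A"
  shows "\<exists>P. compact_op P \<and> (\<forall>a\<in>A. app P a = a) \<and> (\<forall>x. app P x \<in> cspan A) \<and>
    (\<forall>a\<in>A. \<forall>x. cinner a (x - app P x) = 0) \<and> (\<forall>x. norm (x - app P x) \<le> norm x)"
  using assms
proof (induction A rule: finite_induct)
  case empty
  show ?case by (intro exI[of _ 0]) (auto intro: cspan_zero)
next
  case (insert a A)
  then obtain P where P: "compact_op P" "\<And>a. a \<in> A \<Longrightarrow> app P a = a" "\<And>x. app P x \<in> cspan A"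
     "\<And>a x. a \<in> A \<Longrightarrow> cinner a (x - app P x) = 0" "\<And>x. norm (x - app P x) \<le> norm x" by blast
  have mono: "cspan A \<subseteq> cspan (insert a A)"
    by (rule cspan_minimal[OF csubspace_cspan]) (auto intro: cspan_base)
  define d where "d = a - app P a"
  have d_in: "d \<in> cspan (insert a A)"
    unfolding d_def using mono P(3) by (intro csubspaceD(5)[OF csubspace_cspan]) (auto intro: cspan_base)
  have d_orth: "cinner v d = 0" "cinner d v = 0" if "v \<in> cspan A" for v
  proof -
    have v: "v \<in> closure (cspan A)" using that closure_subset by blast
    have "cinner d s = 0" if "s \<in> A" for s
      using P(4)[OF that, of a] unfolding d_def by (metis cinner_commute complex_cnj_zero)
    then show "cinner d v = 0" "cinner v d = 0"
      using orthogonal_closure_cspan[OF _ v] by blast+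
  qed
  show ?case
  proof (cases "d = 0")
    case True
    then have "app P a = a" by (simp add: d_def)
    moreover have "cinner a (x - app P x) = 0" for x
    proof (rule orthogonal_closure_cspan(2)[of A])
      show "a \<in> closure (cspan A)"
        using P(3)[of a] \<open>app P a = a\<close> closure_subset by force
      show "cinner (x - app P x) s = 0" if "s \<in> A" for s
        using P(4)[OF that, of x] by (metis cinner_commute complex_cnj_zero)
    qed
    ultimately show ?thesis
      using P mono by (intro exI[of _ P]) auto
  next
    case False
    define Q where "Q = P + rk ((1 / cinner d d) *\<^sub>C d) d"
    have Q: "app Q x = app P x + (cinner d x / cinner d d) *\<^sub>C d" for x
      by (simp add: Q_def app_simps scaleC_scaleC)
    have Pd: "cinner d x = cinner d (x - app P x)" for x
      using d_orth P(3) by (simp add: cinner_simps)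
    have resid: "cinner d (x - app Q x) = 0" for x
      using False Pd[of x] by (simp add: Q cinner_simps)
    show ?thesis
    proof (intro exI[of _ Q] conjI ballI allI)
      show "compact_op Q" unfolding Q_def by (intro compact_op_add P compact_op_rk)
      have da: "cinner d a = cinner d d"
        using Pd[of a] by (simp add: d_def)
      show "app Q y = y" if "y \<in> insert a A" for y
      proof (cases "y = a")
        case True
        then show ?thesis using False by (simp add: Q da) (simp add: d_def)
      next
        case False
        then have "y \<in> A" using that by simp
        then have "cinner d y = 0" using d_orth(2) cspan_base by blast
        then show ?thesis using P(2)[OF \<open>y \<in> A\<close>] by (simp add: Q)
      qed
      show "app Q x \<in> cspan (insert a A)" for x
        unfolding Q using P(3) mono d_in by (intro cspan_add cspan_scale) auto
      have A0: "cinner y (x - app Q x) = 0" if "y \<in> A" for x y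
        using P(4)[OF that, of x] d_orth(1)[OF cspan_base[OF that]] by (simp add: Q cinner_simps)
      show "cinner y (x - app Q x) = 0" if "y \<in> insert a A" for x y
      proof (cases "y = a")
        case True
        have "cinner (app P a) (x - app Q x) = 0"
        proof (rule orthogonal_closure_cspan(2)[of A])
          show "app P a \<in> closure (cspan A)"
            using P(3)[of a] closure_subset by blast
          show "cinner (x - app Q x) s = 0" if "s \<in> A" for s
            using A0[OF that, of x] by (metis cinner_commute complex_cnj_zero)
        qed
        then show ?thesis
          using resid[of x] True by (simp add: d_def cinner_diff_left)
      qed (use that A0 in auto)
      show "norm (x - app Q x) \<le> norm x" for x
      proof -
        let ?c = "(cinner d x / cinner d d) *\<^sub>C d"
        have "cinner ?c (x - app Q x) = 0" by (simp add: cinner_scaleC_left resid)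
        then have "(norm (?c + (x - app Q x)))\<^sup>2 = (norm ?c)\<^sup>2 + (norm (x - app Q x))\<^sup>2"
          by (rule norm_add_orthogonal)
        moreover have "?c + (x - app Q x) = x - app P x" by (simp add: Q)
        ultimately have "(norm (x - app Q x))\<^sup>2 \<le> (norm (x - app P x))\<^sup>2" by simp
        then show ?thesis
          using P(5)[of x] by (meson norm_ge_zero order_trans power2_le_imp_le)
      qed
    qed
  qed
qed

section \<open>Normally ordered monomials\<close>

lemma cspan_image_subset:
  assumes "x \<in> cspan S" "csubspace V" "\<And>s. s \<in> S \<Longrightarrow> f s \<in> V"
    and "\<And>x y. f (x + y) = f x + f y" "\<And>c x. f (c *\<^sub>C x) = c *\<^sub>C f x"
  shows "f x \<in> V"
  using assms(1)
proof induction
  case cspan_zero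
  have "f 0 = 0" using assms(5)[of 0 0] by simp
  then show ?case using csubspaceD(1)[OF assms(2)] by simp
qed (auto simp: assms csubspaceD)

lemma cspan_mult_left:
  fixes c :: "'a::chilbert_space bop"
  assumes "x \<in> cspan S" "csubspace V" "\<And>s. s \<in> S \<Longrightarrow> c * s \<in> V"
  shows "c * x \<in> V"
  by (rule cspan_image_subset[OF assms]) (simp_all add: distrib_left)

lemma cspan_mult_right:
  fixes c :: "'a::chilbert_space bop"
  assumes "x \<in> cspan S" "csubspace V" "\<And>s. s \<in> S \<Longrightarrow> s * c \<in> V"
  shows "x * c \<in> V"
  by (rule cspan_image_subset[OF assms]) (simp_all add: distrib_right)

locale q_weyl =
  fixes q :: real and r d :: "'i \<Rightarrow> 'f::chilbert_space bop" and \<kappa> :: "'i \<Rightarrow> 'i \<Rightarrow> complex"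
  assumes dr: "d i * r j = of_real q *\<^sub>C (r j * d i) + \<kappa> i j *\<^sub>C 1"
begin

definition R where "R us = prod_list (map r us)"
definition D where "D ws = prod_list (map d ws)"

lemma R_simps [simp]: "R [] = 1" "R (i # us) = r i * R us" "R (us @ vs) = R us * R vs"
  by (simp_all add: R_def)

lemma D_simps [simp]: "D [] = 1" "D (i # us) = d i * D us" "D (us @ vs) = D us * D vs"
  by (simp_all add: D_def)

text \<open>Passing a whole creation word costs q to its length; a contraction removes the
  annihilator together with one creator, so the remainder is made of shorter creation words.\<close>

lemma d_R: "d i * R us - of_real (q ^ length us) *\<^sub>C (R us * d i) \<in> cspan (R ` {us'. length us' < length us})"
proof (induction us)
  case Nil
  show ?case by (simp add: cspan_zero)
next
  case (Cons j us)
  define X where "X = d i * R us - of_real (q ^ length us) *\<^sub>C (R us * d i)"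
  let ?V = "cspan (R ` {us'. length us' < length (j # us)})"
  have "r j * X \<in> ?V"
  proof (rule cspan_mult_left[OF _ csubspace_cspan])
    show "X \<in> cspan (R ` {us'. length us' < length us})" using Cons by (simp add: X_def)
    fix s assume "s \<in> R ` {us'. length us' < length us}"
    then obtain us' where us': "s = R us'" "length us' < length us" by auto
    show "r j * s \<in> ?V"
      by (rule cspan_base, rule image_eqI[of _ _ "j # us'"]) (use us' in auto)
  qed
  moreover have "R us \<in> ?V" by (rule cspan_base) auto
  moreover have "d i * R (j # us) - of_real (q ^ length (j # us)) *\<^sub>C (R (j # us) * d i) =
      of_real q *\<^sub>C (r j * X) + \<kappa> i j *\<^sub>C R us"
  proof -
    have "d i * R (j # us) = of_real q *\<^sub>C (r j * (d i * R us)) + \<kappa> i j *\<^sub>C R us"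
      by (simp add: mult.assoc[symmetric] dr distrib_right)
    also have "d i * R us = X + of_real (q ^ length us) *\<^sub>C (R us * d i)"
      by (simp add: X_def)
    finally show ?thesis
      by (simp add: distrib_left scaleC_add_right scaleC_scaleC mult.assoc)
  qed
  ultimately show ?case
    by (auto intro!: cspan_add cspan_scale)
qed

lemma D_r: "D ws * r i - of_real (q ^ length ws) *\<^sub>C (r i * D ws) \<in> cspan (D ` {ws'. length ws' < length ws})"
proof (induction ws)
  case Nil
  show ?case by (simp add: cspan_zero)
next
  case (Cons j ws)
  define X where "X = D ws * r i - of_real (q ^ length ws) *\<^sub>C (r i * D ws)"
  let ?V = "cspan (D ` {us'. length us' < length (j # ws)})"
  have "d j * X \<in> ?V"
  proof (rule cspan_mult_left[OF _ csubspace_cspan])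
    show "X \<in> cspan (D ` {us'. length us' < length ws})" using Cons by (simp add: X_def)
    fix s assume "s \<in> D ` {us'. length us' < length ws}"
    then obtain us' where us': "s = D us'" "length us' < length ws" by auto
    show "d j * s \<in> ?V"
      by (rule cspan_base, rule image_eqI[of _ _ "j # us'"]) (use us' in auto)
  qed
  moreover have "D ws \<in> ?V" by (rule cspan_base) auto
  moreover have "D (j # ws) * r i - of_real (q ^ length (j # ws)) *\<^sub>C (r i * D (j # ws)) =
      d j * X + (of_real (q ^ length ws) * \<kappa> j i) *\<^sub>C D ws"
  proof -
    have "D (j # ws) * r i = d j * (D ws * r i)" by (simp add: mult.assoc)
    also have "D ws * r i = X + of_real (q ^ length ws) *\<^sub>C (r i * D ws)"
      by (simp add: X_def)
    also have "d j * (X + of_real (q ^ length ws) *\<^sub>C (r i * D ws)) =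
       d j * X + of_real (q ^ length ws) *\<^sub>C ((d j * r i) * D ws)"
      by (simp add: distrib_left mult.assoc)
    finally show ?thesis
      by (simp add: dr distrib_right scaleC_add_right scaleC_scaleC mult.assoc mult.commute)
  qed
  ultimately show ?case
    by (auto intro!: cspan_add cspan_scale)
qed

text \<open>Multiplying a monomial by \<open>r i + d i\<close> on the left moves its first creation letter to the
  annihilators, and multiplying by \<open>q r i + q\<inverse> d i\<close> on the right does the same with the last one,
  up to shorter monomials. Turning all letters into annihilators in these two ways gives the same
  monomial with different coefficients, so it lies in the subspace.\<close>

lemma monomials_in_subspace:
  assumes q: "\<bar>q\<bar> < 1" "q \<noteq> 0" and J: "csubspace J" and one: "1 \<in> J"
    and left: "\<And>Z i. Z \<in> J \<Longrightarrow> (r i + d i) * Z \<in> J"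
    and right: "\<And>Z i. Z \<in> J \<Longrightarrow> Z * (of_real q *\<^sub>C r i + of_real (1 / q) *\<^sub>C d i) \<in> J"
  shows "R us * D ws \<in> J"
proof -
  have "\<forall>us ws. length us + length ws \<le> n \<longrightarrow> R us * D ws \<in> J" for n
  proof (induction n)
    case 0
    then show ?case using one by auto
  next
    case (Suc n)
    then have IH: "R us * D ws \<in> J" if "length us + length ws \<le> n" for us ws
      using that by blast
    have A: "R (i # us) * D ws + of_real (q ^ length us) *\<^sub>C (R us * D (i # ws)) \<in> J"
      if len: "length us + length ws = n" for i us ws
    proof -
      define X where "X = d i * R us - of_real (q ^ length us) *\<^sub>C (R us * d i)"
      have "X * D ws \<in> J"
        by (rule cspan_mult_right[OF d_R[of i us, folded X_def] J]) (use len in \<open>auto intro: IH\<close>)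
      moreover have "(r i + d i) * (R us * D ws) \<in> J"
        by (intro left IH) (use len in simp)
      moreover have "(r i + d i) * (R us * D ws) =
          R (i # us) * D ws + (X + of_real (q ^ length us) *\<^sub>C (R us * d i)) * D ws"
        by (simp add: X_def distrib_right mult.assoc)
      ultimately have "(R (i # us) * D ws + (X + of_real (q ^ length us) *\<^sub>C (R us * d i)) * D ws) - X * D ws \<in> J"
        by (metis csubspaceD(5)[OF J])
      then show ?thesis by (simp add: distrib_right mult.assoc)
    qed
    \<comment> \<open>The exponent has one factor q from the right multiplier and one for each
      annihilator passed by \<open>r i\<close>.\<close>
    have B: "of_real (q ^ Suc (length ws)) *\<^sub>C (R (us @ [i]) * D ws) + of_real (1 / q) *\<^sub>C (R us * D (ws @ [i])) \<in> J"
      if len: "length us + length ws = n" for i us ws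
    proof -
      define X where "X = D ws * r i - of_real (q ^ length ws) *\<^sub>C (r i * D ws)"
      have X: "R us * X \<in> J"
        by (rule cspan_mult_left[OF D_r[of ws i, folded X_def] J]) (use len in \<open>auto intro: IH\<close>)
      have "(R us * D ws) * (of_real q *\<^sub>C r i + of_real (1 / q) *\<^sub>C d i) \<in> J"
        by (intro right IH) (use len in simp)
      moreover have "(R us * D ws) * (of_real q *\<^sub>C r i + of_real (1 / q) *\<^sub>C d i) =
          of_real q *\<^sub>C (R us * (X + of_real (q ^ length ws) *\<^sub>C (r i * D ws))) + of_real (1 / q) *\<^sub>C (R us * D (ws @ [i]))"
        by (simp add: X_def distrib_left mult.assoc)
      ultimately have "(of_real q *\<^sub>C (R us * (X + of_real (q ^ length ws) *\<^sub>C (r i * D ws))) +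
          of_real (1 / q) *\<^sub>C (R us * D (ws @ [i]))) - of_real q *\<^sub>C (R us * X) \<in> J"
        using X by (metis csubspaceD(3,5)[OF J])
      then show ?thesis
        by (simp add: distrib_left mult.assoc scaleC_add_right scaleC_scaleC)
    qed
    have A': "\<exists>c::real. \<bar>c\<bar> \<le> 1 \<and> R us * D ws - of_real c *\<^sub>C D (rev us @ ws) \<in> J"
      if "length us + length ws = Suc n" for us ws
      using that
    proof (induction us arbitrary: ws)
      case Nil
      show ?case by (rule exI[of _ 1]) (simp add: csubspaceD(1)[OF J])
    next
      case (Cons i us)
      then obtain c :: real where c: "\<bar>c\<bar> \<le> 1" "R us * D (i # ws) - of_real c *\<^sub>C D (rev us @ i # ws) \<in> J"
        using Cons.IH[of "i # ws"] by auto
      have "(R (i # us) * D ws + of_real (q ^ length us) *\<^sub>C (R us * D (i # ws)))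
          - of_real (q ^ length us) *\<^sub>C (R us * D (i # ws) - of_real c *\<^sub>C D (rev us @ i # ws)) \<in> J"
        using Cons.prems by (intro csubspaceD(3,5)[OF J] A c) auto
      then have "R (i # us) * D ws - of_real (- (q ^ length us * c)) *\<^sub>C D (rev (i # us) @ ws) \<in> J"
        by (simp add: scaleC_diff_right scaleC_scaleC scaleC_minus_left)
      moreover have "\<bar>- (q ^ length us * c)\<bar> \<le> 1"
        using q c(1) by (simp add: abs_mult power_abs mult_le_one power_le_one)
      ultimately show ?case by blast
    qed
    \<comment> \<open>Whereas the coefficients in \<open>A'\<close> are products of powers of q,
      here each step divides by such powers, so the modulus exceeds 1 once a letter has moved. The
      exact value 1 at the empty word keeps the induction going. Thus the two coefficients of the
      same \<open>D ws\<close> differ.\<close>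
    have B': "\<exists>c::real. (if us = [] then c = 1 else \<bar>c\<bar> > 1) \<and> R us * D ws - of_real c *\<^sub>C D (ws @ rev us) \<in> J"
      if "length us + length ws = Suc n" for us ws
      using that
    proof (induction us arbitrary: ws rule: rev_induct)
      case Nil
      show ?case by (rule exI[of _ 1]) (simp add: csubspaceD(1)[OF J])
    next
      case (snoc i us)
      then have "length us + length (ws @ [i]) = Suc n" by simp
      from snoc.IH[OF this] obtain c :: real where c0: "if us = [] then c = 1 else \<bar>c\<bar> > 1"
        and c2: "R us * D (ws @ [i]) - of_real c *\<^sub>C D ((ws @ [i]) @ rev us) \<in> J"
        by blast
      have c: "\<bar>c\<bar> \<ge> 1" "R us * D (ws @ [i]) - of_real c *\<^sub>C D ((ws @ [i]) @ rev us) \<in> J"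
        using c0 c2 by (auto split: if_splits)
      define p where "p = q ^ Suc (length ws)"
      have p: "p \<noteq> 0" "\<bar>p\<bar> \<le> 1"
        using q by (auto simp: p_def power_abs power_le_one simp del: power_Suc)
      have "of_real (1 / p) *\<^sub>C ((of_real p *\<^sub>C (R (us @ [i]) * D ws) + of_real (1 / q) *\<^sub>C (R us * D (ws @ [i])))
          - of_real (1 / q) *\<^sub>C (R us * D (ws @ [i]) - of_real c *\<^sub>C D ((ws @ [i]) @ rev us))) \<in> J"
        unfolding p_def using snoc.prems by (intro csubspaceD(3,5)[OF J] B c) auto
      then have "R (us @ [i]) * D ws - of_real (- (1 / p * (1 / q) * c)) *\<^sub>C D (ws @ rev (us @ [i])) \<in> J"
        using p by (simp add: scaleC_diff_right scaleC_add_right scaleC_scaleC scaleC_minus_left)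
      moreover have "\<bar>- (1 / p * (1 / q) * c)\<bar> > 1"
      proof -
        have "\<bar>p\<bar> * \<bar>q\<bar> < 1"
          by (rule le_less_trans[OF mult_right_mono[OF p(2) abs_ge_zero]]) (simp add: q)
        then have "\<bar>p\<bar> * \<bar>q\<bar> < \<bar>c\<bar>" using c by linarith
        moreover have "\<bar>p\<bar> * \<bar>q\<bar> > 0" using p q by simp
        ultimately show ?thesis
          by (simp add: abs_mult field_simps)
      qed
      ultimately show ?case by (intro exI[of _ "- (1 / p * (1 / q) * c)"]) simp
    qed
    have D: "D ws \<in> J" if len: "length ws = Suc n" for ws
    proof -
      obtain c :: real where c: "\<bar>c\<bar> \<le> 1" "R (rev ws) - of_real c *\<^sub>C D ws \<in> J"
        using A'[of "rev ws" "[]"] len by auto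
      obtain c' :: real where c': "\<bar>c'\<bar> > 1" "R (rev ws) - of_real c' *\<^sub>C D ws \<in> J"
        using B'[of "rev ws" "[]"] len by (auto split: if_splits)
      have "c' - c \<noteq> 0" using c c' by auto
      have "of_real (1 / (c' - c)) *\<^sub>C ((R (rev ws) - of_real c *\<^sub>C D ws) - (R (rev ws) - of_real c' *\<^sub>C D ws)) \<in> J"
        by (intro csubspaceD(3,5)[OF J] c c')
      moreover have "(R (rev ws) - of_real c *\<^sub>C D ws) - (R (rev ws) - of_real c' *\<^sub>C D ws) = of_real (c' - c) *\<^sub>C D ws"
        by (simp add: scaleC_diff_left)
      ultimately show ?thesis
        using \<open>c' - c \<noteq> 0\<close> by (simp add: scaleC_scaleC flip: of_real_diff of_real_mult)
    qed
    show ?case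
    proof (intro allI impI)
      fix us ws :: "'i list" assume len: "length us + length ws \<le> Suc n"
      show "R us * D ws \<in> J"
      proof (cases "length us + length ws = Suc n")
        case True
        then obtain c :: real where "R us * D ws - of_real c *\<^sub>C D (rev us @ ws) \<in> J"
          using A' by blast
        moreover have "D (rev us @ ws) \<in> J" using True by (intro D) simp
        ultimately have "(R us * D ws - of_real c *\<^sub>C D (rev us @ ws)) + of_real c *\<^sub>C D (rev us @ ws) \<in> J"
          by (intro csubspaceD(2,3)[OF J])
        then show ?thesis by simp
      qed (use len in \<open>auto intro: IH\<close>)
    qed
  qed
  then show ?thesis by blast
qed

lemma r_mult_span: "Z \<in> cspan (range (\<lambda>(us, ws). R us * D ws)) \<Longrightarrow> r i * Z \<in> cspan (range (\<lambda>(us, ws). R us * D ws))"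
proof (erule cspan_mult_left[OF _ csubspace_cspan])
  fix s assume "s \<in> range (\<lambda>(us, ws). R us * D ws)"
  then obtain us ws where "s = R us * D ws" by auto
  then show "r i * s \<in> cspan (range (\<lambda>(us, ws). R us * D ws))"
    by (intro cspan_base image_eqI[of _ _ "(i # us, ws)"]) (auto simp: mult.assoc)
qed

lemma d_mult_span: "Z \<in> cspan (range (\<lambda>(us, ws). R us * D ws)) \<Longrightarrow> d i * Z \<in> cspan (range (\<lambda>(us, ws). R us * D ws))"
proof (erule cspan_mult_left[OF _ csubspace_cspan])
  let ?V = "cspan (range (\<lambda>(us, ws). R us * D ws))"
  fix s assume "s \<in> range (\<lambda>(us, ws). R us * D ws)"
  then obtain us ws where s: "s = R us * D ws" by auto
  define X where "X = d i * R us - of_real (q ^ length us) *\<^sub>C (R us * d i)"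
  have "X * D ws \<in> ?V"
    by (rule cspan_mult_right[OF d_R[of i us, folded X_def] csubspace_cspan]) (auto intro!: cspan_base)
  moreover have "R us * D (i # ws) \<in> ?V"
    by (intro cspan_base image_eqI[of _ _ "(us, i # ws)"]) auto
  moreover have "d i * s = X * D ws + of_real (q ^ length us) *\<^sub>C (R us * D (i # ws))"
    by (simp add: X_def s left_diff_distrib mult.assoc)
  ultimately show "d i * s \<in> ?V"
    by (simp only: cspan_add cspan_scale)
qed

end

text \<open>The norms of K^n x decrease, and by self-adjointness the inner product of K^m x and K^n
  x depends on m + n only. Distances between even powers are therefore combinations of values of one
  convergent sequence. The square is taken because an eigenvalue -1 of K would make its powers
  oscillate.\<close>

lemma contraction_powers_converge:
  fixes K :: "'a::chilbert_space bop"
  assumes sa: "star K = K" and le: "\<And>x. norm (app K x) \<le> norm x"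
  shows "\<exists>y. (\<lambda>n. app ((K * K) ^ n) x) \<longlonglongrightarrow> y \<and> app (K * K) y = y"
proof -
  let ?L = "K * K"
  have Kc: "cinner (app K a) b = cinner a (app K b)" for a b
    by (metis cinner_star_left sa)
  have comm: "K ^ n * K = K * K ^ n" for n by (rule power_commutes)
  have starK: "star (K ^ n) = K ^ n" for n
    by (induction n) (simp_all add: star_mult sa power_commutes)
  define s where "s n = (norm (app (K ^ n) x))\<^sup>2" for n
  have inner: "inner (app (K ^ a) x) (app (K ^ b) x) = s c" if "a + b = 2 * c" for a b c
  proof -
    have "cinner (app (K ^ a) x) (app (K ^ b) x) = cinner x (app (K ^ a * K ^ b) x)"
      using cinner_star_left[of "K ^ a"] starK by simp
    also have "\<dots> = cinner x (app (K ^ c * K ^ c) x)"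
      using that by (simp add: power_add[symmetric] mult_2)
    also have "\<dots> = cinner (app (K ^ c) x) (app (K ^ c) x)"
      using cinner_star_left[of "K ^ c"] starK by simp
    finally show ?thesis
      by (simp add: inner_eq_Re_cinner s_def power2_norm_eq_inner)
  qed
  have "decseq s"
    unfolding decseq_Suc_iff s_def by (auto intro!: power_mono le)
  then have "convergent s"
    using decseq_convergent[of s 0] by (metis convergentI s_def zero_le_power2)
  then have "Cauchy s" by (rule convergent_Cauchy)
  have diff: "(norm (app (?L ^ m) x - app (?L ^ n) x))\<^sup>2 = s (2 * m) + s (2 * n) - 2 * s (m + n)" for m n
  proof -
    have L: "?L ^ j = K ^ (2 * j)" for j
      by (simp add: power_mult power2_eq_square)
    show ?thesis
      unfolding L power2_norm_eq_inner inner_diff_left inner_diff_right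
      by (simp add: inner[of "2*m" "2*m" "2*m"] inner[of "2*n" "2*n" "2*n"] inner[of "2*m" "2*n" "m+n"]
          inner[of "2*n" "2*m" "m+n"])
  qed
  have "Cauchy (\<lambda>n. app (?L ^ n) x)"
  proof (rule metric_CauchyI)
    fix e :: real assume "e > 0"
    then obtain N where N: "\<And>m n. m \<ge> N \<Longrightarrow> n \<ge> N \<Longrightarrow> \<bar>s m - s n\<bar> < e\<^sup>2 / 2"
      using metric_CauchyD[OF \<open>Cauchy s\<close>, of "e\<^sup>2 / 2"] by (auto simp: dist_real_def)
    have "dist (app (?L ^ m) x) (app (?L ^ n) x) < e" if "m \<ge> N" "n \<ge> N" for m n
    proof -
      have "\<bar>s (2 * m) - s (m + n)\<bar> < e\<^sup>2 / 2" "\<bar>s (2 * n) - s (m + n)\<bar> < e\<^sup>2 / 2"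
        by (rule N; use that in simp)+
      then have "(norm (app (?L ^ m) x - app (?L ^ n) x))\<^sup>2 < e\<^sup>2"
        unfolding diff by argo
      then show ?thesis
        using \<open>e > 0\<close> by (simp add: dist_norm power_less_imp_less_base)
    qed
    then show "\<exists>M. \<forall>m\<ge>M. \<forall>n\<ge>M. dist (app (?L ^ m) x) (app (?L ^ n) x) < e" by blast
  qed
  then obtain y where y: "(\<lambda>n. app (?L ^ n) x) \<longlonglongrightarrow> y"
    using Cauchy_convergent convergent_def by blast
  have "(\<lambda>n. app ?L (app (?L ^ n) x)) \<longlonglongrightarrow> app ?L y"
    by (intro tendsto_intros y)
  moreover have "app ?L (app (?L ^ n) x) = app (?L ^ Suc n) x" for n
    by (simp only: power_Suc app_mult)
  ultimately have "(\<lambda>n. app (?L ^ Suc n) x) \<longlonglongrightarrow> app ?L y" by simp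
  then have "app ?L y = y"
    by (rule LIMSEQ_unique[OF _ LIMSEQ_Suc[OF y]])
  with y show ?thesis by blast
qed

inductive_set walg :: "'a::monoid_mult set \<Rightarrow> 'a set" for G where
  walg_one: "1 \<in> walg G"
| walg_step: "x \<in> G \<Longrightarrow> y \<in> walg G \<Longrightarrow> x * y \<in> walg G"

lemma walg_mult: "x \<in> walg G \<Longrightarrow> y \<in> walg G \<Longrightarrow> x * y \<in> walg G"
  by (induction rule: walg.induct) (auto simp: mult.assoc intro: walg.intros)

lemma walg_base: "x \<in> G \<Longrightarrow> x \<in> walg G"
  using walg_step[OF _ walg_one] by fastforce

lemma walg_commute:
  assumes "y \<in> walg G" "\<And>x. x \<in> G \<Longrightarrow> c * x = x * c"
  shows "c * y = y * c"
  using assms(1)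
proof induction
  case (walg_step x y)
  have "c * (x * y) = x * (c * y)"
    using assms(2)[OF walg_step(1)] by (metis mult.assoc)
  then show ?case by (simp add: walg_step mult.assoc)
qed simp

lemma walg_star:
  assumes "y \<in> walg G" "\<And>x. x \<in> G \<Longrightarrow> star x \<in> G"
  shows "star y \<in> walg G"
  using assms(1)
proof induction
  case (walg_step x y)
  show ?case
    unfolding star_mult by (rule walg_mult[OF walg_step(3) walg_base[OF assms(2)[OF walg_step(1)]]])
qed (simp add: walg_one)

lemma mult_commute_mult:
  fixes x y z :: "'a::semigroup_mult"
  assumes "z * x = x * z" "z * y = y * z"
  shows "z * (x * y) = (x * y) * z"
  by (metis assms mult.assoc)

lemma compact_op_approx:
  assumes "\<And>e. e > 0 \<Longrightarrow> \<exists>Y'. compact_op Y' \<and> (\<forall>x. norm (app (Y - Y') x) \<le> e * norm x)"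
  shows "compact_op Y"
  unfolding compact_op_def
proof (intro allI impI)
  fix e :: real assume "e > 0"
  then obtain Y' where Y': "compact_op Y'" "\<And>x. norm (app (Y - Y') x) \<le> e / 2 * norm x"
    using assms by (meson half_gt_zero)
  then obtain l where l: "\<And>x. norm (app (Y' - (\<Sum>(a, b)\<leftarrow>l. rk a b)) x) \<le> e / 2 * norm x"
    using \<open>e > 0\<close> unfolding compact_op_def by (meson half_gt_zero)
  have "norm (app (Y - (\<Sum>(a, b)\<leftarrow>l. rk a b)) x) \<le> e * norm x" for x
  proof -
    have "app (Y - (\<Sum>(a, b)\<leftarrow>l. rk a b)) x = app (Y - Y') x + app (Y' - (\<Sum>(a, b)\<leftarrow>l. rk a b)) x"
      by (simp add: app_diff)
    then show ?thesis
      using norm_triangle_le[OF add_mono[OF Y'(2)[of x] l[of x]]] by simp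
  qed
  then show "\<exists>l. \<forall>x. norm (app (Y - (\<Sum>(a, b)\<leftarrow>l. rk a b)) x) \<le> e * norm x" by blast
qed

context q_fock
begin

lemma abs_q_less: "\<bar>q\<bar> < 1"
  using q_bounds by linarith

section \<open>Left and right generators\<close>

text \<open>If y is the image of x under the antilinear operator x1 + i x2 -> x1 - i x2 of the
  one-particle space, this is a complex combination of two q-Gaussians. The right analogue
  \<open>rgen\<close> uses the adjoint of that operator and yields elements of the
  commutant.\<close>

definition lgen :: "'h \<Rightarrow> 'h \<Rightarrow> 'f bop" where "lgen x y = cr x + an y"
definition rgen :: "'h \<Rightarrow> 'h \<Rightarrow> 'f bop" where "rgen x y = rc x + ra y"

lemma star_lgen: "star (lgen x y) = lgen y x"
  by (simp add: lgen_def star_add add.commute)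

lemma star_rgen: "star (rgen x y) = rgen y x"
  by (simp add: rgen_def star_add add.commute)

text \<open>The mixed commutators are <y, u> q^N and -<v, x> q^N; all others vanish.\<close>

lemma lgen_rgen_commute:
  assumes "cinner y u = cinner v x"
  shows "lgen x y * rgen u v = rgen u v * lgen x y"
  by (simp add: lgen_def rgen_def distrib_left distrib_right cr_rc an_rc ra_cr an_ra assms algebra_simps)

lemma ra_lgen: "ra x * lgen y z = lgen y z * ra x + cinner x y *\<^sub>C dil q"
  by (simp add: lgen_def distrib_left distrib_right ra_cr an_ra[symmetric])

lemma anw_in_lists:
  assumes "xs \<in> lists L"
  shows "anw y xs \<in> cspan (w ` {zs. zs \<in> lists L \<and> length zs < length xs})"
  unfolding anw_def
proof (intro csubspace_sum[OF csubspace_cspan] cspan_scale cspan_base imageI)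
  fix k assume "k \<in> {..<length xs}"
  then show "del k xs \<in> {zs. zs \<in> lists L \<and> length zs < length xs}"
    using assms by (auto simp: length_del in_lists_conv_set) (auto simp: del_def dest: in_set_takeD in_set_dropD)
qed

lemma ra_in_lists:
  assumes "xs \<in> lists L"
  shows "app (ra y) (w xs) \<in> cspan (w ` {zs. zs \<in> lists L \<and> length zs < length xs})"
proof -
  let ?W = "{zs. zs \<in> lists L \<and> length zs < length xs}"
  have "anw y (rev xs) \<in> cspan (w ` ?W)"
    using anw_in_lists[of "rev xs" L y] assms by (simp add: in_lists_conv_set)
  then have "app flip (anw y (rev xs)) \<in> cspan (w ` ?W)"
    by (rule cspan_image_subset[OF _ csubspace_cspan])
      (auto simp: flip_w app_simps intro!: cspan_base imageI)
  then show ?thesis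
    by (simp add: ra_eq flip_w an_w)
qed

text \<open>The left generator prepends x to a word and adds a combination of shorter words over L,
  which are known to lie in V. Any partner y will do.\<close>

lemma words_in_left:
  assumes V: "csubspace V" "\<Omega> \<in> V" and step: "\<And>x. x \<in> L \<Longrightarrow> \<exists>y. \<forall>v\<in>V. app (lgen x y) v \<in> V"
  shows "xs \<in> lists L \<Longrightarrow> w xs \<in> V"
proof (induction "length xs" arbitrary: xs rule: less_induct)
  case less
  show ?case
  proof (cases xs)
    case Nil
    then show ?thesis by (simp add: V)
  next
    case (Cons x ys)
    then have x: "x \<in> L" "ys \<in> lists L" using less.prems by auto
    then obtain y where y: "\<And>v. v \<in> V \<Longrightarrow> app (lgen x y) v \<in> V" using step by blast
    have "w zs \<in> V" if "zs \<in> lists L" "length zs < length ys" for zs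
      by (rule less.hyps) (use that in \<open>auto simp: Cons\<close>)
    then have "w ` {zs. zs \<in> lists L \<and> length zs < length ys} \<subseteq> V"
      by blast
    then have "anw y ys \<in> V"
      using anw_in_lists[OF x(2), of y] cspan_minimal[OF V(1)] by blast
    moreover have "w ys \<in> V" using less.hyps[of ys] x by (simp add: Cons)
    ultimately have "app (lgen x y) (w ys) - anw y ys \<in> V"
      by (intro csubspaceD(5)[OF V(1)] y)
    then show ?thesis by (simp add: lgen_def app_simps cr_w an_w Cons)
  qed
qed

lemma words_in_right:
  assumes V: "csubspace V" "\<Omega> \<in> V" and step: "\<And>x. x \<in> L \<Longrightarrow> \<exists>y. \<forall>v\<in>V. app (rgen x y) v \<in> V"
  shows "xs \<in> lists L \<Longrightarrow> w xs \<in> V"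
proof (induction "length xs" arbitrary: xs rule: less_induct)
  case less
  show ?case
  proof (cases xs rule: rev_cases)
    case Nil
    then show ?thesis by (simp add: V)
  next
    case (snoc ys x)
    then have x: "x \<in> L" "ys \<in> lists L" using less.prems by auto
    then obtain y where y: "\<And>v. v \<in> V \<Longrightarrow> app (rgen x y) v \<in> V" using step by blast
    have "w zs \<in> V" if "zs \<in> lists L" "length zs < length ys" for zs
      by (rule less.hyps) (use that in \<open>auto simp: snoc\<close>)
    then have "w ` {zs. zs \<in> lists L \<and> length zs < length ys} \<subseteq> V"
      by blast
    then have "app (ra y) (w ys) \<in> V"
      using ra_in_lists[OF x(2), of y] cspan_minimal[OF V(1)] by blast
    moreover have "w ys \<in> V" using less.hyps[of ys] x by (simp add: snoc)
    ultimately have "app (rgen x y) (w ys) - app (ra y) (w ys) \<in> V"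
      by (intro csubspaceD(5)[OF V(1)] y)
    then show ?thesis by (simp add: rgen_def app_simps rc_w snoc)
  qed
qed

lemma cr_zero [simp]: "cr 0 = 0"
  using cr_scaleC[of 0 0] by simp

lemma ra_scaleC: "ra (c *\<^sub>C x) = cnj c *\<^sub>C ra x"
  by (simp add: rc_scaleC star_scaleC)

lemma lgen_Nil: "app (lgen x y) \<Omega> = w [x]"
  by (simp add: lgen_def app_simps cr_w)

lemma rgen_Nil: "app (rgen x y) \<Omega> = w [x]"
  by (simp add: rgen_def app_simps rc_w)

end

section \<open>The subspace generated by an orthogonal pair\<close>

text \<open>No order between the norms of e and e1 is fixed, since the locale is used for the pair
  in both orders.\<close>

locale q_pair = q_fock q w for q :: real and w :: "'h::chilbert_space list \<Rightarrow> 'f::chilbert_space" +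
  fixes e e1 :: 'h
  assumes orth: "cinner e e1 = 0" and nz: "e \<noteq> 0" "e1 \<noteq> 0"
begin

lemma orth': "cinner e1 e = 0"
  using orth by (metis cinner_commute complex_cnj_zero)

definition mu :: real where "mu = (norm e)\<^sup>2 / (norm e1)\<^sup>2"

lemma mu_pos: "mu > 0"
  using nz by (simp add: mu_def)

text \<open>The factor \<open>mu\<close> is chosen so that \<open>h\<close> and \<open>k\<close> agree on the vacuum.\<close>

definition a where "a = lgen e e1"
definition b where "b = rgen e (of_real mu *\<^sub>C e1)"
definition h where "h = star a * a"
definition k where "k = of_real (1 / mu) *\<^sub>C (b * star b)"

lemma star_a: "star a = lgen e1 e"
  by (simp add: a_def star_lgen)

lemma star_b: "star b = rgen (of_real mu *\<^sub>C e1) e"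
  by (simp add: b_def star_rgen)

lemma star_b': "of_real (1 / mu) *\<^sub>C star b = rgen e1 (of_real (1 / mu) *\<^sub>C e)"
  using mu_pos by (simp add: star_b rgen_def rc_scaleC star_scaleC scaleC_add_right scaleC_scaleC)

lemma mu_e1: "of_real mu * cinner e1 e1 = cinner e e"
  using nz by (simp add: mu_def cinner_self)

text \<open>Here \<open>mu\<close> acts a second time: for \<open>star a\<close> and
  \<open>b\<close> the commutation condition reads <e, e> = mu <e1, e1>. For \<open>a\<close> and
  \<open>b\<close> both sides vanish by orthogonality.\<close>

lemma commute_ab: "a * b = b * a" "star a * b = b * star a" "a * star b = star b * a"
  "star a * star b = star b * star a"
proof -
  show 1: "a * b = b * a" "star a * b = b * star a"
    unfolding star_a unfolding a_def b_def
    by (rule lgen_rgen_commute, simp add: cinner_simps orth orth' mu_e1)+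
  show "a * star b = star b * a" "star a * star b = star b * star a"
    using arg_cong[OF 1(2), of star] arg_cong[OF 1(1), of star] by (simp_all add: star_mult)
qed

lemma star_h: "star h = h" and star_k: "star k = k"
  by (simp_all add: h_def k_def star_mult star_scaleC)

lemma h_commute: "b * h = h * b" "star b * h = h * star b"
  unfolding h_def by (rule mult_commute_mult; simp only: commute_ab)+

lemma a_k: "a * k = k * a" "star a * k = k * star a"
proof -
  have "a * (b * star b) = (b * star b) * a" "star a * (b * star b) = (b * star b) * star a"
    by (rule mult_commute_mult; simp only: commute_ab)+
  then show "a * k = k * a" "star a * k = k * star a" by (simp_all add: k_def)
qed

lemma h_k: "h * k = k * h"
  unfolding h_def by (rule sym, rule mult_commute_mult; simp only: a_k)

lemma a_Nil: "app a \<Omega> = w [e]" "app b \<Omega> = w [e]" "app (star a) \<Omega> = w [e1]"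
  "app (star b) \<Omega> = of_real mu *\<^sub>C w [e1]"
  by (simp_all add: star_a star_b) (simp_all add: a_def b_def lgen_Nil rgen_Nil w_Cons_scale)

text \<open>Since a and b both send Omega to e and \<open>star a\<close> commutes with b, h Omega =
  b e1; and e1 is \<open>star b\<close> applied to Omega, divided by mu.\<close>

lemma h_Nil: "app h \<Omega> = app k \<Omega>"
proof -
  have "app h \<Omega> = app (star a * b) \<Omega>" by (simp add: h_def a_Nil)
  also have "\<dots> = app b (w [e1])" unfolding commute_ab by (simp add: a_Nil)
  also have "\<dots> = app k \<Omega>"
    using mu_pos by (simp add: k_def app_simps a_Nil scaleC_scaleC)
  finally show ?thesis .
qed

subsection \<open>Invariance\<close>

definition F0 where "F0 = closure (cspan (w ` lists {e, e1}))"

lemma F0_csubspace: "csubspace F0" and F0_closed: "closed F0" and Nil_F0: "\<Omega> \<in> F0"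
proof -
  show "csubspace F0" "closed F0"
    by (simp_all add: F0_def csubspace_closure csubspace_cspan)
  have "\<Omega> \<in> cspan (w ` lists {e, e1})" by (rule cspan_base) auto
  then show "\<Omega> \<in> F0" unfolding F0_def using closure_subset by blast
qed

definition Inv where "Inv = {X. \<forall>x\<in>F0. app X x \<in> F0}"

lemma InvI: "(\<And>xs. xs \<in> lists {e, e1} \<Longrightarrow> app X (w xs) \<in> F0) \<Longrightarrow> X \<in> Inv"
  unfolding Inv_def
proof (intro CollectI ballI)
  fix x assume *: "\<And>xs. xs \<in> lists {e, e1} \<Longrightarrow> app X (w xs) \<in> F0" and "x \<in> F0"
  then show "app X x \<in> F0"
    using app_closure_cspan[OF _ F0_csubspace F0_closed, of "w ` lists {e, e1}" X x]
    unfolding F0_def[symmetric] by blast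
qed

lemma InvD: "X \<in> Inv \<Longrightarrow> x \<in> F0 \<Longrightarrow> app X x \<in> F0"
  by (simp add: Inv_def)

lemma Inv_intros:
  "1 \<in> Inv" "X \<in> Inv \<Longrightarrow> Y \<in> Inv \<Longrightarrow> X * Y \<in> Inv" "X \<in> Inv \<Longrightarrow> Y \<in> Inv \<Longrightarrow> X + Y \<in> Inv"
  "X \<in> Inv \<Longrightarrow> Y \<in> Inv \<Longrightarrow> X - Y \<in> Inv" "X \<in> Inv \<Longrightarrow> c *\<^sub>C X \<in> Inv"
  by (auto simp: Inv_def app_simps csubspaceD[OF F0_csubspace])

lemma w_F0: "xs \<in> lists {e, e1} \<Longrightarrow> w xs \<in> F0"
  unfolding F0_def by (rule subsetD[OF closure_subset], rule cspan_base) simp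

lemma cspan_lists_F0: "cspan (w ` {zs. zs \<in> lists {e, e1} \<and> P zs}) \<subseteq> F0"
  by (rule cspan_minimal[OF F0_csubspace]) (auto intro!: w_F0)

lemma Inv_cr: "x \<in> {e, e1} \<Longrightarrow> cr x \<in> Inv" "x \<in> {e, e1} \<Longrightarrow> rc x \<in> Inv"
  by (rule InvI, auto simp: cr_w rc_w intro!: w_F0)+

lemma Inv_an: "an x \<in> Inv" "ra x \<in> Inv"
proof -
  show "an x \<in> Inv"
    by (rule InvI, unfold an_w, rule subsetD[OF cspan_lists_F0 anw_in_lists])
  show "ra x \<in> Inv"
    by (rule InvI, rule subsetD[OF cspan_lists_F0 ra_in_lists])
qed

lemma Inv_gen: "a \<in> Inv" "star a \<in> Inv" "b \<in> Inv" "star b \<in> Inv"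
proof -
  have "rc (c *\<^sub>C e1) \<in> Inv" for c
    unfolding rc_scaleC by (intro Inv_intros Inv_cr) simp
  then show "a \<in> Inv" "star a \<in> Inv" "b \<in> Inv" "star b \<in> Inv"
    unfolding star_a star_b unfolding a_def b_def lgen_def rgen_def
    by (simp_all add: Inv_intros Inv_cr Inv_an)
qed

lemma Inv_h: "h \<in> Inv" "k \<in> Inv"
  unfolding h_def k_def by (intro Inv_intros Inv_gen)+

lemma Inv_dil: "\<bar>t\<bar> \<le> 1 \<Longrightarrow> dil t \<in> Inv"
  by (rule InvI) (auto simp: dil_w intro!: csubspaceD(3)[OF F0_csubspace] w_F0)

lemma Inv_cheb: "X \<in> Inv \<Longrightarrow> cheb X n \<in> Inv"
  by (induction n rule: induct_nat_012) (auto intro!: Inv_intros)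

lemma Inv_walg: "X \<in> walg G \<Longrightarrow> G \<subseteq> Inv \<Longrightarrow> X \<in> Inv"
  by (induction rule: walg.induct) (auto intro: Inv_intros)

definition E :: "'f bop" where
  "E = (SOME E. (\<forall>x. app E x \<in> F0) \<and> (\<forall>x\<in>F0. app E x = x) \<and>
    (\<forall>v\<in>F0. \<forall>x. cinner v (x - app E x) = 0) \<and> star E = E \<and> (\<forall>x. norm (app E x) \<le> norm x))"

lemma E: "app E x \<in> F0" "x \<in> F0 \<Longrightarrow> app E x = x" "v \<in> F0 \<Longrightarrow> cinner v (x - app E x) = 0"
  "star E = E" "norm (app E x) \<le> norm x"
proof -
  have "\<exists>E. (\<forall>x. app E x \<in> F0) \<and> (\<forall>x\<in>F0. app E x = x) \<and>
    (\<forall>v\<in>F0. \<forall>x. cinner v (x - app E x) = 0) \<and> star E = E \<and> (\<forall>x. norm (app E x) \<le> norm x)"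
    using projection_bop[OF F0_csubspace F0_closed] by metis
  from someI_ex[OF this, folded E_def]
  show "app E x \<in> F0" "x \<in> F0 \<Longrightarrow> app E x = x" "v \<in> F0 \<Longrightarrow> cinner v (x - app E x) = 0"
    "star E = E" "norm (app E x) \<le> norm x" by blast+
qed

lemma E_unique: "y \<in> F0 \<Longrightarrow> (\<And>v. v \<in> F0 \<Longrightarrow> cinner v (x - y) = 0) \<Longrightarrow> app E x = y"
proof -
  assume y: "y \<in> F0" "\<And>v. v \<in> F0 \<Longrightarrow> cinner v (x - y) = 0"
  have "app E x - y \<in> F0" using y E(1) by (intro csubspaceD[OF F0_csubspace])
  then have "cinner (app E x - y) ((x - y) - (x - app E x)) = 0"
    using y(2) E(3) by (simp only: cinner_diff_right[of _ "x - y"]) simp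
  then show ?thesis by simp
qed

lemma E_commute: "X \<in> Inv \<Longrightarrow> star X \<in> Inv \<Longrightarrow> X * E = E * X"
proof (rule bop_eqI)
  fix x assume X: "X \<in> Inv" "star X \<in> Inv"
  have "app E (app X x) = app X (app E x)"
  proof (rule E_unique)
    show "app X (app E x) \<in> F0" by (intro InvD[OF X(1)] E)
    fix v assume "v \<in> F0"
    then have "cinner (app (star X) v) (x - app E x) = 0" by (intro E InvD[OF X(2)])
    then show "cinner v (app X x - app X (app E x)) = 0"
      by (simp add: cinner_star_left app_diff_right)
  qed
  then show "app (X * E) x = app (E * X) x" by simp
qed

lemma E_E: "E * E = E"
  by (rule bop_eqI) (simp add: E)

text \<open>\<open>F0\<close> has finitely many words of length below N over its two letters, and on
  the orthogonal complement of these in \<open>F0\<close> the operator has norm at most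
  |q|^N.\<close>

lemma compact_op_dil_E: "compact_op (dil q * E)"
proof (rule compact_op_approx)
  fix d :: real assume "d > 0"
  obtain N where N: "\<bar>q\<bar> ^ N < d"
    using real_arch_pow_inv[OF \<open>d > 0\<close> abs_q_less] by blast
  let ?A = "w ` {xs. xs \<in> lists {e, e1} \<and> length xs < N}"
  have "finite {xs. set xs \<subseteq> {e, e1} \<and> length xs \<le> N}"
    by (rule finite_lists_length_le) simp
  then have "finite {xs. xs \<in> lists {e, e1} \<and> length xs < N}"
    by (rule finite_subset[rotated]) auto
  then have "finite ?A" by simp
  from finite_rank_projection[OF this] obtain P where P: "compact_op P" "\<And>x. app P x \<in> cspan ?A"
    "\<And>a x. a \<in> ?A \<Longrightarrow> cinner a (x - app P x) = 0" "\<And>x. norm (x - app P x) \<le> norm x" by blast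
  have "norm (app (dil q * E - dil q * P * E) x) \<le> d * norm x" for x
  proof -
    let ?y = "app E x - app P (app E x)"
    have "?y \<in> F0"
      by (intro csubspaceD(5)[OF F0_csubspace] E(1) subsetD[OF cspan_lists_F0 P(2)])
    then have "norm (app (dil q) ?y) \<le> \<bar>q\<bar> ^ N * norm ?y"
      using P(3) by (intro norm_dil_high[of q ?y "{e, e1}"]) (auto simp: F0_def)
    also have "\<dots> \<le> d * norm x"
      using N P(4)[of "app E x"] E(5)[of x] \<open>d > 0\<close> by (intro mult_mono) auto
    finally show ?thesis by (simp add: app_simps)
  qed
  moreover have "compact_op (dil q * P * E)" by (intro compact_op_left compact_op_right P)
  ultimately show "\<exists>Y'. compact_op Y' \<and> (\<forall>x. norm (app (dil q * E - Y') x) \<le> d * norm x)" by blast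
qed

subsection \<open>Null operators\<close>

text \<open>One scale for three operators. The product \<open>a * star a\<close> is included because
  a intertwines h with it, and its Chebyshev orbits must obey the same bounds.\<close>

definition scal :: real where
  "scal = (SOME c. c > 0 \<and> (\<forall>X\<in>{h, k, a * star a}. \<forall>x. norm (app X x) \<le> c / 2 * norm x))"

lemma scal: "scal > 0" "norm (app h x) \<le> scal / 2 * norm x" "norm (app k x) \<le> scal / 2 * norm x"
  "norm (app (a * star a) x) \<le> scal / 2 * norm x"
proof -
  obtain f :: "'f bop \<Rightarrow> real" where f: "\<And>X. f X > 0" "\<And>X x. norm (app X x) \<le> f X * norm x"
    using app_bounded by metis
  define c where "c = 2 * (f h + f k + f (a * star a))"
  have "c > 0" using f(1)[of h] f(1)[of k] f(1)[of "a * star a"] by (simp add: c_def)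
  moreover have "norm (app X x) \<le> c / 2 * norm x" if "X \<in> {h, k, a * star a}" for X x
  proof (rule order_trans[OF f(2)])
    show "f X * norm x \<le> c / 2 * norm x"
      using that f(1)[of h] f(1)[of k] f(1)[of "a * star a"]
      by (intro mult_right_mono) (auto simp: c_def)
  qed
  ultimately have "\<exists>c. c > 0 \<and> (\<forall>X\<in>{h, k, a * star a}. \<forall>x. norm (app X x) \<le> c / 2 * norm x)"
    by blast
  from someI_ex[OF this, folded scal_def]
  show "scal > 0" "norm (app h x) \<le> scal / 2 * norm x" "norm (app k x) \<le> scal / 2 * norm x"
    "norm (app (a * star a) x) \<le> scal / 2 * norm x"
    by blast+
qed

definition g where "g = of_real (1 / scal) *\<^sub>C h"
definition g' where "g' = of_real (1 / scal) *\<^sub>C k"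

sublocale g: half_contraction g
proof
  show "star g = g" by (simp add: g_def star_scaleC star_h)
  show "norm (app g x) \<le> norm x / 2" for x
    using scal(1) scal(2)[of x] by (simp add: g_def app_simps norm_scaleC norm_divide field_simps)
qed

sublocale g': half_contraction g'
proof
  show "star g' = g'" by (simp add: g'_def star_scaleC star_k)
  show "norm (app g' x) \<le> norm x / 2" for x
    using scal(1) scal(3)[of x] by (simp add: g'_def app_simps norm_scaleC norm_divide field_simps)
qed

definition u where "u m = app (cheb g m) \<Omega>"

lemma norm_Nil: "norm \<Omega> = 1"
proof -
  have "complex_of_real ((norm \<Omega>)\<^sup>2) = of_real 1"
    using norm_w_Nil by (simp add: cinner_self)
  then have "(norm \<Omega>)\<^sup>2 = 1" using of_real_eq_iff by blast
  then show ?thesis by (simp add: power2_eq_1_iff) (metis norm_ge_zero not_one_le_zero neg_0_le_iff_le order_trans zero_le_one)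
qed

lemma norm_u: "norm (u m) \<le> 2"
  using g.cheb_upper[of m \<Omega>] by (simp add: u_def norm_Nil)

lemma u_F0: "u m \<in> F0"
  unfolding u_def g_def by (intro InvD[OF Inv_cheb] Inv_intros Inv_h Nil_F0)

lemma u_alt: "u m = app (cheb g' m) \<Omega>"
  unfolding u_def by (rule cheb_agree) (simp_all add: g_def g'_def app_simps h_Nil h_k)

definition nul where "nul Y \<longleftrightarrow> average_null (\<lambda>m. cinner (u m) (app Y (u m)))"

lemma nul_csubspace: "csubspace {Y. nul Y}"
  by (auto simp: csubspace_def nul_def app_simps cinner_simps intro!: average_null_add average_null_cmult)

lemma nul_commutator: "nul (Y * h - h * Y)"
proof -
  have "Y * h - h * Y = of_real scal *\<^sub>C (Y * g - g * Y)"
    using scal(1) by (simp add: g_def scaleC_diff_right scaleC_scaleC)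
  moreover have "nul (Y * g - g * Y)"
    unfolding nul_def u_def by (rule g.average_null_commutator)
  ultimately show ?thesis
    using csubspaceD(3)[OF nul_csubspace, of "Y * g - g * Y" "of_real scal"] by simp
qed

definition RA where "RA = walg {b, star b}"

lemma RA_commute: "y \<in> RA \<Longrightarrow> star a * y = y * star a" "y \<in> RA \<Longrightarrow> h * y = y * h" "y \<in> RA \<Longrightarrow> a * y = y * a"
  unfolding RA_def by (rule walg_commute, assumption, auto simp: commute_ab h_commute)+

lemma RA_Inv: "y \<in> RA \<Longrightarrow> y \<in> Inv"
  unfolding RA_def by (erule Inv_walg) (auto intro: Inv_gen)

lemma RA_intros: "1 \<in> RA" "b \<in> RA" "star b \<in> RA" "y \<in> RA \<Longrightarrow> y' \<in> RA \<Longrightarrow> y * y' \<in> RA" "y \<in> RA \<Longrightarrow> star y \<in> RA"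
  unfolding RA_def by (auto intro: walg_one walg_base walg_mult walg_star)

text \<open>A right annihilator meets only the creation part of a left generator. That of
  \<open>star a\<close> is l(e1), orthogonal to e, so only the factor \<open>a\<close> of h
  contributes.\<close>

lemma ra_h: "ra e * h = h * ra e + cinner e e *\<^sub>C (star a * dil q)"
proof -
  have "ra e * star a = star a * ra e"
    unfolding star_a using orth by (simp add: ra_lgen)
  moreover have "ra e * a = a * ra e + cinner e e *\<^sub>C dil q"
    by (simp add: a_def ra_lgen)
  ultimately show ?thesis
    unfolding h_def by (metis (no_types, lifting) distrib_left mult.assoc scaleC_mult_right)
qed

text \<open>Words in RA commute with h and with \<open>star a\<close>, so the commutator of h with
  \<open>y * ra e * y'\<close> comes from the middle factor alone.\<close>

lemma nul_base:
  assumes y: "y \<in> RA" "y' \<in> RA"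
  shows "nul (star a * y * dil q * y')"
proof -
  have "(y * ra e * y') * h - h * (y * ra e * y') = y * (ra e * h - h * ra e) * y'"
  proof -
    have "(y * ra e * y') * h = y * (ra e * h) * y'"
      by (simp only: mult.assoc RA_commute(2)[OF y(2), symmetric])
    moreover have "h * (y * ra e * y') = y * (h * ra e) * y'"
      by (simp only: mult.assoc[symmetric] RA_commute(2)[OF y(1)])
    ultimately show ?thesis
      by (simp only: right_diff_distrib left_diff_distrib)
  qed
  also have "\<dots> = cinner e e *\<^sub>C (star a * y * dil q * y')"
    using RA_commute(1)[OF y(1)] by (simp add: ra_h mult.assoc[symmetric])
  finally have "nul (cinner e e *\<^sub>C (star a * y * dil q * y'))"
    using nul_commutator by metis
  then have "nul ((1 / cinner e e) *\<^sub>C cinner e e *\<^sub>C (star a * y * dil q * y'))"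
    using csubspaceD(3)[OF nul_csubspace] by blast
  then show ?thesis
    using nz by (simp add: scaleC_scaleC)
qed

text \<open>Creation and annihilation parts of the generators of RA: index True belongs to
  \<open>b\<close>, index False to \<open>star b\<close> divided by \<open>mu\<close>.\<close>

definition rr where "rr i = (if i then rc e else rc e1)"
definition dd where "dd i = (if i then ra (of_real mu *\<^sub>C e1) else ra (of_real (1 / mu) *\<^sub>C e))"

sublocale weyl: q_weyl q rr dd
  "\<lambda>i j. cinner (if i then of_real mu *\<^sub>C e1 else of_real (1 / mu) *\<^sub>C e) (if j then e else e1)"
  by unfold_locales (simp add: rr_def dd_def ra_rc)

lemma rr_dd: "rr True + dd True = b" "rr False + dd False = of_real (1 / mu) *\<^sub>C star b"
  unfolding star_b' by (simp_all add: rr_def dd_def b_def rgen_def del: of_real_divide)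

text \<open>The commutator of \<open>h\<close> with \<open>y r(e)\<^sup>* y'\<close> is a multiple of \<open>star a * y * dil q * y'\<close>,
  which therefore averages to zero. So \<open>J\<close> contains \<open>1\<close>, and by the relations of \<open>weyl\<close> it contains
  all normally ordered monomials.\<close>

definition J where "J = {Z. \<forall>y\<in>RA. \<forall>y'\<in>RA. nul (star a * y * Z * dil q * y')}"

lemma J_csubspace: "csubspace J"
  unfolding csubspace_def J_def
proof (intro conjI ballI allI CollectI)
  show "nul (star a * y * 0 * dil q * y')" for y y'
    using csubspaceD(1)[OF nul_csubspace] by simp
next
  fix X Z y y' assume "X \<in> {Z. \<forall>y\<in>RA. \<forall>y'\<in>RA. nul (star a * y * Z * dil q * y')}"
    "Z \<in> {Z. \<forall>y\<in>RA. \<forall>y'\<in>RA. nul (star a * y * Z * dil q * y')}" "y \<in> RA" "y' \<in> RA"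
  then show "nul (star a * y * (X + Z) * dil q * y')"
    using csubspaceD(2)[OF nul_csubspace] by (simp add: distrib_left distrib_right)
next
  fix c Z y y' assume "Z \<in> {Z. \<forall>y\<in>RA. \<forall>y'\<in>RA. nul (star a * y * Z * dil q * y')}" "y \<in> RA" "y' \<in> RA"
  then show "nul (star a * y * (c *\<^sub>C Z) * dil q * y')"
    using csubspaceD(3)[OF nul_csubspace] by simp
qed

lemma monomials_J:
  assumes "q \<noteq> 0"
  shows "weyl.R us * weyl.D ws \<in> J"
proof (rule weyl.monomials_in_subspace[OF abs_q_less assms J_csubspace])
  show "1 \<in> J" by (simp add: J_def nul_base)
next
  fix Z i assume Z: "Z \<in> J"
  \<comment> \<open>A factor from RA to the left of Z is absorbed by the arbitrary word y.\<close>
  have bZ: "x * Z \<in> J" if "x \<in> RA" for x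
    unfolding J_def
  proof (intro CollectI ballI)
    fix y y' assume "y \<in> RA" "y' \<in> RA"
    then have "nul (star a * (y * x) * Z * dil q * y')"
      using Z that unfolding J_def by (blast intro: RA_intros)
    then show "nul (star a * y * (x * Z) * dil q * y')" by (simp add: mult.assoc)
  qed
  show "(rr i + dd i) * Z \<in> J"
    using csubspaceD(3)[OF J_csubspace bZ[of "star b"]] bZ[of b]
    by (cases i) (simp_all add: rr_dd RA_intros del: of_real_divide)
next
  fix Z i assume Z: "Z \<in> J"
  \<comment> \<open>Passing through \<open>dil q\<close> rescales creators and annihilators
    inversely. The weights q and 1/q compensate for this, and the generator that emerges on the
    right is absorbed by y'.\<close>
  have d: "(of_real q *\<^sub>C rr i + of_real (1 / q) *\<^sub>C dd i) * dil q = dil q * (rr i + dd i)"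
    using assms
    by (cases i) (simp_all add: rr_def dd_def distrib_left distrib_right dil_rc ra_dil scaleC_scaleC
        del: of_real_divide flip: of_real_mult)

  have "nul (star a * y * (Z * (of_real q *\<^sub>C rr i + of_real (1 / q) *\<^sub>C dd i)) * dil q * y')"
    if y: "y \<in> RA" "y' \<in> RA" for y y'
  proof -
    have *: "nul (star a * y * Z * dil q * (x * y'))" if "x \<in> RA" for x
      using Z y that unfolding J_def by (blast intro: RA_intros)
    have "star a * y * (Z * (of_real q *\<^sub>C rr i + of_real (1 / q) *\<^sub>C dd i)) * dil q * y' =
        star a * y * Z * ((of_real q *\<^sub>C rr i + of_real (1 / q) *\<^sub>C dd i) * dil q) * y'"
      by (simp only: mult.assoc)
    also have "\<dots> = star a * y * Z * dil q * ((rr i + dd i) * y')"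
      unfolding d by (simp only: mult.assoc)
    finally show ?thesis
      using *[of b] csubspaceD(3)[OF nul_csubspace, of "star a * y * Z * dil q * (star b * y')" "of_real (1/mu)"] *[of "star b"]
      by (cases i) (simp_all add: rr_dd RA_intros del: of_real_divide)
  qed
  then show "Z * (of_real q *\<^sub>C rr i + of_real (1 / q) *\<^sub>C dd i) \<in> J"
    by (simp add: J_def)
qed

section \<open>From q^N to the vacuum projection\<close>

lemma ra_zero_imp_Nil:
  assumes "y \<in> F0" "app (ra e) y = 0" "app (ra e1) y = 0"
  shows "y = cinner \<Omega> y *\<^sub>C \<Omega>"
proof -
  define z where "z = y - cinner \<Omega> y *\<^sub>C \<Omega>"
  have "cinner z s = 0" if s: "s \<in> w ` lists {e, e1}" for s
  proof -
    obtain xs where xs: "s = w xs" "xs \<in> lists {e, e1}" using s by blast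
    have "cinner s z = 0"
    proof (cases xs rule: rev_cases)
      case Nil
      then show ?thesis by (simp add: xs z_def cinner_simps norm_w_Nil)
    next
      case (snoc ys x)
      then have "x = e \<or> x = e1" using xs by auto
      moreover have "cinner s y = cinner (w ys) (app (ra x) y)"
        by (simp add: xs snoc cinner_star_right rc_w)
      ultimately have "cinner s y = 0" using assms by auto
      moreover have "cinner s \<Omega> = 0" by (simp add: xs snoc cinner_w q_gram_length)
      ultimately show ?thesis by (simp add: z_def cinner_simps)
    qed
    then show ?thesis by (metis cinner_commute complex_cnj_zero)
  qed
  moreover have "z \<in> F0"
    unfolding z_def by (intro csubspaceD[OF F0_csubspace] assms Nil_F0)
  ultimately have "cinner z z = 0"
    using orthogonal_closure_cspan(1)[of "w ` lists {e, e1}" z z] unfolding F0_def by blast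
  then show ?thesis by (simp add: z_def)
qed

text \<open>K = 1 - S / c, where S is the sum over e and e1 of the right creator times its adjoint.
  It shrinks every vector that is not killed by both right annihilators and fixes Omega; being a
  polynomial in the right operators, it keeps its powers within reach of
  \<open>monomials_J\<close>.\<close>

lemma damping_operator:
  obtains K d where "d > 0" "star K = K" "K \<in> Inv" "app K \<Omega> = \<Omega>"
    "\<And>x. (norm (app K x))\<^sup>2 \<le> (norm x)\<^sup>2 - d * ((norm (app (ra e) x))\<^sup>2 + (norm (app (ra e1) x))\<^sup>2)"
    "\<And>Z. Z \<in> cspan (range (\<lambda>(us, ws). weyl.R us * weyl.D ws)) \<Longrightarrow>
      K * Z \<in> cspan (range (\<lambda>(us, ws). weyl.R us * weyl.D ws))"
proof -
  let ?S = "rc e * ra e + rc e1 * ra e1"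
  obtain K1 K2 where K1: "K1 > 0" "\<And>x. norm (app (rc e) x) \<le> K1 * norm x"
    and K2: "K2 > 0" "\<And>x. norm (app (rc e1) x) \<le> K2 * norm x"
    using app_bounded[of "rc e"] app_bounded[of "rc e1"] by metis
  \<comment> \<open>Chosen so that |S x|^2 <= c <x, S x>, by (s + t)^2 <= 2 s^2 + 2 t^2.\<close>
  define c where "c = 2 * (K1\<^sup>2 + K2\<^sup>2)"
  have c: "c > 0" using K1 K2 by (simp add: c_def add_pos_pos)
  define K where "K = 1 - of_real (1 / c) *\<^sub>C ?S"
  let ?t = "\<lambda>x. (norm (app (ra e) x))\<^sup>2 + (norm (app (ra e1) x))\<^sup>2"
  have inner: "inner x (app ?S x) = ?t x" for x
    by (simp add: inner_eq_Re_cinner app_simps cinner_simps cinner_star_left[symmetric] cinner_self)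
  have norm: "(norm (app ?S x))\<^sup>2 \<le> c * ?t x" for x
  proof -
    let ?p = "app (ra e) x" and ?r = "app (ra e1) x"
    have "norm (app ?S x) \<le> K1 * norm ?p + K2 * norm ?r"
      unfolding app_add app_mult by (intro norm_triangle_le add_mono K1 K2)
    then have "(norm (app ?S x))\<^sup>2 \<le> (K1 * norm ?p + K2 * norm ?r)\<^sup>2"
      by (rule power_mono) simp
    also have "\<dots> \<le> 2 * (K1\<^sup>2 * (norm ?p)\<^sup>2 + K2\<^sup>2 * (norm ?r)\<^sup>2)"
      using sum_squares_bound[of "K1 * norm ?p" "K2 * norm ?r"]
      by (simp add: power2_sum power_mult_distrib)
    also have "\<dots> \<le> 2 * ((K1\<^sup>2 + K2\<^sup>2) * (norm ?p)\<^sup>2 + (K1\<^sup>2 + K2\<^sup>2) * (norm ?r)\<^sup>2)"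
      by (intro mult_left_mono add_mono mult_right_mono) auto
    finally show ?thesis by (simp add: c_def algebra_simps)
  qed
  show ?thesis
  proof (rule that[of "1 / c" K])
    show "star K = K"
      by (simp add: K_def star_diff star_add star_scaleC star_mult)
    show "K \<in> Inv"
      unfolding K_def by (intro Inv_intros Inv_cr Inv_an) auto
    show "app K \<Omega> = \<Omega>"
      by (simp add: K_def app_simps)
    show "(norm (app K x))\<^sup>2 \<le> (norm x)\<^sup>2 - 1 / c * ?t x" for x
    proof -
      have K: "app K x = x - (1 / c) *\<^sub>R app ?S x"
        by (simp add: K_def app_diff app_scaleC scaleR_scaleC)
      have "(norm (app K x))\<^sup>2 = (norm x)\<^sup>2 - 2 * (1 / c) * inner x (app ?S x) + (1 / c)\<^sup>2 * (norm (app ?S x))\<^sup>2"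
        unfolding K power2_norm_eq_inner
        by (simp add: inner_diff_left inner_diff_right inner_commute power2_eq_square)
      also have "(1 / c)\<^sup>2 * (norm (app ?S x))\<^sup>2 \<le> (1 / c)\<^sup>2 * (c * ?t x)"
        by (intro mult_left_mono norm) auto
      also have "(1 / c)\<^sup>2 * (c * ?t x) = 1 / c * ?t x"
        using c by (simp add: power2_eq_square)
      finally show ?thesis unfolding inner by (simp add: add_divide_distrib)
    qed
    fix Z assume Z: "Z \<in> cspan (range (\<lambda>(us, ws). weyl.R us * weyl.D ws))" (is "_ \<in> ?V")
    have V: "csubspace ?V" by (rule csubspace_cspan)
    have "ra e * Z = of_real mu *\<^sub>C (dd False * Z)" "ra e1 * Z = of_real (1 / mu) *\<^sub>C (dd True * Z)"
      using mu_pos by (simp_all add: dd_def ra_scaleC scaleC_scaleC)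
    then have "ra e * Z \<in> ?V" "ra e1 * Z \<in> ?V"
      using weyl.d_mult_span[OF Z] csubspaceD(3)[OF V] by metis+
    then have "rc e * (ra e * Z) \<in> ?V" "rc e1 * (ra e1 * Z) \<in> ?V"
      using weyl.r_mult_span[of _ True] weyl.r_mult_span[of _ False] by (auto simp: rr_def)
    then have "Z - of_real (1 / c) *\<^sub>C (rc e * (ra e * Z) + rc e1 * (ra e1 * Z)) \<in> ?V"
      by (intro csubspaceD[OF V] Z)
    then show "K * Z \<in> ?V"
      by (simp add: K_def left_diff_distrib distrib_right mult.assoc)
  qed (use c in simp)
qed

text \<open>The powers \<open>L j\<close> of K^2 lie in \<open>J\<close> and converge strongly on
  \<open>F0\<close> to the vacuum projection. Multiplied by the compact \<open>dil q * E\<close>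
  they converge in norm, and nullity survives uniform limits; finally
  \<open>dil 0 * dil q = dil 0\<close>. For q = 0 the operator \<open>dil q\<close> is already the
  vacuum projection.\<close>

lemma nul_vacuum:
  assumes y: "y \<in> RA" "y' \<in> RA"
  shows "nul (star a * y * dil 0 * y')"
proof (cases "q = 0")
  case True
  then show ?thesis using nul_base[OF y] by simp
next
  case False
  obtain d K where K: "d > 0" "star K = K" "K \<in> Inv" "app K \<Omega> = \<Omega>"
    "\<And>x. (norm (app K x))\<^sup>2 \<le> (norm x)\<^sup>2 - d * ((norm (app (ra e) x))\<^sup>2 + (norm (app (ra e1) x))\<^sup>2)"
    "\<And>Z. Z \<in> cspan (range (\<lambda>(us, ws). weyl.R us * weyl.D ws)) \<Longrightarrow>
      K * Z \<in> cspan (range (\<lambda>(us, ws). weyl.R us * weyl.D ws))"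
    by (rule damping_operator) (rule that)
  define L where "L j = (K * K) ^ j" for j
  have L_Suc: "L (Suc j) = K * (K * L j)" "L 0 = 1" for j
    by (simp_all add: L_def mult.assoc)
  have K_le: "norm (app K x) \<le> norm x" for x
  proof (rule power2_le_imp_le)
    have "0 \<le> d * ((norm (app (ra e) x))\<^sup>2 + (norm (app (ra e1) x))\<^sup>2)"
      using K(1) by simp
    then show "(norm (app K x))\<^sup>2 \<le> (norm x)\<^sup>2" using K(5)[of x] by linarith
  qed simp
  have L_le: "norm (app (L j) x) \<le> norm x" for j x
    by (induction j) (auto simp: L_Suc intro: order_trans[OF K_le])
  have L_Inv: "L j \<in> Inv" for j
    by (induction j) (auto simp: L_Suc intro!: Inv_intros K)
  have L_J: "L j \<in> J" for j
  proof -
    let ?V = "cspan (range (\<lambda>(us, ws). weyl.R us * weyl.D ws))"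
    have "1 \<in> ?V" by (rule cspan_base, rule image_eqI[of _ _ "([], [])"]) auto
    then have "L j \<in> ?V"
      by (induction j) (simp_all add: L_Suc K(6))
    moreover have "?V \<subseteq> J"
      by (rule cspan_minimal[OF J_csubspace]) (auto simp: monomials_J[OF False])
    ultimately show ?thesis by blast
  qed
  have L_Nil: "app (L j) \<Omega> = \<Omega>" and star_L: "star (L j) = L j" for j
  proof -
    show "app (L j) \<Omega> = \<Omega>" by (induction j) (simp_all add: L_Suc K)
    have "star ((K * K) ^ j) = (K * K) ^ j"
      by (induction j) (simp_all add: star_mult K power_commutes)
    then show "star (L j) = L j" by (simp add: L_def)
  qed
  have dil0: "app (dil 0) x = cinner \<Omega> x *\<^sub>C \<Omega>" for x
    by (simp add: dil_0)
  have lim: "(\<lambda>j. app (L j) x) \<longlonglongrightarrow> app (dil 0) x" if x: "x \<in> F0" for x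
  proof -
    obtain z where z: "(\<lambda>j. app (L j) x) \<longlonglongrightarrow> z" "app (K * K) z = z"
      using contraction_powers_converge[OF K(2) K_le, of x] unfolding L_def by blast
    have zF: "z \<in> F0"
      by (rule closed_sequentially[OF F0_closed _ z(1)]) (use InvD[OF L_Inv x] in simp)
    \<comment> \<open>A fixed vector of K^2 loses no norm under K, so the damping estimate makes
      both right annihilators vanish on it.\<close>
    have "norm z \<le> norm (app K z)"
      using K_le[of "app K z"] z(2) by simp
    then have "(norm z)\<^sup>2 \<le> (norm (app K z))\<^sup>2" by (rule power_mono) simp
    then have "d * ((norm (app (ra e) z))\<^sup>2 + (norm (app (ra e1) z))\<^sup>2) \<le> 0"
      using K(5)[of z] by linarith
    then have "(norm (app (ra e) z))\<^sup>2 + (norm (app (ra e1) z))\<^sup>2 \<le> 0"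
      using K(1) by (simp add: mult_le_0_iff)
    then have "app (ra e) z = 0" "app (ra e1) z = 0"
      by (simp_all add: sum_power2_le_zero_iff)
    then have z': "z = cinner \<Omega> z *\<^sub>C \<Omega>" by (rule ra_zero_imp_Nil[OF zF])
    have "cinner \<Omega> (app (L j) x) = cinner \<Omega> x" for j
      using cinner_star_left[of "L j" \<Omega> x] by (simp add: star_L L_Nil)
    moreover have "(\<lambda>j. cinner \<Omega> (app (L j) x)) \<longlonglongrightarrow> cinner \<Omega> z"
      by (intro tendsto_intros z)
    ultimately have "cinner \<Omega> z = cinner \<Omega> x"
      by (simp add: LIMSEQ_const_iff)
    then show ?thesis using z(1) z' by (simp add: dil0)
  qed
  \<comment> \<open>The factor \<open>E\<close> restricts to \<open>F0\<close>, where the strong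
    convergence is known.\<close>
  define Kj where "Kj j = (L j - dil 0) * E" for j
  have Kj: "app (Kj j) x = app (L j) (app E x) - app (dil 0) (app E x)" for j x
    by (simp add: Kj_def app_diff)
  have "norm (app (Kj j) x) \<le> 2 * norm x" for j x
  proof -
    have "norm (app (dil 0) (app E x)) \<le> norm (app E x)"
      using cinner_cauchy_schwarz[of \<Omega> "app E x"] by (simp add: dil0 norm_scaleC norm_Nil)
    then have "norm (app (Kj j) x) \<le> norm (app E x) + norm (app E x)"
      unfolding Kj by (intro norm_triangle_le_diff add_mono L_le)
    then show ?thesis using E(5)[of x] by simp
  qed
  moreover have "(\<lambda>j. app (Kj j) x) \<longlonglongrightarrow> 0" for x
    unfolding Kj using tendsto_diff[OF lim[OF E(1)[of x]] tendsto_const[of "app (dil 0) (app E x)"]] by simp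
  ultimately have small: "\<exists>j. \<forall>x. norm (app (Kj j * (dil q * E)) x) \<le> r * norm x" if "r > 0" for r
    by (rule compact_op_mult_strong_limit[OF compact_op_dil_E _ _ that])
  obtain B1 B2 where B1: "B1 > 0" "\<And>x. norm (app (star (star a * y)) x) \<le> B1 * norm x"
    and B2: "B2 > 0" "\<And>x. norm (app y' x) \<le> B2 * norm x"
    using app_bounded[of "star (star a * y)"] app_bounded[of y'] by metis
  show ?thesis
    unfolding nul_def
  proof (rule average_null_approx)
    fix r :: real assume "r > 0"
    define B where "B = (B1 * 2) * (B2 * 2)"
    have "B > 0" using B1 B2 by (simp add: B_def)
    then obtain j where j: "\<And>x. norm (app (Kj j * (dil q * E)) x) \<le> r / B * norm x"
      using small[of "r / B"] \<open>r > 0\<close> by auto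
    have "average_null (\<lambda>m. cinner (u m) (app (star a * y * L j * dil q * y') (u m)))"
      using L_J[of j] y unfolding J_def nul_def by blast
    moreover have "cmod (cinner (u m) (app (star a * y * dil 0 * y') (u m)) -
        cinner (u m) (app (star a * y * L j * dil q * y') (u m))) \<le> r" for m
    proof -
      define x where "x = app y' (u m)"
      have x: "x \<in> F0" unfolding x_def by (intro InvD[OF RA_Inv] y u_F0)
      then have qx: "app (dil q) x \<in> F0" by (intro InvD[OF Inv_dil]) auto
      have "app (dil 0) (app (dil q) x) = app (dil 0) x"
        using dil_dil[of 0 q] by (metis abs_q abs_zero app_mult mult_zero_left zero_le_one)
      then have Kx: "app (Kj j * (dil q * E)) x = app (L j) (app (dil q) x) - app (dil 0) x"
        by (simp add: Kj E(2)[OF x] E(2)[OF qx])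
      have "cinner (u m) (app (star a * y * dil 0 * y') (u m)) -
          cinner (u m) (app (star a * y * L j * dil q * y') (u m)) =
          - cinner (app (star (star a * y)) (u m)) (app (Kj j * (dil q * E)) x)"
        unfolding Kx by (simp add: x_def cinner_star_left[of "star a * y"] cinner_diff_right app_diff_right del: star_star)
      then have "cmod (cinner (u m) (app (star a * y * dil 0 * y') (u m)) -
          cinner (u m) (app (star a * y * L j * dil q * y') (u m))) \<le>
          norm (app (star (star a * y)) (u m)) * norm (app (Kj j * (dil q * E)) x)"
        by (simp only: norm_minus_cancel cinner_cauchy_schwarz)
      also have "\<dots> \<le> (B1 * 2) * (r / B * (B2 * 2))"
      proof (intro mult_mono)
        show "norm (app (star (star a * y)) (u m)) \<le> B1 * 2"
          by (rule order_trans[OF B1(2)]) (use norm_u[of m] B1(1) in simp)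
        have "norm x \<le> B2 * 2"
          unfolding x_def by (rule order_trans[OF B2(2)]) (use norm_u[of m] B2(1) in simp)
        then show "norm (app (Kj j * (dil q * E)) x) \<le> r / B * (B2 * 2)"
          using \<open>r > 0\<close> \<open>B > 0\<close> by (intro order_trans[OF j] mult_left_mono) auto
      qed (use B1 in auto)
      also have "\<dots> = r" using B1(1) B2(1) by (simp add: B_def)
      finally show ?thesis .
    qed
    ultimately show "\<exists>s1. average_null s1 \<and> (\<forall>m. cmod (cinner (u m) (app (star a * y * dil 0 * y') (u m)) - s1 m) \<le> r)"
      by blast
  qed
qed

text \<open>Take x = y Omega with y in RA and P the vacuum projection. At u_m the form of
  \<open>star a * y * P * b * star y\<close> is mu |<x, a u_m>|^2; the factor b is there because
  \<open>star b\<close> and \<open>star a\<close> send Omega to proportional vectors. Such x span a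
  dense subspace of \<open>F0\<close>, and a u_m is bounded uniformly in m.\<close>

theorem average_weakly_null:
  assumes "x \<in> F0"
  shows "average_null (\<lambda>m. of_real ((cmod (cinner x (app a (u m))))\<^sup>2))"
proof -
  define W where "W = {x. average_null (\<lambda>m. of_real ((cmod (cinner x (app a (u m))))\<^sup>2))}"
  obtain Ka where Ka: "Ka > 0" "\<And>x. norm (app a x) \<le> Ka * norm x" using app_bounded by blast
  have au: "norm (app a (u m)) \<le> Ka * 2" for m
    by (rule order_trans[OF Ka(2)]) (use norm_u[of m] Ka(1) in simp)
  have bound: "(cmod (cinner (x + y) (app a (u m))))\<^sup>2 \<le>
      2 * (cmod (cinner x (app a (u m))))\<^sup>2 + 2 * (cmod (cinner y (app a (u m))))\<^sup>2" for x y m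
  proof -
    have "(cmod (cinner (x + y) (app a (u m))))\<^sup>2 \<le> (cmod (cinner x (app a (u m))) + cmod (cinner y (app a (u m))))\<^sup>2"
      unfolding cinner_add_left by (intro power_mono norm_triangle_ineq) auto
    also have "\<dots> \<le> 2 * (cmod (cinner x (app a (u m))))\<^sup>2 + 2 * (cmod (cinner y (app a (u m))))\<^sup>2"
      using sum_squares_bound[of "cmod (cinner x (app a (u m)))" "cmod (cinner y (app a (u m)))"]
      by (simp add: power2_sum)
    finally show ?thesis .
  qed
  have near: "x \<in> W" if ap: "\<And>r. r > 0 \<Longrightarrow> \<exists>y\<in>W. \<forall>m. 2 * (cmod (cinner (x - y) (app a (u m))))\<^sup>2 \<le> r" for x
    unfolding W_def
  proof (intro CollectI average_null_dominated)
    fix r :: real assume "r > 0"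
    then obtain y where y: "y \<in> W" "\<And>m. 2 * (cmod (cinner (x - y) (app a (u m))))\<^sup>2 \<le> r"
      using ap by blast
    have "average_null (\<lambda>m. 2 * of_real ((cmod (cinner y (app a (u m))))\<^sup>2))"
      using y(1) unfolding W_def by (intro average_null_cmult) blast
    moreover have "cmod (of_real ((cmod (cinner x (app a (u m))))\<^sup>2) - 0) \<le>
        r + Re (2 * of_real ((cmod (cinner y (app a (u m))))\<^sup>2))" for m
      using bound[of "x - y" y m] y(2)[of m] by (simp flip: of_real_power)
    ultimately show "\<exists>s1 s2. average_null s1 \<and> average_null s2 \<and> (\<forall>m. cmod (of_real ((cmod (cinner x (app a (u m))))\<^sup>2) - s1 m) \<le> r + Re (s2 m))"
      using average_null_zero by blast
  qed
  have W: "csubspace W"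
    unfolding csubspace_def
  proof (intro conjI ballI allI)
    show "0 \<in> W" by (simp add: W_def)
  next
    fix x c assume "x \<in> W"
    then have "average_null (\<lambda>m. of_real ((cmod c)\<^sup>2) * of_real ((cmod (cinner x (app a (u m))))\<^sup>2))"
      unfolding W_def by (intro average_null_cmult) blast
    then show "c *\<^sub>C x \<in> W"
      by (simp add: W_def cinner_scaleC_left norm_mult power_mult_distrib)
  next
    fix x y assume "x \<in> W" "y \<in> W"
    then have A: "average_null (\<lambda>m. 2 * of_real ((cmod (cinner x (app a (u m))))\<^sup>2) + 2 * of_real ((cmod (cinner y (app a (u m))))\<^sup>2))"
      unfolding W_def by (intro average_null_add average_null_cmult) blast+
    have "average_null (\<lambda>m. of_real ((cmod (cinner (x + y) (app a (u m))))\<^sup>2))"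
    proof (rule average_null_dominated)
      fix r :: real assume "r > 0"
      have "\<forall>m. cmod (of_real ((cmod (cinner (x + y) (app a (u m))))\<^sup>2) - 0) \<le> r +
          Re (2 * of_real ((cmod (cinner x (app a (u m))))\<^sup>2) + 2 * of_real ((cmod (cinner y (app a (u m))))\<^sup>2))"
      proof
        fix m
        have "(cmod (cinner (x + y) (app a (u m))))\<^sup>2 \<le> r +
            (2 * (cmod (cinner x (app a (u m))))\<^sup>2 + 2 * (cmod (cinner y (app a (u m))))\<^sup>2)"
          using bound[of x y m] \<open>r > 0\<close> by linarith
        then show "cmod (of_real ((cmod (cinner (x + y) (app a (u m))))\<^sup>2) - 0) \<le> r +
            Re (2 * of_real ((cmod (cinner x (app a (u m))))\<^sup>2) + 2 * of_real ((cmod (cinner y (app a (u m))))\<^sup>2))"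
          by (simp flip: of_real_power)
      qed
      then show "\<exists>s1 s2. average_null s1 \<and> average_null s2 \<and>
          (\<forall>m. cmod (of_real ((cmod (cinner (x + y) (app a (u m))))\<^sup>2) - s1 m) \<le> r + Re (s2 m))"
        using A average_null_zero by blast
    qed
    then show "x + y \<in> W" by (simp add: W_def)
  qed
  have clW: "closure W \<subseteq> W"
  proof
    fix x assume x: "x \<in> closure W"
    show "x \<in> W"
    proof (rule near)
      fix r :: real assume "r > 0"
      define d where "d = sqrt (r / 2) / (Ka * 2)"
      have "d > 0" using \<open>r > 0\<close> Ka by (simp add: d_def)
      then obtain y where y: "y \<in> W" "dist y x < d"
        using x unfolding closure_approachable by blast
      have "2 * (cmod (cinner (x - y) (app a (u m))))\<^sup>2 \<le> r" for m
      proof -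
        have "cmod (cinner (x - y) (app a (u m))) \<le> norm (x - y) * norm (app a (u m))"
          by (rule cinner_cauchy_schwarz)
        also have "\<dots> \<le> d * (Ka * 2)"
          using y(2) \<open>d > 0\<close> by (intro mult_mono au) (auto simp: dist_norm norm_minus_commute)
        also have "\<dots> = sqrt (r / 2)" using Ka by (simp add: d_def)
        finally have "(cmod (cinner (x - y) (app a (u m))))\<^sup>2 \<le> (sqrt (r / 2))\<^sup>2"
          by (intro power_mono) auto
        then show ?thesis using \<open>r > 0\<close> by simp
      qed
      with y show "\<exists>y\<in>W. \<forall>m. 2 * (cmod (cinner (x - y) (app a (u m))))\<^sup>2 \<le> r" by blast
    qed
  qed
  have base: "app y \<Omega> \<in> W" if y: "y \<in> RA" for y
  proof -
    define t where "t m = cinner (app y \<Omega>) (app a (u m))" for m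
    have "nul (star a * y * dil 0 * (b * star y))"
      by (intro nul_vacuum RA_intros y)
    moreover have "cinner (u m) (app (star a * y * dil 0 * (b * star y)) (u m)) = of_real mu * of_real ((cmod (t m))\<^sup>2)" for m
    proof -
      have "app (star a) (app y \<Omega>) = app y (app (star a) \<Omega>)"
        using arg_cong[OF RA_commute(1)[OF y], of "\<lambda>X. app X \<Omega>"] by simp
      then have s: "app (star b) \<Omega> = of_real mu *\<^sub>C app (star a) \<Omega>" by (simp add: a_Nil)
      have "cinner \<Omega> (app b (app (star y) (u m))) = cinner (app y (app (star b) \<Omega>)) (u m)"
        by (simp only: cinner_star_left[of b, symmetric] cinner_star_right)
      also have "\<dots> = of_real mu * cinner (app (star a) (app y \<Omega>)) (u m)"
        using \<open>app (star a) (app y \<Omega>) = _\<close> by (simp add: s app_simps cinner_simps)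
      also have "\<dots> = of_real mu * t m" by (simp add: t_def cinner_star_left)
      finally have 1: "cinner \<Omega> (app b (app (star y) (u m))) = of_real mu * t m" .
      have "cinner (u m) (app (star a) (app y \<Omega>)) = cnj (t m)"
        unfolding t_def by (metis cinner_commute cinner_star_left)
      then show ?thesis
        using 1 by (simp add: dil_0 app_simps cinner_simps mult_ac complex_norm_square[symmetric])
    qed
    ultimately have "average_null (\<lambda>m. of_real mu * of_real ((cmod (t m))\<^sup>2))"
      by (simp add: nul_def)
    then have "average_null (\<lambda>m. of_real (1 / mu) * (of_real mu * of_real ((cmod (t m))\<^sup>2)))"
      by (rule average_null_cmult)
    then show ?thesis
      using mu_pos by (simp add: W_def t_def)
  qed
  define V where "V = cspan ((\<lambda>y. app y \<Omega>) ` RA)"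
  have V: "csubspace V" unfolding V_def by (rule csubspace_cspan)
  have stable: "app X v \<in> V" if X: "X \<in> RA" and v: "v \<in> V" for X v
    unfolding V_def
  proof (rule cspan_image_subset[OF v[unfolded V_def] csubspace_cspan])
    fix s assume "s \<in> (\<lambda>y. app y \<Omega>) ` RA"
    then obtain y where "s = app y \<Omega>" "y \<in> RA" by blast
    then show "app X s \<in> cspan ((\<lambda>y. app y \<Omega>) ` RA)"
      using RA_intros(4)[OF X] by (intro cspan_base image_eqI[of _ _ "X * y"]) auto
  qed (simp_all add: app_simps)
  have "w xs \<in> V" if "xs \<in> lists {e, e1}" for xs
  proof (rule words_in_right[OF V _ _ that])
    show "\<Omega> \<in> V" unfolding V_def by (rule cspan_base, rule image_eqI[of _ _ 1]) (auto intro: RA_intros)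
    fix x assume "x \<in> {e, e1}"
    moreover have "app (rgen e (of_real mu *\<^sub>C e1)) v \<in> V" if "v \<in> V" for v
      using stable[OF RA_intros(2) that] by (simp add: b_def)
    moreover have "app (rgen e1 (of_real (1 / mu) *\<^sub>C e)) v \<in> V" if "v \<in> V" for v
      using csubspaceD(3)[OF V stable[OF RA_intros(3) that]] by (simp add: star_b'[symmetric] app_simps del: of_real_divide)
    ultimately show "\<exists>y. \<forall>v\<in>V. app (rgen x y) v \<in> V" by blast
  qed
  then have "F0 \<subseteq> closure V"
    unfolding F0_def by (intro closure_mono cspan_minimal[OF V]) auto
  also have "\<dots> \<subseteq> closure W"
    unfolding V_def by (intro closure_mono cspan_minimal[OF W]) (auto intro: base)
  finally show ?thesis
    using assms clW unfolding W_def by blast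
qed

end

section \<open>Mixing\<close>

context q_fock
begin

inductive_set AA :: "'f bop set" where
  AA_one: "1 \<in> AA"
| AA_cr: "X \<in> AA \<Longrightarrow> cr x * X \<in> AA"
| AA_an: "X \<in> AA \<Longrightarrow> an x * X \<in> AA"
| AA_rc: "X \<in> AA \<Longrightarrow> rc x * X \<in> AA"
| AA_ra: "X \<in> AA \<Longrightarrow> ra x * X \<in> AA"
| AA_add: "X \<in> AA \<Longrightarrow> Y \<in> AA \<Longrightarrow> X + Y \<in> AA"
| AA_scale: "X \<in> AA \<Longrightarrow> c *\<^sub>C X \<in> AA"

inductive_set AR :: "'f bop set" where
  AR_one: "1 \<in> AR"
| AR_rc: "X \<in> AR \<Longrightarrow> rc x * X \<in> AR"
| AR_ra: "X \<in> AR \<Longrightarrow> ra x * X \<in> AR"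
| AR_add: "X \<in> AR \<Longrightarrow> Y \<in> AR \<Longrightarrow> X + Y \<in> AR"

lemma AA_mult: "X \<in> AA \<Longrightarrow> Y \<in> AA \<Longrightarrow> X * Y \<in> AA"
  by (induction rule: AA.induct) (auto simp: distrib_right mult.assoc intro: AA.intros)

lemma AR_AA: "X \<in> AR \<Longrightarrow> X \<in> AA"
  by (induction rule: AR.induct) (auto intro: AA.intros)

lemma walg_rgen_AR: "X \<in> walg (range (\<lambda>(x, y). rgen x y)) \<Longrightarrow> X \<in> AR"
  by (induction rule: walg.induct) (auto simp: rgen_def distrib_right AR.intros)

end

context q_pair
begin

text \<open>q^N passes every creator or annihilator at the cost of a factor q or 1/q until it meets
  \<open>E\<close>. For q = 0 it has rank one.\<close>

lemma compact_op_dil_AA: "Y \<in> AA \<Longrightarrow> compact_op (dil q * Y * E)"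
proof (cases "q = 0")
  case True
  then show ?thesis by (simp add: dil_0 compact_op_right compact_op_rk)
next
  case False
  assume "Y \<in> AA"
  then show ?thesis
  proof induction
    case AA_one
    show ?case by (simp add: compact_op_dil_E)
  next
    case (AA_cr X x)
    have "dil q * (cr x * X) * E = of_real q *\<^sub>C (cr x * (dil q * X * E))"
      by (simp add: mult.assoc[symmetric] dil_cr)
    then show ?case by (simp only: compact_op_scaleC compact_op_left AA_cr)
  next
    case (AA_rc X x)
    have "dil q * (rc x * X) * E = of_real q *\<^sub>C (rc x * (dil q * X * E))"
      by (simp add: mult.assoc[symmetric] dil_rc)
    then show ?case by (simp only: compact_op_scaleC compact_op_left AA_rc)
  next
    case (AA_an X x)
    have "dil q * an x = of_real (1 / q) *\<^sub>C (an x * dil q)"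
      using False by (simp add: an_dil scaleC_scaleC)
    then have "dil q * (an x * X) * E = of_real (1 / q) *\<^sub>C (an x * (dil q * X * E))"
      by (simp add: mult.assoc[symmetric])
    then show ?case by (simp only: compact_op_scaleC compact_op_left AA_an)
  next
    case (AA_ra X x)
    have "dil q * ra x = of_real (1 / q) *\<^sub>C (ra x * dil q)"
      using False by (simp add: ra_dil scaleC_scaleC)
    then have "dil q * (ra x * X) * E = of_real (1 / q) *\<^sub>C (ra x * (dil q * X * E))"
      by (simp add: mult.assoc[symmetric])
    then show ?case by (simp only: compact_op_scaleC compact_op_left AA_ra)
  next
    case (AA_add X Y)
    then show ?case by (simp add: distrib_left distrib_right compact_op_add)
  next
    case (AA_scale X c)
    then show ?case by (simp add: compact_op_scaleC)
  qed
qed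

text \<open>Right creators commute with l(z), and a right annihilator leaves a multiple of q^N,
  which is compact in front of operators ending in \<open>E\<close>.\<close>

lemma compact_op_AR_commutator:
  "X \<in> AR \<Longrightarrow> Y \<in> AA \<Longrightarrow> compact_op ((X * cr z - cr z * X) * Y * E)"
proof (induction rule: AR.induct)
  case (AR_rc X x)
  have "(rc x * X * cr z - cr z * (rc x * X)) * Y * E = rc x * ((X * cr z - cr z * X) * Y * E)"
    by (simp add: mult.assoc[symmetric] cr_rc right_diff_distrib left_diff_distrib)
  then show ?case using compact_op_left AR_rc by metis
next
  case (AR_ra X x)
  have "ra x * X * cr z - cr z * (ra x * X) =
      ra x * (X * cr z - cr z * X) + (ra x * cr z - cr z * ra x) * X"
    by (simp add: mult.assoc right_diff_distrib left_diff_distrib)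
  also have "\<dots> = ra x * (X * cr z - cr z * X) + cinner x z *\<^sub>C (dil q * X)"
    by (simp add: ra_cr)
  finally have "(ra x * X * cr z - cr z * (ra x * X)) * Y * E =
      ra x * ((X * cr z - cr z * X) * Y * E) + cinner x z *\<^sub>C (dil q * (X * Y) * E)"
    by (simp add: distrib_right mult.assoc)
  then show ?case
    using AR_ra by (simp only: compact_op_add compact_op_left compact_op_scaleC compact_op_dil_AA AA_mult AR_AA)
next
  case (AR_add X X')
  have "((X + X') * cr z - cr z * (X + X')) * Y * E =
      (X * cr z - cr z * X) * Y * E + (X' * cr z - cr z * X') * Y * E"
    by (simp add: algebra_simps)
  then show ?case
    using AR_add by (simp only: compact_op_add)
qed simp

text \<open>Left creators in front of an operator that preserves \<open>F0\<close> and starts from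
  \<open>E\<close>. A left annihilator is pushed inward through the creators and disappears into
  that operator, so words of left generators times \<open>E\<close> all have this form.\<close>

inductive_set YY :: "'f bop set" where
  YY_base: "A \<in> AA \<Longrightarrow> A \<in> Inv \<Longrightarrow> A * E \<in> YY"
| YY_add: "X \<in> YY \<Longrightarrow> Y \<in> YY \<Longrightarrow> X + Y \<in> YY"
| YY_scale: "X \<in> YY \<Longrightarrow> c *\<^sub>C X \<in> YY"
| YY_cr: "X \<in> YY \<Longrightarrow> cr x * X \<in> YY"

lemma YY_AA: "Y \<in> YY \<Longrightarrow> \<exists>B\<in>AA. Y = B * E"
proof (induction rule: YY.induct)
  case (YY_add X Y)
  then obtain B B' where "B \<in> AA" "B' \<in> AA" "X = B * E" "Y = B' * E" by blast
  then show ?case by (intro bexI[of _ "B + B'"]) (auto simp: distrib_right intro: AA.intros)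
next
  case (YY_scale X c)
  then obtain B where "B \<in> AA" "X = B * E" by blast
  then show ?case by (intro bexI[of _ "c *\<^sub>C B"]) (auto intro: AA.intros)
next
  case (YY_cr X x)
  then obtain B where "B \<in> AA" "X = B * E" by blast
  then show ?case by (intro bexI[of _ "cr x * B"]) (auto simp: mult.assoc intro: AA.intros)
qed auto

lemma YY_an: "Y \<in> YY \<Longrightarrow> an y * Y \<in> YY"
proof (induction rule: YY.induct)
  case (YY_base A)
  have "(an y * A) * E \<in> YY"
    using YY_base by (intro YY.YY_base AA_an Inv_intros Inv_an)
  then show ?case by (simp add: mult.assoc)
next
  case (YY_add X Y)
  then show ?case by (simp add: distrib_left YY.YY_add)
next
  case (YY_scale X c)
  then show ?case by (simp add: YY.YY_scale)
next
  case (YY_cr X x)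
  have "an y * (cr x * X) = of_real q *\<^sub>C (cr x * (an y * X)) + cinner y x *\<^sub>C X"
    by (simp add: mult.assoc[symmetric] an_cr distrib_right)
  then show ?case using YY_cr by (simp add: YY.intros)
qed

lemma YY_lgen: "Y \<in> YY \<Longrightarrow> lgen x y * Y \<in> YY"
  by (simp add: lgen_def distrib_right YY.intros YY_an)

lemma YY_walg:
  assumes "X \<in> walg GL" "GL \<subseteq> range (\<lambda>(x, y). lgen x y)"
  shows "X * E \<in> YY"
  using assms(1)
proof induction
  case walg_one
  show ?case using YY_base[OF AA_one Inv_intros(1)] by simp
next
  case (walg_step x X)
  then obtain y z where "x = lgen y z" using assms(2) by auto
  then show ?case using YY_lgen[OF walg_step(3), of y z] by (simp add: mult.assoc)
qed

lemma an_E_zero: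
  assumes "cinner z e = 0" "cinner z e1 = 0"
  shows "an z * E = 0"
proof (rule bop_eqI)
  fix x
  have "app (an z) y = app 0 y" if "y \<in> F0" for y
  proof (rule app_eq_closure_cspan[OF _ that[unfolded F0_def]])
    fix s assume "s \<in> w ` lists {e, e1}"
    then obtain xs where xs: "s = w xs" "xs \<in> lists {e, e1}" by auto
    have "cinner z (xs ! k) = 0" if "k < length xs" for k
    proof -
      have "xs ! k = e \<or> xs ! k = e1" using xs(2) that nth_mem by auto
      then show ?thesis using assms by auto
    qed
    then show "app (an z) s = app 0 s"
      by (simp add: xs an_w anw_def)
  qed
  then show "app (an z * E) x = app 0 x" using E(1) by simp
qed

lemma E_cr_zero:
  assumes "cinner z e = 0" "cinner z e1 = 0"
  shows "E * cr z = 0"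
  using arg_cong[OF an_E_zero[OF assms], of star] by (simp add: star_mult E(4))

text \<open>Induction on the creators of Y. The letter z is split into z0 in the plane and z1
  orthogonal to it. Since \<open>E * cr z1 = 0\<close>, only the commutator of X with
  \<open>cr z1\<close> survives; \<open>cr z0\<close> commutes with \<open>E\<close> and is moved to
  the front modulo compact commutators, which leaves the induction hypothesis.\<close>

lemma compact_op_mixing: "Y \<in> YY \<Longrightarrow> X \<in> AR \<Longrightarrow> compact_op (E * X * (1 - E) * Y)"
proof (induction arbitrary: X rule: YY.induct)
  case (YY_base A)
  have "(1 - E) * (A * E) = 0"
    by (rule bop_eqI) (simp add: app_diff E InvD[OF YY_base(2)])
  then have "E * X * (1 - E) * (A * E) = 0" by (simp add: mult.assoc)
  then show ?case by simp
next
  case (YY_add Y Y')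
  then show ?case by (simp add: distrib_left compact_op_add)
next
  case (YY_scale Y c)
  then show ?case by (simp add: compact_op_scaleC)
next
  case (YY_cr Y z)
  obtain B where B: "B \<in> AA" "Y = B * E" using YY_AA YY_cr(1) by blast
  have comm: "compact_op ((X * cr x - cr x * X) * Y)" "compact_op ((X * cr x - cr x * X) * E * Y)" for x
    using compact_op_AR_commutator[OF YY_cr(3) B(1), of x]
      compact_op_right[OF compact_op_AR_commutator[OF YY_cr(3) AA_one, of x], of Y]
    by (simp_all add: B(2) mult.assoc)
  define c c1 where "c = cinner e z / cinner e e" and "c1 = cinner e1 z / cinner e1 e1"
  define z0 z1 where "z0 = c *\<^sub>C e + c1 *\<^sub>C e1" and "z1 = z - z0"
  have z: "cr z = cr z0 + cr z1"
    by (simp add: z1_def cr_add[symmetric])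
  have "cinner e z1 = 0" "cinner e1 z1 = 0"
    using nz orth orth' by (simp_all add: z1_def z0_def c_def c1_def cinner_simps)
  then have "cinner z1 e = 0" "cinner z1 e1 = 0"
    by (metis cinner_commute complex_cnj_zero)+
  then have Ez1: "E * cr z1 = 0" by (rule E_cr_zero)
  have "cr z0 \<in> Inv" unfolding z0_def cr_add cr_scaleC by (intro Inv_intros Inv_cr) auto
  then have Ez0: "cr z0 * E = E * cr z0" by (rule E_commute) (rule Inv_an)
  have "E * X * (1 - E) * (cr z1 * Y) = E * X * cr z1 * Y - E * X * (E * cr z1) * Y"
    by (simp add: algebra_simps)
  also have "\<dots> = E * X * cr z1 * Y" by (simp add: Ez1)
  also have "\<dots> = E * ((X * cr z1 - cr z1 * X) * Y) + (E * cr z1) * X * Y"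
    by (simp add: algebra_simps)
  also have "\<dots> = E * ((X * cr z1 - cr z1 * X) * Y)" by (simp add: Ez1)
  finally have 1: "compact_op (E * X * (1 - E) * (cr z1 * Y))"
    by (simp only: compact_op_left comm)
  have "E * X * (1 - E) * (cr z0 * Y) = E * X * cr z0 * Y - E * X * (E * cr z0) * Y"
    by (simp add: algebra_simps)
  also have "\<dots> = E * X * cr z0 * Y - E * X * (cr z0 * E) * Y"
    by (simp only: Ez0)
  also have "\<dots> = E * ((X * cr z0 - cr z0 * X) * Y) - E * ((X * cr z0 - cr z0 * X) * E * Y)
      + ((E * cr z0) * X * Y - (E * cr z0) * X * E * Y)"
    by (simp add: algebra_simps)
  also have "(E * cr z0) * X * Y - (E * cr z0) * X * E * Y = cr z0 * (E * X * (1 - E) * Y)"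
    unfolding Ez0[symmetric] by (simp add: algebra_simps)
  finally have 2: "compact_op (E * X * (1 - E) * (cr z0 * Y))"
    by (simp only: compact_op_add compact_op_diff compact_op_left comm YY_cr(2)[OF YY_cr(3)])
  show ?case
    using compact_op_add[OF 2 1] by (simp add: z distrib_left distrib_right)
qed

text \<open>For a rank-one operator the term factors through <a u_m, p>, and p may be replaced by
  its projection to \<open>F0\<close>, where \<open>average_weakly_null\<close> applies.\<close>

lemma average_null_compact_op:
  assumes "compact_op Y"
  shows "average_null (\<lambda>m. cinner (app a (u m)) (app Y (u m)))"
proof (rule average_null_approx)
  fix r :: real assume "r > 0"
  obtain Ka where Ka: "Ka > 0" "\<And>x. norm (app a x) \<le> Ka * norm x" using app_bounded by blast
  have au: "norm (app a (u m)) \<le> Ka * 2" for m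
    by (rule order_trans[OF Ka(2)]) (use norm_u[of m] Ka(1) in simp)
  define d where "d = r / (Ka * 2) / 2"
  have "d > 0" using \<open>r > 0\<close> Ka by (simp add: d_def)
  then obtain l where l: "\<And>x. norm (app (Y - (\<Sum>(p, s)\<leftarrow>l. rk p s)) x) \<le> d * norm x"
    using assms unfolding compact_op_def by blast
  have "average_null (\<lambda>m. cinner (app a (u m)) (app (\<Sum>(p, s)\<leftarrow>l. rk p s) (u m)))" for l
  proof (induction l)
    case (Cons ps l)
    obtain p s where ps: "ps = (p, s)" by (cases ps)
    have "average_null (\<lambda>m. cinner (app a (u m)) (cinner s (u m) *\<^sub>C p))"
    proof (rule average_null_sq_le)
      show "average_null (\<lambda>m. of_real ((cmod (cinner (app E p) (app a (u m))))\<^sup>2))"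
        by (rule average_weakly_null) (rule E)
      fix m
      have "app a (u m) \<in> F0" by (intro InvD[OF Inv_gen(1)] u_F0)
      then have "cinner (app a (u m)) p = cinner (app a (u m)) (app E p)"
        using E(3)[of "app a (u m)" p] by (simp add: cinner_diff_right)
      then have "cmod (cinner (app a (u m)) p) = cmod (cinner (app E p) (app a (u m)))"
        by (metis cinner_commute complex_mod_cnj)
      moreover have "cmod (cinner s (u m)) \<le> norm s * 2"
        using order_trans[OF cinner_cauchy_schwarz mult_left_mono[OF norm_u norm_ge_zero]] by blast
      ultimately show "cmod (cinner (app a (u m)) (cinner s (u m) *\<^sub>C p)) \<le>
          (norm s * 2) * cmod (cinner (app E p) (app a (u m)))"
        by (simp add: cinner_scaleC_right norm_mult mult_right_mono)
    qed
    from average_null_add[OF this Cons] show ?case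
      by (simp add: ps app_add cinner_add_right)
  qed (simp add: cinner_zero_right)
  moreover have "cmod (cinner (app a (u m)) (app Y (u m)) - cinner (app a (u m)) (app (\<Sum>(p, s)\<leftarrow>l. rk p s) (u m))) \<le> r" for m
  proof -
    have "cmod (cinner (app a (u m)) (app (Y - (\<Sum>(p, s)\<leftarrow>l. rk p s)) (u m))) \<le>
        norm (app a (u m)) * norm (app (Y - (\<Sum>(p, s)\<leftarrow>l. rk p s)) (u m))"
      by (rule cinner_cauchy_schwarz)
    also have "\<dots> \<le> (Ka * 2) * (d * 2)"
      using au \<open>d > 0\<close> Ka(1) norm_u[of m] by (intro mult_mono order_trans[OF l]) auto
    also have "\<dots> = r" using Ka(1) by (simp add: d_def)
    finally show ?thesis by (simp add: app_diff cinner_diff_right)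
  qed
  ultimately show "\<exists>s1. average_null s1 \<and> (\<forall>m. cmod (cinner (app a (u m)) (app Y (u m)) - s1 m) \<le> r)"
    by blast
qed

lemma E_commute_gen: "a * E = E * a" "h * E = E * h" "k * E = E * k" "g * E = E * g" "g' * E = E * g'"
proof -
  show a: "a * E = E * a" by (rule E_commute) (rule Inv_gen)+
  show h: "h * E = E * h" by (rule E_commute) (simp_all add: star_h Inv_h)
  show k: "k * E = E * k" by (rule E_commute) (simp_all add: star_k Inv_h)
  show "g * E = E * g" by (simp add: g_def h)
  show "g' * E = E * g'" by (simp add: g'_def k)
qed

text \<open>Let P = 1 - E, let X be a right word and Z a left word. Commuting X past a and functions
  of h, and Z past functions of k, turns <a T_m(g) P X Omega, a T_m(g') P Z Omega> into <a u_m, Y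
  u_m> with the fixed operator \<open>E * star X * P * (a * Z * E)\<close> as Y, which is compact by
  mixing. By density the average then also vanishes with v in both slots.\<close>

theorem off_F0_kernel:
  assumes GL: "GL \<subseteq> range (\<lambda>(x, y). lgen x y)" "a \<in> GL" "\<And>X. X \<in> GL \<Longrightarrow> k * X = X * k"
    and GR: "GR \<subseteq> range (\<lambda>(x, y). rgen x y)" "\<And>X. X \<in> GR \<Longrightarrow> a * X = X * a" "\<And>X. X \<in> GR \<Longrightarrow> h * X = X * h"
    and dense: "closure (cspan ((\<lambda>X. app X \<Omega>) ` walg GL)) = UNIV" "closure (cspan ((\<lambda>X. app X \<Omega>) ` walg GR)) = UNIV"
    and v: "app h v = app k v"
  shows "app a (v - app E v) = 0"
proof -
  define P where "P = 1 - E"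
  have P: "app P x = x - app E x" for x by (simp add: P_def app_diff)
  have P_star: "star P = P" by (simp add: P_def star_diff E)
  have P_P: "P * P = P" by (simp add: P_def algebra_simps E_E)
  have P_comm: "a * P = P * a" "g * P = P * g" "g' * P = P * g'" "h * P = P * h" "k * P = P * k"
    by (simp_all add: P_def algebra_simps E_commute_gen)
  have P_le: "norm (app P x) \<le> 2 * norm x" for x
    unfolding P using norm_triangle_ineq4[of x "app E x"] E(5)[of x] by linarith
  obtain Ka where Ka: "Ka > 0" "\<And>x. norm (app a x) \<le> Ka * norm x" using app_bounded by blast
  let ?T = "\<lambda>m. a * cheb g m * P" and ?T' = "\<lambda>m. a * cheb g' m * P"
  define C where "C = Ka * (2 * 2)"
  have C: "C > 0" using Ka by (simp add: C_def)
  have T: "norm (app (?T m) x) \<le> C * norm x" "norm (app (?T' m) x) \<le> C * norm x" for m x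
  proof -
    have "norm (app (cheb g m) (app P x)) \<le> 2 * (2 * norm x)" "norm (app (cheb g' m) (app P x)) \<le> 2 * (2 * norm x)"
      using order_trans[OF g.cheb_upper] order_trans[OF g'.cheb_upper] P_le by (meson mult_left_mono zero_le_numeral)+
    then show "norm (app (?T m) x) \<le> C * norm x" "norm (app (?T' m) x) \<le> C * norm x"
      using order_trans[OF Ka(2) mult_left_mono] Ka(1) by (simp_all add: C_def mult.assoc)
  qed
  have base: "average_null (\<lambda>m. cinner (app (?T m) (app X \<Omega>)) (app (?T' m) (app Z \<Omega>)))"
    if X: "X \<in> walg GR" and Z: "Z \<in> walg GL" for X Z
  proof -
    have aX: "a * X = X * a" by (rule walg_commute[OF X GR(2)])
    have "h * X = X * h" by (rule walg_commute[OF X GR(3)])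
    then have gX: "X * cheb g m = cheb g m * X" for m
      by (intro cheb_commute) (simp add: g_def)
    have "k * Z = Z * k" by (rule walg_commute[OF Z GL(3)])
    then have gZ: "Z * cheb g' m = cheb g' m * Z" for m
      by (intro cheb_commute) (simp add: g'_def)
    have Pg: "P * cheb g m = cheb g m * P" "P * cheb g' m = cheb g' m * P" for m
      by (rule cheb_commute, simp add: P_comm)+
    have 1: "?T m * X = P * X * a * cheb g m" for m
    proof -
      have "?T m * X = a * (cheb g m * P) * X" by (simp only: mult.assoc)
      also have "\<dots> = (a * P) * (cheb g m * X)" by (simp only: Pg[symmetric] mult.assoc)
      also have "\<dots> = P * (a * X) * cheb g m" by (simp only: P_comm gX[symmetric] mult.assoc)
      finally show ?thesis by (simp only: aX mult.assoc)
    qed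
    have 2: "?T' m * Z = P * (a * Z) * cheb g' m" for m
    proof -
      have "?T' m * Z = a * (cheb g' m * P) * Z" by (simp only: mult.assoc)
      also have "\<dots> = (a * P) * (cheb g' m * Z)" by (simp only: Pg[symmetric] mult.assoc)
      finally show ?thesis by (simp only: P_comm gZ[symmetric] mult.assoc)
    qed
    have starX: "star X \<in> AR"
    proof (rule walg_rgen_AR)
      have "X \<in> walg (range (\<lambda>(x, y). rgen x y))"
        using X by (induction) (use GR(1) in \<open>auto intro: walg.intros\<close>)
      then show "star X \<in> walg (range (\<lambda>(x, y). rgen x y))"
      proof (rule walg_star)
        fix z assume "z \<in> range (\<lambda>(x, y). rgen x y)"
        then obtain x y where "star z = (\<lambda>(x, y). rgen x y) (y, x)" by (auto simp: star_rgen)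
        then show "star z \<in> range (\<lambda>(x, y). rgen x y)" by (simp only: rangeI)
      qed
    qed
    have Y: "compact_op (E * star X * P * (a * Z * E))"
      unfolding P_def by (rule compact_op_mixing[OF YY_walg[OF _ GL(1)] starX]) (rule walg_step[OF GL(2) Z])
    have eq: "cinner (app (?T m) (app X \<Omega>)) (app (?T' m) (app Z \<Omega>)) =
        cinner (app a (u m)) (app (E * star X * P * (a * Z * E)) (u m))" for m
    proof -
      have "app (?T m) (app X \<Omega>) = app P (app X (app a (u m)))"
        using arg_cong[OF 1[of m], of "\<lambda>A. app A \<Omega>"] by (simp add: u_def)
      moreover have "app (?T' m) (app Z \<Omega>) = app P (app (a * Z) (u m))"
        using arg_cong[OF 2[of m], of "\<lambda>A. app A \<Omega>"] by (simp add: u_alt)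
      moreover have "cinner (app P x) (app P y) = cinner x (app P y)" for x y
        using P_star P_P by (metis app_mult cinner_star_left)
      moreover have "cinner (app X x) y = cinner x (app (star X) y)" for x y
        by (simp add: cinner_star_right)
      moreover have "cinner (app a (u m)) y = cinner (app a (u m)) (app E y)" for y
        using E(3)[of "app a (u m)" y] InvD[OF Inv_gen(1) u_F0] by (simp add: cinner_diff_right)
      moreover have "app E (u m) = u m" by (rule E(2)[OF u_F0])
      ultimately show ?thesis by simp
    qed
    show ?thesis unfolding eq by (rule average_null_compact_op[OF Y])
  qed
  have fin: "average_null (\<lambda>m. cinner (app (?T m) x) (app (?T' m) y))"
    if x: "x \<in> cspan ((\<lambda>X. app X \<Omega>) ` walg GR)" and y: "y \<in> cspan ((\<lambda>X. app X \<Omega>) ` walg GL)" for x y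
  proof -
    have *: "average_null (\<lambda>m. cinner (app (?T m) x) (app (?T' m) y))" if x: "x \<in> (\<lambda>X. app X \<Omega>) ` walg GR" for x
    proof -
      have "csubspace {y. average_null (\<lambda>m. cinner (app (?T m) x) (app (?T' m) y))}"
        by (auto simp: csubspace_def app_add_right app_scaleC_right cinner_simps simp del: app_mult intro!: average_null_add average_null_cmult)
      then show ?thesis
        using cspan_minimal[of "{y. average_null (\<lambda>m. cinner (app (?T m) x) (app (?T' m) y))}" "(\<lambda>X. app X \<Omega>) ` walg GL"] base x y
        by blast
    qed
    have "csubspace {x. average_null (\<lambda>m. cinner (app (?T m) x) (app (?T' m) y))}"
      by (auto simp: csubspace_def app_add_right app_scaleC_right cinner_simps simp del: app_mult intro!: average_null_add average_null_cmult)
    then show ?thesis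
      using cspan_minimal[of "{x. average_null (\<lambda>m. cinner (app (?T m) x) (app (?T' m) y))}" "(\<lambda>X. app X \<Omega>) ` walg GR"] * x
      by blast
  qed
  \<comment> \<open>Here h v = k v enters: the two Chebyshev orbits of P v coincide, so the limit
    concerns a mean of squared norms.\<close>
  have Tv: "app (?T m) v = app (?T' m) v" for m
  proof -
    have "app g (app P v) = app g' (app P v)"
    proof -
      have "app h (app P v) = app P (app h v)" "app k (app P v) = app P (app k v)"
        using P_comm(4,5) by (metis app_mult)+
      then show ?thesis using v by (simp add: g_def g'_def app_scaleC)
    qed
    moreover have "g * g' = g' * g" by (simp add: g_def g'_def h_k)
    ultimately have "app (cheb g m) (app P v) = app (cheb g' m) (app P v)" by (rule cheb_agree)
    then show ?thesis by simp
  qed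
  have "average_null (\<lambda>m. cinner (app (?T m) v) (app (?T' m) v))"
  proof (rule average_null_approx)
    fix r :: real assume "r > 0"
    define B where "B = C * C * (2 * norm v + 1)"
    have "B > 0" using C by (simp add: B_def add_nonneg_pos)
    \<comment> \<open>If x and y are within d <= 1 of v, the error is at most C^2 d |v| + C^2 (|v| +
      1) d = d B.\<close>
    define d where "d = min 1 (r / B)"
    have d: "d > 0" "d \<le> 1" "d * B \<le> r"
      using \<open>r > 0\<close> \<open>B > 0\<close> by (auto simp: d_def min_def field_simps)
    obtain x where x: "x \<in> cspan ((\<lambda>X. app X \<Omega>) ` walg GR)" "dist x v < d"
      using dense(2) d(1) by (metis UNIV_I closure_approachable)
    obtain y where y: "y \<in> cspan ((\<lambda>X. app X \<Omega>) ` walg GL)" "dist y v < d"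
      using dense(1) d(1) by (metis UNIV_I closure_approachable)
    have "cmod (cinner (app (?T m) v) (app (?T' m) v) - cinner (app (?T m) x) (app (?T' m) y)) \<le> r" for m
    proof -
      have nx: "norm (v - x) \<le> d" "norm (v - y) \<le> d"
        using x(2) y(2) by (simp_all add: dist_norm norm_minus_commute)
      have "norm x \<le> norm v + d"
        using nx(1) norm_triangle_sub[of x v] by (simp add: norm_minus_commute)
      then have nx': "norm x \<le> norm v + 1" using d(2) by linarith
      have "cinner (app (?T m) v) (app (?T' m) v) - cinner (app (?T m) x) (app (?T' m) y) =
        cinner (app (?T m) (v - x)) (app (?T' m) v) + cinner (app (?T m) x) (app (?T' m) (v - y))"
        by (simp only: app_diff_right cinner_diff_left cinner_diff_right) simp
      also have "cmod \<dots> \<le> (C * d) * (C * norm v) + (C * (norm v + 1)) * (C * d)"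
      proof (intro norm_triangle_le add_mono order_trans[OF cinner_cauchy_schwarz] mult_mono)
        show "norm (app (?T m) (v - x)) \<le> C * d" "norm (app (?T' m) v) \<le> C * norm v"
          "norm (app (?T m) x) \<le> C * (norm v + 1)" "norm (app (?T' m) (v - y)) \<le> C * d"
          using C nx nx' by (auto simp del: app_mult intro!: order_trans[OF T(1)] order_trans[OF T(2)] mult_left_mono)
      qed (use C d in \<open>auto simp del: app_mult\<close>)
      also have "\<dots> = d * B" by (simp add: B_def algebra_simps)
      finally show ?thesis using d(3) by linarith
    qed
    then show "\<exists>s1. average_null s1 \<and> (\<forall>m. cmod (cinner (app (?T m) v) (app (?T' m) v) - s1 m) \<le> r)"
      using fin[OF x(1) y(1)] by blast
  qed
  then have null: "average_null (\<lambda>m. cinner (app (?T m) v) (app (?T m) v))"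
    by (simp only: Tv)
  \<comment> \<open>The relation a h = a (\<open>star a\<close> a) lets the polynomial move to the
    left of a as a polynomial in \<open>gg\<close>; the orbit of a P v cannot be null unless a P v =
    0.\<close>
  define gg where "gg = of_real (1 / scal) *\<^sub>C (a * star a)"
  interpret gg: half_contraction gg
  proof
    show "star gg = gg" by (simp add: gg_def star_scaleC star_mult)
    show "norm (app gg x) \<le> norm x / 2" for x
      using scal(1) scal(4)[of x] by (simp add: gg_def app_simps norm_scaleC norm_divide field_simps)
  qed
  have "a * g = gg * a"
    by (simp add: g_def gg_def h_def mult.assoc)
  then have "a * cheb g m = cheb gg m * a" for m by (rule cheb_intertwine)
  then have "app (?T m) v = app (cheb gg m) (app a (app P v))" for m
    by (metis app_mult)
  then have "average_null (\<lambda>m. of_real ((norm (app (cheb gg m) (app a (app P v))))\<^sup>2))"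
    using null by (simp only: cinner_self)
  then have "app a (app P v) = 0" by (rule gg.cheb_average_null_imp_zero)
  then show ?thesis by (simp add: P)
qed

end

section \<open>Operators commuting with the left and the right generators\<close>

context q_fock
begin

text \<open>The letters whose creator preserves the closed span form a subspace, and it is closed
  because the norm of the creator is controlled by that of the letter. It contains L, hence every
  letter.\<close>

lemma dense_words:
  assumes "closure (cspan L) = UNIV"
  shows "closure (cspan (w ` lists L)) = UNIV"
proof -
  let ?W = "closure (cspan (w ` lists L))"
  have W: "csubspace ?W" "closed ?W" by (simp_all add: csubspace_closure csubspace_cspan)
  define D where "D = {x. \<forall>v\<in>?W. app (cr x) v \<in> ?W}"
  have D: "csubspace D"
    by (auto simp: csubspace_def D_def cr_add cr_scaleC app_simps csubspaceD[OF W(1)])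
  have "closed D"
    unfolding closed_sequential_limits
  proof (intro allI impI)
    fix f x assume f: "(\<forall>n. f n \<in> D) \<and> f \<longlonglongrightarrow> x"
    have "app (cr x) v \<in> ?W" if v: "v \<in> ?W" for v
    proof (rule closed_sequentially[OF W(2)])
      show "app (cr (f n)) v \<in> ?W" for n using f v by (simp add: D_def)
      have "(\<lambda>n. f n - x) \<longlonglongrightarrow> x - x" using f by (intro tendsto_intros) auto
      then have lim0: "(\<lambda>n. norm (f n - x) / sqrt (1 - \<bar>q\<bar>) * norm v) \<longlonglongrightarrow> 0"
        by (intro tendsto_mult_left_zero tendsto_divide_zero) (simp add: tendsto_norm_zero_iff)
      have le: "norm (app (cr (f n)) v - app (cr x) v) \<le> norm (f n - x) / sqrt (1 - \<bar>q\<bar>) * norm v" for n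
      proof -
        have "cr (f n) = cr (f n - x) + cr x" by (simp add: cr_add[symmetric])
        then have "app (cr (f n)) v - app (cr x) v = app (cr (f n - x)) v" by (simp add: app_add)
        then show ?thesis by (simp only: norm_cr)
      qed
      have "(\<lambda>n. norm (app (cr (f n)) v - app (cr x) v)) \<longlonglongrightarrow> 0"
        by (rule tendsto_sandwich[OF _ _ tendsto_const lim0])
          (rule always_eventually, rule allI, rule norm_ge_zero, rule always_eventually, rule allI, rule le)
      then show "(\<lambda>n. app (cr (f n)) v) \<longlonglongrightarrow> app (cr x) v"
        using LIM_zero_cancel tendsto_norm_zero_iff by blast
    qed
    then show "x \<in> D" by (simp add: D_def)
  qed
  have "L \<subseteq> D"
  proof
    fix x assume x: "x \<in> L"
    have "app (cr x) v \<in> ?W" if "v \<in> ?W" for v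
    proof (rule app_closure_cspan[OF _ W that])
      fix s assume "s \<in> w ` lists L"
      then obtain xs where xs: "s = w xs" "xs \<in> lists L" by blast
      then have "w (x # xs) \<in> cspan (w ` lists L)" using x by (intro cspan_base imageI) auto
      then show "app (cr x) s \<in> ?W" using closure_subset by (auto simp: xs(1) cr_w)
    qed
    then show "x \<in> D" by (simp add: D_def)
  qed
  then have DU: "D = UNIV" using closure_cspan_minimal[OF D \<open>closed D\<close>] assms by blast
  have "w xs \<in> ?W" for xs
  proof (induction xs)
    case Nil
    have "w [] \<in> cspan (w ` lists L)" by (intro cspan_base imageI) auto
    then show ?case using closure_subset by blast
  next
    case (Cons x xs)
    then show ?case using DU cr_w[of x xs] unfolding D_def by (metis (mono_tags) UNIV_I mem_Collect_eq)
  qed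
  then have "closure (cspan (range w)) \<subseteq> ?W"
    by (intro closure_cspan_minimal W) auto
  then show ?thesis using dense_w by auto
qed

lemma dense_lgen:
  assumes "closure (cspan (fst ` Lp)) = UNIV"
  shows "closure (cspan ((\<lambda>X. app X \<Omega>) ` walg ((\<lambda>(x, y). lgen x y) ` Lp))) = UNIV" (is "closure (cspan ?S) = _")
proof -
  let ?V = "closure (cspan ?S)"
  have V: "csubspace ?V" "closed ?V" by (simp_all add: csubspace_closure csubspace_cspan)
  have in_V: "s \<in> ?S \<Longrightarrow> s \<in> ?V" for s by (rule subsetD[OF closure_subset]) (rule cspan_base)
  have "w xs \<in> ?V" if "xs \<in> lists (fst ` Lp)" for xs
  proof (rule words_in_left[OF V(1) _ _ that])
    show "\<Omega> \<in> ?V" by (rule in_V, rule image_eqI[of _ _ 1]) (auto intro: walg_one)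
    fix x assume "x \<in> fst ` Lp"
    then obtain y where y: "(x, y) \<in> Lp" by auto
    have "app (lgen x y) v \<in> ?V" if "v \<in> ?V" for v
    proof (rule app_closure_cspan[OF _ V that])
      fix s assume "s \<in> ?S"
      then obtain X where "s = app X \<Omega>" "X \<in> walg ((\<lambda>(x, y). lgen x y) ` Lp)" by blast
      then show "app (lgen x y) s \<in> ?V"
        using y by (intro in_V image_eqI[of _ _ "lgen x y * X"]) (auto intro!: walg_step)
    qed
    then show "\<exists>y. \<forall>v\<in>?V. app (lgen x y) v \<in> ?V" by blast
  qed
  then have "closure (cspan (w ` lists (fst ` Lp))) \<subseteq> ?V"
    by (intro closure_cspan_minimal V) auto
  then show ?thesis using dense_words[OF assms] by auto
qed

lemma dense_rgen:
  assumes "closure (cspan (fst ` Rp)) = UNIV"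
  shows "closure (cspan ((\<lambda>X. app X \<Omega>) ` walg ((\<lambda>(x, y). rgen x y) ` Rp))) = UNIV" (is "closure (cspan ?S) = _")
proof -
  let ?V = "closure (cspan ?S)"
  have V: "csubspace ?V" "closed ?V" by (simp_all add: csubspace_closure csubspace_cspan)
  have in_V: "s \<in> ?S \<Longrightarrow> s \<in> ?V" for s by (rule subsetD[OF closure_subset]) (rule cspan_base)
  have "w xs \<in> ?V" if "xs \<in> lists (fst ` Rp)" for xs
  proof (rule words_in_right[OF V(1) _ _ that])
    show "\<Omega> \<in> ?V" by (rule in_V, rule image_eqI[of _ _ 1]) (auto intro: walg_one)
    fix x assume "x \<in> fst ` Rp"
    then obtain y where y: "(x, y) \<in> Rp" by auto
    have "app (rgen x y) v \<in> ?V" if "v \<in> ?V" for v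
    proof (rule app_closure_cspan[OF _ V that])
      fix s assume "s \<in> ?S"
      then obtain X where "s = app X \<Omega>" "X \<in> walg ((\<lambda>(x, y). rgen x y) ` Rp)" by blast
      then show "app (rgen x y) s \<in> ?V"
        using y by (intro in_V image_eqI[of _ _ "rgen x y * X"]) (auto intro!: walg_step)
    qed
    then show "\<exists>y. \<forall>v\<in>?V. app (rgen x y) v \<in> ?V" by blast
  qed
  then have "closure (cspan (w ` lists (fst ` Rp))) \<subseteq> ?V"
    by (intro closure_cspan_minimal V) auto
  then show ?thesis using dense_words[OF assms] by auto
qed

lemma norm_an_le: "norm (app (an x) y) \<le> norm x / sqrt (1 - \<bar>q\<bar>) * norm y"
proof -
  have "complex_of_real ((norm (app (an x) y))\<^sup>2) = cinner y (app (cr x) (app (an x) y))"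
    using cinner_star_left[of "cr x" y "app (an x) y"] by (simp only: cinner_self)
  then have "(norm (app (an x) y))\<^sup>2 \<le> norm y * norm (app (cr x) (app (an x) y))"
    using cinner_cauchy_schwarz[of y "app (cr x) (app (an x) y)"] by (metis norm_of_real abs_power2)
  also have "\<dots> \<le> norm y * (norm x / sqrt (1 - \<bar>q\<bar>) * norm (app (an x) y))"
    by (intro mult_left_mono norm_cr) auto
  finally have "norm (app (an x) y) * norm (app (an x) y) \<le> norm (app (an x) y) * (norm x / sqrt (1 - \<bar>q\<bar>) * norm y)"
    by (simp add: power2_eq_square mult_ac)
  moreover have "0 \<le> norm x / sqrt (1 - \<bar>q\<bar>) * norm y"
    using abs_q_less by (intro mult_nonneg_nonneg divide_nonneg_nonneg) auto
  moreover have "n \<le> c" if "n * n \<le> n * c" "0 \<le> c" "0 \<le> n" for n c :: real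
    using that by (cases "n = 0") auto
  ultimately show ?thesis
    using norm_ge_zero by blast
qed

text \<open>For q different from 0, |e|^2 q^N is the commutator of r(e)^* with
  \<open>lgen e e1\<close>, and the two kernel conditions annihilate both of its terms. For q = 0
  this detects the vacuum component only; instead |l(e) v| = |e| |v| is compared with |l(e1)^* v| <=
  |e1| |v|.\<close>

lemma kernel_lgen_zero:
  assumes "app (lgen e e1) v = 0" "app (lgen e1 e) v = 0" and orth: "cinner e e1 = 0" and lt: "norm e1 < norm e"
  shows "v = 0"
proof (cases "q = 0")
  case True
  have "app (cr e) v = - app (an e1) v"
    using assms(1) by (simp add: lgen_def app_add eq_neg_iff_add_eq_0)
  then have "norm (app (cr e) v) \<le> norm e1 * norm v"
    using norm_an_le[of e1 v] by (simp add: True)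
  moreover have "complex_of_real ((norm (app (cr e) v))\<^sup>2) = of_real ((norm e * norm v)\<^sup>2)"
  proof -
    have "complex_of_real ((norm (app (cr e) v))\<^sup>2) = cinner v (app (an e * cr e) v)"
      using cinner_star_right[of v "cr e" "app (cr e) v"] by (simp only: cinner_self app_mult)
    moreover have "complex_of_real q = 0" using True by simp
    then have "an e * cr e = cinner e e *\<^sub>C 1" unfolding an_cr by simp
    ultimately show ?thesis
      by (simp add: app_simps cinner_simps cinner_self power_mult_distrib del: app_mult)
  qed
  then have "(norm (app (cr e) v))\<^sup>2 = (norm e * norm v)\<^sup>2"
    using of_real_eq_iff by blast
  then have "norm (app (cr e) v) = norm e * norm v"
    by (simp add: power2_eq_iff_nonneg)
  ultimately show ?thesis
    using lt by (metis mult_right_le_imp_le not_less norm_le_zero_iff not_le)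
next
  case False
  \<comment> \<open>For q < 0 this brings in the parity operator, which preserves the kernel of the
    odd operator \<open>lgen e e1\<close> and turns q^N into the positive operator |q|^N.\<close>
  define \<sigma> where "\<sigma> = sgn q"
  have \<sigma>: "\<bar>\<sigma>\<bar> \<le> 1" "\<sigma> * \<sigma> = 1" "q * \<sigma> = \<bar>q\<bar>"
    using False by (auto simp: \<sigma>_def sgn_if)
  have s2: "of_real \<sigma> *\<^sub>C of_real \<sigma> *\<^sub>C x = x" for x :: 'f
    using \<sigma>(2) by (simp add: scaleC_scaleC flip: of_real_mult)
  define y where "y = app (dil \<sigma>) v"
  have "app (cr e) y = of_real \<sigma> *\<^sub>C app (dil \<sigma>) (app (cr e) v)"
    using arg_cong[OF dil_cr[OF \<sigma>(1), of e], of "\<lambda>X. app X v"] by (simp add: app_scaleC y_def s2)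
  moreover have "app (an e1) y = of_real \<sigma> *\<^sub>C app (dil \<sigma>) (app (an e1) v)"
    using arg_cong[OF an_dil[OF \<sigma>(1), of e1], of "\<lambda>X. app X v"] by (simp add: app_scaleC y_def)
  ultimately have "app (lgen e e1) y = of_real \<sigma> *\<^sub>C app (dil \<sigma>) (app (lgen e e1) v)"
    by (simp add: lgen_def app_add app_add_right scaleC_add_right)
  then have ay: "app (lgen e e1) y = 0" by (simp add: assms)
  have "cinner e e *\<^sub>C dil q = ra e * lgen e e1 - lgen e e1 * ra e"
    by (simp add: ra_lgen)
  then have "cinner v (app (cinner e e *\<^sub>C dil q) y) = cinner v (app (ra e * lgen e e1 - lgen e e1 * ra e) y)"
    by simp
  also have "\<dots> = - cinner v (app (lgen e e1) (app (ra e) y))"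
    by (simp add: app_diff ay cinner_minus_right)
  also have "\<dots> = - cinner (app (lgen e1 e) v) (app (ra e) y)"
    using cinner_star_left[of "lgen e e1" v "app (ra e) y"] by (simp only: star_lgen)
  also have "\<dots> = 0" by (simp add: assms)
  finally have "cinner v (app (dil q) y) = 0"
    using lt by (auto simp: app_scaleC cinner_scaleC_right)
  moreover have "app (dil q) y = app (dil \<bar>q\<bar>) v"
    unfolding y_def app_mult[symmetric] by (simp add: dil_dil \<sigma>)
  moreover have "dil \<bar>q\<bar> = dil (sqrt \<bar>q\<bar>) * dil (sqrt \<bar>q\<bar>)"
    by (subst dil_dil) (auto simp: abs_q)
  ultimately have "cinner v (app (dil (sqrt \<bar>q\<bar>)) (app (dil (sqrt \<bar>q\<bar>)) v)) = 0" by simp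
  then have "cinner (app (dil (sqrt \<bar>q\<bar>)) v) (app (dil (sqrt \<bar>q\<bar>)) v) = 0"
    using star_dil[of "sqrt \<bar>q\<bar>"] by (metis abs_q abs_ge_zero abs_of_nonneg cinner_star_left real_sqrt_ge_zero real_sqrt_le_1_iff)
  then have "app (dil (sqrt \<bar>q\<bar>)) v = 0" by simp
  then show ?thesis
    using dil_injective[of "sqrt \<bar>q\<bar>" v] False by simp
qed

text \<open>On the orthogonal complement of the vacuum q^N has norm at most |q| < 1.\<close>

lemma vacuum_of_dil_fixed:
  assumes "cinner v (app (dil q) v) = cinner v v"
  shows "v = cinner \<Omega> v *\<^sub>C \<Omega>"
proof -
  define v' where "v' = v - cinner \<Omega> v *\<^sub>C \<Omega>"
  have O: "cinner \<Omega> v' = 0" by (simp add: v'_def cinner_simps norm_w_Nil)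
  then have O': "cinner v' \<Omega> = 0" by (metis cinner_commute complex_cnj_zero)
  have v: "v = v' + cinner \<Omega> v *\<^sub>C \<Omega>" by (simp add: v'_def)
  have Od: "cinner \<Omega> (app (dil q) v') = 0"
    using cinner_star_left[of "dil q" \<Omega> v'] by (simp add: star_dil O)
  have "norm (app (dil q) v') \<le> \<bar>q\<bar> ^ 1 * norm v'"
    by (rule norm_dil_high[of q v' UNIV 1]) (simp_all add: dense_w lists_UNIV O)
  then have le: "norm v' * norm (app (dil q) v') \<le> \<bar>q\<bar> * (norm v')\<^sup>2"
    using mult_left_mono[of _ _ "norm v'"] by (fastforce simp: power2_eq_square mult_ac)
  have "cinner (v' + c *\<^sub>C \<Omega>) (app (dil q) (v' + c *\<^sub>C \<Omega>)) - cinner (v' + c *\<^sub>C \<Omega>) (v' + c *\<^sub>C \<Omega>) =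
      cinner v' (app (dil q) v') - cinner v' v'" for c
    by (simp add: app_add_right app_scaleC_right cinner_simps O O' Od)
  then have "cinner v' (app (dil q) v') = cinner v' v'"
    using assms v by (metis eq_iff_diff_eq_0)
  then have "(norm v')\<^sup>2 = cmod (cinner v' (app (dil q) v'))"
    by (simp add: cinner_self norm_power)
  also have "\<dots> \<le> \<bar>q\<bar> * (norm v')\<^sup>2"
    by (rule order_trans[OF cinner_cauchy_schwarz le])
  finally have "(1 - \<bar>q\<bar>) * (norm v')\<^sup>2 \<le> 0" by (simp add: algebra_simps)
  then have "v' = 0"
    using abs_q_less by (simp add: mult_le_0_iff)
  then show ?thesis using v by simp
qed

end

context q_pair
begin

lemma kernel_of_central:
  assumes compat: "\<And>x x' y y'. (x, x') \<in> Lp \<Longrightarrow> (y, y') \<in> Rp \<Longrightarrow> cinner x' y = cinner y' x"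
    and dense: "closure (cspan (fst ` Lp)) = UNIV" "closure (cspan (fst ` Rp)) = UNIV"
    and e: "(e, e1) \<in> Lp" "(e1, e) \<in> Lp" "(e, of_real mu *\<^sub>C e1) \<in> Rp" "(e1, of_real (1 / mu) *\<^sub>C e) \<in> Rp"
    and T: "\<And>x x'. (x, x') \<in> Lp \<Longrightarrow> T * lgen x x' = lgen x x' * T"
      "\<And>y y'. (y, y') \<in> Rp \<Longrightarrow> T * rgen y y' = rgen y y' * T"
  shows "app a (app T \<Omega> - app E (app T \<Omega>)) = 0"
proof -
  let ?GL = "(\<lambda>(x, y). lgen x y) ` Lp" and ?GR = "(\<lambda>(x, y). rgen x y) ` Rp"
  have comm: "lgen x x' * rgen y y' = rgen y y' * lgen x x'" if "(x, x') \<in> Lp" "(y, y') \<in> Rp" for x x' y y'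
    by (rule lgen_rgen_commute) (rule compat[OF that])
  have k_alt: "k = b * rgen e1 (of_real (1 / mu) *\<^sub>C e)"
    unfolding k_def star_b'[symmetric] by simp
  show ?thesis
  proof (rule off_F0_kernel[of ?GL ?GR])
    show "a \<in> ?GL" unfolding a_def using e(1) by (rule image_eqI[rotated]) simp
    fix X assume "X \<in> ?GL"
    then show "k * X = X * k"
      unfolding k_alt b_def using comm e(3,4) by (intro sym[OF mult_commute_mult]) auto
  next
    fix X assume "X \<in> ?GR"
    then show "a * X = X * a" "h * X = X * h"
      unfolding h_def star_a unfolding a_def using comm e(1,2) by (auto intro!: sym[OF mult_commute_mult])
  next
    have "T * h = h * T"
      unfolding h_def star_a unfolding a_def by (intro mult_commute_mult T e)
    moreover have "T * k = k * T"
      unfolding k_alt b_def by (intro mult_commute_mult T e)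
    ultimately show "app h (app T \<Omega>) = app k (app T \<Omega>)"
      by (metis app_mult h_Nil)
  qed (auto simp: dense_lgen dense_rgen dense)
qed

lemma ra_F0_zero:
  assumes z: "cinner z e = 0" "cinner z e1 = 0" and y: "y \<in> F0"
  shows "app (ra z) y = 0"
proof -
  have "app (ra z) y = app 0 y"
  proof (rule app_eq_closure_cspan[OF _ y[unfolded F0_def]])
    fix s assume "s \<in> w ` lists {e, e1}"
    then obtain xs where xs: "s = w xs" "xs \<in> lists {e, e1}" by auto
    have "cinner z (rev xs ! k) = 0" if "k < length (rev xs)" for k
    proof -
      have "rev xs ! k \<in> set xs" using nth_mem[OF that] by simp
      then have "rev xs ! k = e \<or> rev xs ! k = e1" using xs(2) by auto
      then show ?thesis using z by auto
    qed
    then show "app (ra z) s = app 0 s"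
      by (simp add: xs ra_eq flip_w an_w anw_def)
  qed
  then show ?thesis by simp
qed

lemma an_F0_zero:
  assumes "cinner z e = 0" "cinner z e1 = 0" "y \<in> F0"
  shows "app (an z) y = 0"
  using arg_cong[OF an_E_zero[OF assms(1,2)], of "\<lambda>X. app X y"] E(2)[OF assms(3)] by simp

end

context q_fock
begin

theorem central_is_scalar:
  assumes compat: "\<And>x x' y y'. (x, x') \<in> Lp \<Longrightarrow> (y, y') \<in> Rp \<Longrightarrow> cinner x' y = cinner y' x"
    and dense: "closure (cspan (fst ` Lp)) = UNIV" "closure (cspan (fst ` Rp)) = UNIV"
    and orth: "cinner e e1 = 0" and nz: "e1 \<noteq> 0" and lt: "norm e1 < norm e"
    and mu: "mu = (norm e)\<^sup>2 / (norm e1)\<^sup>2"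
    and e: "(e, e1) \<in> Lp" "(e1, e) \<in> Lp" "(e, of_real mu *\<^sub>C e1) \<in> Rp" "(e1, of_real (1 / mu) *\<^sub>C e) \<in> Rp"
    and f: "f \<noteq> 0" "(f, f1) \<in> Lp" "(f, f2) \<in> Rp"
      "\<And>z. z \<in> {f, f1, f2} \<Longrightarrow> cinner z e = 0 \<and> cinner z e1 = 0"
    and T: "\<And>x x'. (x, x') \<in> Lp \<Longrightarrow> T * lgen x x' = lgen x x' * T"
      "\<And>y y'. (y, y') \<in> Rp \<Longrightarrow> T * rgen y y' = rgen y y' * T"
  shows "\<exists>c. T = c *\<^sub>C 1"
proof -
  have nz': "e \<noteq> 0" using lt by auto
  have orth': "cinner e1 e = 0" using orth by (metis cinner_commute complex_cnj_zero)
  interpret p: q_pair q w e e1 by unfold_locales (use orth nz nz' in auto)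
  interpret p': q_pair q w e1 e by unfold_locales (use orth' nz nz' in auto)
  \<comment> \<open>Exchanging e and e1 inverts \<open>mu\<close>, replaces \<open>a\<close> by its
    adjoint and keeps \<open>F0\<close>; the two pairs required in \<open>Rp\<close> merely change
    places.\<close>
  have mu_p: "p.mu = mu" "p'.mu = 1 / mu" by (simp_all add: p.mu_def p'.mu_def mu)
  define v where "v = app T \<Omega>"
  have F0: "p'.F0 = p.F0" by (simp add: p'.F0_def p.F0_def insert_commute)
  have E: "app p'.E v = app p.E v"
    by (rule p'.E_unique) (simp_all add: F0 p.E)
  have "app p.a (v - app p.E v) = 0"
    unfolding v_def by (rule p.kernel_of_central[OF compat dense _ _ _ _ T]) (use e in \<open>simp_all add: mu_p\<close>)
  moreover have "app p'.a (v - app p'.E v) = 0"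
    unfolding v_def by (rule p'.kernel_of_central[OF compat dense _ _ _ _ T]) (use e in \<open>simp_all add: mu_p\<close>)
  ultimately have "v - app p.E v = 0"
    unfolding E p.a_def p'.a_def by (rule kernel_lgen_zero[OF _ _ orth lt])
  then have vF: "v \<in> p.F0" using p.E(1)[of v] by simp
  have zero: "app (an f) v = 0" "app (an f1) v = 0" "app (ra f2) v = 0"
    using f(4) by (auto intro!: p.an_F0_zero p.ra_F0_zero vF)
  have "app (lgen f f1) v = app T (w [f])"
    unfolding v_def using arg_cong[OF T(1)[OF f(2)], of "\<lambda>X. app X \<Omega>"] by (simp add: lgen_Nil)
  moreover have "app (rgen f f2) v = app T (w [f])"
    unfolding v_def using arg_cong[OF T(2)[OF f(3)], of "\<lambda>X. app X \<Omega>"] by (simp add: rgen_Nil)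
  ultimately have eq: "app (cr f) v = app (rc f) v"
    using zero by (simp add: lgen_def rgen_def app_add)
  \<comment> \<open>As l(f)^* v = 0, applying l(f)^* to l(f) v gives |f|^2 v, while applying it to
    r(f) v gives |f|^2 q^N v.\<close>
  have "cinner v (app (an f * cr f) v) = cinner v (app (an f * rc f) v)"
    by (simp add: eq)
  then have "cinner f f * cinner v v = cinner f f * cinner v (app (dil q) v)"
    unfolding an_cr an_rc by (simp add: app_add app_scaleC zero cinner_simps)
  then have "v = cinner \<Omega> v *\<^sub>C \<Omega>"
    using f(1) by (intro vacuum_of_dil_fixed) simp
  then obtain c where c: "v = c *\<^sub>C \<Omega>" by blast
  have "T = c *\<^sub>C 1"
  proof (rule bop_eq_dense[OF dense_lgen[OF dense(1)]])
    fix s assume "s \<in> (\<lambda>X. app X \<Omega>) ` walg ((\<lambda>(x, y). lgen x y) ` Lp)"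
    then obtain X where X: "s = app X \<Omega>" "X \<in> walg ((\<lambda>(x, y). lgen x y) ` Lp)" by blast
    have "T * X = X * T"
      by (rule walg_commute[OF X(2)]) (auto simp: T)
    then have "app T s = app X v"
      unfolding X v_def by (metis app_mult)
    then show "app T s = app (c *\<^sub>C 1) s"
      by (simp add: c X app_scaleC app_scaleC_right)
  qed
  then show ?thesis by blast
qed

end

section \<open>Functions on a horizontal strip\<close>

text \<open>Extended by zero above the real line, the function stays continuous and is holomorphic
  across the line, so the identity theorem applies; the lower edge is reached by continuity.\<close>

lemma strip_zero:
  fixes \<phi> :: "complex \<Rightarrow> complex"
  assumes "d > 0" and cont: "continuous_on {z. - d \<le> Im z \<and> Im z \<le> 0} \<phi>"
    and hol: "\<phi> holomorphic_on {z. - d < Im z \<and> Im z < 0}"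
    and zero: "\<And>t. \<phi> (complex_of_real t) = 0" and z: "- d \<le> Im z" "Im z \<le> 0"
  shows "\<phi> z = 0"
proof -
  let ?S = "{z. - d < Im z}"
  define \<psi> where "\<psi> z = (if Im z \<le> 0 then \<phi> z else 0)" for z
  have S: "open ?S" "connected ?S"
    by (simp_all add: open_halfspace_Im_gt convex_halfspace_Im_gt convex_connected)
  have "continuous_on ({z \<in> ?S. Im z \<le> 0} \<union> {z \<in> ?S. 0 \<le> Im z}) \<psi>"
    unfolding \<psi>_def
  proof (rule continuous_on_cases_local)
    show "closedin (top_of_set ({z \<in> ?S. Im z \<le> 0} \<union> {z \<in> ?S. 0 \<le> Im z})) {z \<in> ?S. Im z \<le> 0}"
      using closedin_closed_Int[OF closed_halfspace_Im_le[of 0], of "{z \<in> ?S. Im z \<le> 0} \<union> {z \<in> ?S. 0 \<le> Im z}"]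
      by (rule back_subst[of "closedin _"]) auto
    show "closedin (top_of_set ({z \<in> ?S. Im z \<le> 0} \<union> {z \<in> ?S. 0 \<le> Im z})) {z \<in> ?S. 0 \<le> Im z}"
      using closedin_closed_Int[OF closed_halfspace_Im_ge[of 0], of "{z \<in> ?S. Im z \<le> 0} \<union> {z \<in> ?S. 0 \<le> Im z}"]
      by (rule back_subst[of "closedin _"]) auto
    show "continuous_on {z \<in> ?S. Im z \<le> 0} \<phi>"
      by (rule continuous_on_subset[OF cont]) auto
    show "\<phi> w = 0" if "w \<in> {z \<in> ?S. Im z \<le> 0} \<and> \<not> Im w \<le> 0 \<or> w \<in> {z \<in> ?S. 0 \<le> Im z} \<and> Im w \<le> 0" for w
    proof -
      have "w = complex_of_real (Re w)" using that by (auto simp: complex_eq_iff)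
      then show ?thesis using zero by metis
    qed
  qed auto
  moreover have "{z \<in> ?S. Im z \<le> 0} \<union> {z \<in> ?S. 0 \<le> Im z} = ?S" by auto
  ultimately have cont\<psi>: "continuous_on ?S \<psi>" by simp
  have hol1: "\<psi> holomorphic_on ?S \<inter> {z. 0 < Im z}"
    by (rule holomorphic_transform[of "\<lambda>_. 0"]) (auto simp: \<psi>_def)
  have hol2: "\<psi> holomorphic_on ?S \<inter> {z. Im z < 0}"
    by (rule holomorphic_transform[of \<phi>], rule holomorphic_on_subset[OF hol]) (auto simp: \<psi>_def)
  have hol\<psi>: "\<psi> holomorphic_on ?S"
    by (rule holomorphic_on_paste_across_line[OF S(1), of "- \<i>" _ 0]) (use hol1 hol2 cont\<psi> in auto)
  have int: "\<psi> w = 0" if "w \<in> ?S" for w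
  proof (rule analytic_continuation_open[of "{z. 0 < Im z}" ?S \<psi> "\<lambda>_. 0"])
    have "\<i> \<in> {z. 0 < Im z}" by simp
    then show "{z. 0 < Im z} \<noteq> {}" by blast
  qed (use that S hol\<psi> \<open>d > 0\<close> in \<open>auto simp: open_halfspace_Im_gt \<psi>_def\<close>)
  show ?thesis
  proof (cases "Im z = - d")
    case False
    then show ?thesis using int[of z] z by (simp add: \<psi>_def)
  next
    case True
    define r where "r n = d * inverse (real (Suc n))" for n
    define f where "f n = z + \<i> * of_real (r n)" for n
    have le: "r n \<le> d" "0 < r n" for n
      using \<open>d > 0\<close> by (simp_all add: r_def divide_inverse[symmetric] divide_le_eq mult_left_le)
    have f: "- d < Im (f n)" "Im (f n) \<le> 0" for n
      using le[of n] True by (auto simp: f_def)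
    have "r \<longlonglongrightarrow> d * 0"
      unfolding r_def by (intro tendsto_intros LIMSEQ_inverse_real_of_nat)
    then have "(\<lambda>n. z + \<i> * of_real (r n)) \<longlonglongrightarrow> z + \<i> * of_real (d * 0)"
      by (intro tendsto_intros)
    then have "f \<longlonglongrightarrow> z" by (simp add: f_def[abs_def])
    then have "(\<lambda>n. \<phi> (f n)) \<longlonglongrightarrow> \<phi> z"
      using f z by (intro continuous_on_tendsto_compose[OF cont] always_eventually) (auto intro: less_imp_le)
    moreover have "\<phi> (f n) = 0" for n
      using int[of "f n"] f[of n] by (simp add: \<psi>_def)
    ultimately show ?thesis by (simp add: LIMSEQ_const_iff)
  qed
qed

definition strip_holomorphic :: "real \<Rightarrow> (complex \<Rightarrow> 'c::complex_inner) \<Rightarrow> bool" where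
  "strip_holomorphic d f \<longleftrightarrow> continuous_on {z. - d \<le> Im z \<and> Im z \<le> 0} f \<and>
     (\<forall>z. - d < Im z \<and> Im z < 0 \<longrightarrow> (\<exists>D. (f has_derivative (\<lambda>h. h *\<^sub>C D)) (at z)))"

lemma strip_holomorphic_cinner:
  assumes "strip_holomorphic d f"
  shows "continuous_on {z. - d \<le> Im z \<and> Im z \<le> 0} (\<lambda>z. cinner y (f z))"
    and "(\<lambda>z. cinner y (f z)) holomorphic_on {z. - d < Im z \<and> Im z < 0}"
proof -
  show "continuous_on {z. - d \<le> Im z \<and> Im z \<le> 0} (\<lambda>z. cinner y (f z))"
    using assms by (intro continuous_intros) (simp add: strip_holomorphic_def)
  show "(\<lambda>z. cinner y (f z)) holomorphic_on {z. - d < Im z \<and> Im z < 0}"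
    unfolding holomorphic_on_def
  proof
    fix z assume z: "z \<in> {z. - d < Im z \<and> Im z < 0}"
    then obtain D where "(f has_derivative (\<lambda>h. h *\<^sub>C D)) (at z)"
      using assms by (auto simp: strip_holomorphic_def)
    then have "((\<lambda>z. cinner y (f z)) has_derivative (\<lambda>h. cinner y (h *\<^sub>C D))) (at z)"
      by (rule bounded_linear.has_derivative[OF bounded_bilinear.bounded_linear_right[OF bounded_bilinear_cinner]])
    then have "((\<lambda>z. cinner y (f z)) has_field_derivative cinner y D) (at z)"
      by (simp add: has_field_derivative_def cinner_scaleC_right mult_commute_abs)
    then show "(\<lambda>z. cinner y (f z)) field_differentiable at z within {z. - d < Im z \<and> Im z < 0}"
      using field_differentiable_at_within field_differentiable_def by blast
  qed
qed

lemma strip_holomorphic_diff: "strip_holomorphic d f \<Longrightarrow> strip_holomorphic d g \<Longrightarrow> strip_holomorphic d (\<lambda>z. f z - g z)"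
  unfolding strip_holomorphic_def
proof (intro conjI allI impI)
  fix z assume *: "continuous_on {z. - d \<le> Im z \<and> Im z \<le> 0} f \<and>
     (\<forall>z. - d < Im z \<and> Im z < 0 \<longrightarrow> (\<exists>D. (f has_derivative (\<lambda>h. h *\<^sub>C D)) (at z)))"
    "continuous_on {z. - d \<le> Im z \<and> Im z \<le> 0} g \<and>
     (\<forall>z. - d < Im z \<and> Im z < 0 \<longrightarrow> (\<exists>D. (g has_derivative (\<lambda>h. h *\<^sub>C D)) (at z)))"
  then show "continuous_on {z. - d \<le> Im z \<and> Im z \<le> 0} (\<lambda>z. f z - g z)"
    by (intro continuous_intros) auto
  assume "- d < Im z \<and> Im z < 0"
  with * obtain D D' where "(f has_derivative (\<lambda>h. h *\<^sub>C D)) (at z)" "(g has_derivative (\<lambda>h. h *\<^sub>C D')) (at z)"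
    by blast
  then have "((\<lambda>z. f z - g z) has_derivative (\<lambda>h. h *\<^sub>C (D - D'))) (at z)"
    unfolding scaleC_diff_right by (rule has_derivative_diff)
  then show "\<exists>D. ((\<lambda>z. f z - g z) has_derivative (\<lambda>h. h *\<^sub>C D)) (at z)" by blast
qed

lemma strip_holomorphic_const: "strip_holomorphic d (\<lambda>_. x)"
  unfolding strip_holomorphic_def by (auto intro!: exI[of _ 0])

lemma strip_holomorphic_linear:
  assumes "strip_holomorphic d f" "bounded_linear T" "\<And>c x. T (c *\<^sub>C x) = c *\<^sub>C T x"
  shows "strip_holomorphic d (\<lambda>z. T (f z))"
  unfolding strip_holomorphic_def
proof (intro conjI allI impI)
  show "continuous_on {z. - d \<le> Im z \<and> Im z \<le> 0} (\<lambda>z. T (f z))"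
    using assms(1) by (intro bounded_linear.continuous_on[OF assms(2)]) (simp add: strip_holomorphic_def)
  fix z assume "- d < Im z \<and> Im z < 0"
  then obtain D where "(f has_derivative (\<lambda>h. h *\<^sub>C D)) (at z)" using assms(1) by (auto simp: strip_holomorphic_def)
  then have "((\<lambda>z. T (f z)) has_derivative (\<lambda>h. T (h *\<^sub>C D))) (at z)"
    by (rule bounded_linear.has_derivative[OF assms(2)])
  then show "\<exists>D. ((\<lambda>z. T (f z)) has_derivative (\<lambda>h. h *\<^sub>C D)) (at z)"
    by (auto simp: assms(3))
qed

lemma strip_holomorphic_affine:
  assumes f: "strip_holomorphic d f" and s: "s = 1 \<or> s = - 1"
    and dom: "\<And>z. - d' \<le> Im z \<Longrightarrow> Im z \<le> 0 \<Longrightarrow> - d \<le> Im (c + of_real s * z) \<and> Im (c + of_real s * z) \<le> 0"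
      "\<And>z. - d' < Im z \<Longrightarrow> Im z < 0 \<Longrightarrow> - d < Im (c + of_real s * z) \<and> Im (c + of_real s * z) < 0"
  shows "strip_holomorphic d' (\<lambda>z. f (c + of_real s * z))"
  unfolding strip_holomorphic_def
proof (intro conjI allI impI)
  show "continuous_on {z. - d' \<le> Im z \<and> Im z \<le> 0} (\<lambda>z. f (c + of_real s * z))"
  proof (rule continuous_on_compose2[of "{z. - d \<le> Im z \<and> Im z \<le> 0}" f _ "\<lambda>z. c + of_real s * z"])
    show "continuous_on {z. - d \<le> Im z \<and> Im z \<le> 0} f" using f by (simp add: strip_holomorphic_def)
    show "continuous_on {z. - d' \<le> Im z \<and> Im z \<le> 0} (\<lambda>z. c + of_real s * z)"
      by (intro continuous_intros)
    show "(\<lambda>z. c + of_real s * z) ` {z. - d' \<le> Im z \<and> Im z \<le> 0} \<subseteq> {z. - d \<le> Im z \<and> Im z \<le> 0}"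
      using dom(1) by blast
  qed
  fix z assume z: "- d' < Im z \<and> Im z < 0"
  then obtain D where D: "(f has_derivative (\<lambda>h. h *\<^sub>C D)) (at (c + of_real s * z))"
    using f dom(2)[of z] unfolding strip_holomorphic_def by blast
  have "((\<lambda>z. c + of_real s * z) has_derivative (\<lambda>h. of_real s * h)) (at z)"
    by (auto intro!: derivative_eq_intros)
  from has_derivative_compose[OF this D]
  have "((\<lambda>z. f (c + of_real s * z)) has_derivative (\<lambda>h. h *\<^sub>C (of_real s *\<^sub>C D))) (at z)"
    by (simp add: scaleC_scaleC mult.commute)
  then show "\<exists>D. ((\<lambda>z. f (c + of_real s * z)) has_derivative (\<lambda>h. h *\<^sub>C D)) (at z)" by blast
qed

lemma strip_holomorphic_eq:
  assumes "d > 0" "strip_holomorphic d f" "strip_holomorphic d g" "\<And>t. f (complex_of_real t) = g (of_real t)"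
    and "- d \<le> Im z" "Im z \<le> 0"
  shows "f z = g z"
proof (rule cinner_ext)
  fix y
  have "cinner y (f z - g z) = 0"
    using strip_zero[OF assms(1) strip_holomorphic_cinner[OF strip_holomorphic_diff[OF assms(2,3)], of y] _ assms(5,6)] assms(4)
    by simp
  then show "cinner y (f z) = cinner y (g z)" by (simp add: cinner_diff_right)
qed

section \<open>The analytic generator\<close>

locale one_parameter_group =
  fixes V :: "real \<Rightarrow> 'c::chilbert_space \<Rightarrow> 'c" and cc :: "'c \<Rightarrow> 'c"
  assumes V_add: "V t (x + y) = V t x + V t y"
    and V_scaleC: "V t (c *\<^sub>C x) = c *\<^sub>C V t x"
    and V_cinner: "cinner (V t x) (V t y) = cinner x y"
    and V_0: "V 0 x = x"
    and V_plus: "V (s + t) x = V s (V t x)"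
    and cc_add: "cc (x + y) = cc x + cc y"
    and cc_scaleC: "cc (c *\<^sub>C x) = cnj c *\<^sub>C cc x"
    and cc_cc [simp]: "cc (cc x) = x"
    and cc_cinner: "cinner (cc x) (cc y) = cnj (cinner x y)"
    and cc_V: "cc (V t x) = V t (cc x)"
begin

lemma bounded_linear_V: "bounded_linear (V t)"
proof (rule bounded_linear_intro[of _ 1])
  have "complex_of_real ((norm (V t x))\<^sup>2) = of_real ((norm x)\<^sup>2)" for x
    by (simp only: cinner_self[symmetric] V_cinner)
  then have "norm (V t x) = norm x" for x
    by (metis of_real_eq_iff norm_ge_zero power2_eq_iff_nonneg)
  then show "norm (V t x) \<le> norm x * 1" for x by simp
qed (simp_all add: V_add V_scaleC scaleR_scaleC)

lemma bounded_linear_cc: "bounded_linear cc"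
proof (rule bounded_linear_intro[of _ 1])
  have "complex_of_real ((norm (cc x))\<^sup>2) = of_real ((norm x)\<^sup>2)" for x
    unfolding cinner_self[symmetric] cc_cinner by (simp add: cinner_self)
  then have "norm (cc x) = norm x" for x
    by (metis of_real_eq_iff norm_ge_zero power2_eq_iff_nonneg)
  then show "norm (cc x) \<le> norm x * 1" for x by simp
qed (simp_all add: cc_add cc_scaleC scaleR_scaleC)

lemma V_zero [simp]: "V t 0 = 0"
  using V_scaleC[of t 0 0] by simp

lemma V_minus_cinner: "cinner (V (- t) x) y = cinner x (V t y)"
  using V_cinner[of t "V (- t) x" y] V_plus[of t "- t" x] by (simp add: V_0)

definition G where "G = analytic_generator V"

lemma G_iff: "(x, y) \<in> G \<longleftrightarrow> (\<exists>f. strip_holomorphic 1 f \<and> (\<forall>t. f (complex_of_real t) = V t x) \<and> f (- \<i>) = y)"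
  by (auto simp: G_def analytic_generator_def strip_holomorphic_def)

lemma G_diff:
  assumes "(x, y) \<in> G" "(x', y') \<in> G"
  shows "(x - x', y - y') \<in> G"
proof -
  obtain f f' where f: "strip_holomorphic 1 f" "\<And>t. f (complex_of_real t) = V t x" "f (- \<i>) = y"
    "strip_holomorphic 1 f'" "\<And>t. f' (complex_of_real t) = V t x'" "f' (- \<i>) = y'"
    using assms unfolding G_iff by blast
  have "V t (x - x') = V t x - V t x'" for t
    using V_add[of t "x - x'" x'] by (simp add: eq_diff_eq)
  then show ?thesis
    unfolding G_iff using f by (intro exI[of _ "\<lambda>z. f z - f' z"]) (auto intro: strip_holomorphic_diff)
qed

lemma G_scaleC:
  assumes "(x, y) \<in> G"
  shows "(c *\<^sub>C x, c *\<^sub>C y) \<in> G"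
proof -
  obtain f where f: "strip_holomorphic 1 f" "\<And>t. f (complex_of_real t) = V t x" "f (- \<i>) = y"
    using assms unfolding G_iff by blast
  have "strip_holomorphic 1 (\<lambda>z. c *\<^sub>C f z)"
    by (rule strip_holomorphic_linear[OF f(1) bounded_linear_scaleC]) (simp add: scaleC_scaleC mult.commute)
  then show ?thesis
    unfolding G_iff using f by (intro exI[of _ "\<lambda>z. c *\<^sub>C f z"]) (auto simp: V_scaleC)
qed

lemma G_add:
  assumes "(x, y) \<in> G" "(x', y') \<in> G"
  shows "(x + x', y + y') \<in> G"
  using G_diff[OF assms(1) G_scaleC[OF assms(2), of "-1"]] by (simp add: scaleC_minus_left)

text \<open>Both sides extend s -> V (t + s) x to the strip, and such extensions are unique.\<close>

lemma G_flow:
  assumes "strip_holomorphic 1 f" "\<And>t. f (complex_of_real t) = V t x" "- 1 \<le> Im z" "Im z \<le> 0"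
  shows "f (of_real t + z) = V t (f z)"
proof -
  have 1: "strip_holomorphic 1 (\<lambda>z. f (of_real t + of_real 1 * z))"
    by (rule strip_holomorphic_affine[OF assms(1)]) auto
  have 2: "strip_holomorphic 1 (\<lambda>z. V t (f z))"
    by (rule strip_holomorphic_linear[OF assms(1) bounded_linear_V V_scaleC])
  have "f (of_real t + of_real 1 * of_real s) = V t (f (of_real s))" for s
    using assms(2)[of "t + s"] by (simp add: assms(2) V_plus)
  from strip_holomorphic_eq[OF _ 1 2 this assms(3,4)] show ?thesis by simp
qed

lemma G_single: "(0, y) \<in> G \<Longrightarrow> y = 0"
proof -
  assume "(0, y) \<in> G"
  then obtain f where f: "strip_holomorphic 1 f" "\<And>t. f (complex_of_real t) = V t 0" "f (- \<i>) = y"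
    unfolding G_iff by blast
  have "f (- \<i>) = 0"
    by (rule strip_holomorphic_eq[OF _ f(1) strip_holomorphic_const]) (simp_all add: f(2))
  then show "y = 0" by (simp add: f)
qed

text \<open>The strip is turned upside down: z -> f(-i - z) vanishes on the real line by
  \<open>G_flow\<close>, hence at -i, where its value is x.\<close>

lemma G_injective: "(x, 0) \<in> G \<Longrightarrow> x = 0"
proof -
  assume "(x, 0) \<in> G"
  then obtain f where f: "strip_holomorphic 1 f" "\<And>t. f (complex_of_real t) = V t x" "f (- \<i>) = 0"
    unfolding G_iff by blast
  have g: "strip_holomorphic 1 (\<lambda>z. f (- \<i> + of_real (- 1) * z))"
    by (rule strip_holomorphic_affine[OF f(1)]) auto
  have "f (- \<i> + of_real (- 1) * of_real t) = 0" for t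
    using G_flow[OF f(1,2), of "- \<i>" "- t"] by (simp add: f(3) add.commute)
  then have "f (- \<i> + of_real (- 1) * (- \<i>)) = 0"
    using strip_holomorphic_eq[OF _ g strip_holomorphic_const[of 1 0], of "- \<i>"] by simp
  then show "x = 0" using f(2)[of 0] by (simp add: V_0)
qed

text \<open>The generator is positive: \<open>\<langle>A x, x\<rangle> = \<langle>A\<^sup>1\<^sup>/\<^sup>2 x, A\<^sup>1\<^sup>/\<^sup>2 x\<rangle>\<close>. Both sides are
  values at \<open>- \<i> / 2\<close> of functions on a half strip that agree on the real line.\<close>

lemma G_positive:
  assumes "(x, y) \<in> G"
  shows "\<exists>v::'c. cinner y x = cinner v v"
proof -
  obtain f where f: "strip_holomorphic 1 f" "\<And>t. f (complex_of_real t) = V t x" "f (- \<i>) = y"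
    using assms unfolding G_iff by blast
  define v where "v = f (- (\<i> / 2))"
  have flow: "f (of_real t + - (\<i> / 2)) = V t v" for t
    unfolding v_def by (rule G_flow[OF f(1,2)]) auto
  define \<kappa> where "\<kappa> z = cinner x (f (- (\<i> / 2) + of_real (- 1) * z))" for z
  define \<beta> where "\<beta> = cnj \<circ> \<kappa> \<circ> cnj"
  define \<phi> where "\<phi> z = cinner v (f z) - \<beta> z" for z
  have g: "continuous_on {z. - 1 \<le> Im z \<and> Im z \<le> 0} (\<lambda>z. cinner x (f z))"
    "(\<lambda>z. cinner x (f z)) holomorphic_on {z. - 1 < Im z \<and> Im z < 0}"
    by (rule strip_holomorphic_cinner[OF f(1)])+
  have \<kappa>c: "continuous_on {z. 0 \<le> Im z \<and> Im z \<le> 1 / 2} \<kappa>"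
    unfolding \<kappa>_def
    by (rule continuous_on_compose2[OF g(1), of _ "\<lambda>z. - (\<i> / 2) + of_real (- 1) * z"])
      (auto intro!: continuous_intros)
  have \<kappa>h: "\<kappa> holomorphic_on {z. 0 < Im z \<and> Im z < 1 / 2}"
  proof -
    have "((\<lambda>z. cinner x (f z)) \<circ> (\<lambda>z. - (\<i> / 2) + of_real (- 1) * z)) holomorphic_on {z. 0 < Im z \<and> Im z < 1 / 2}"
      by (rule holomorphic_on_compose_gen[OF _ g(2)]) (auto intro!: holomorphic_intros)
    then show ?thesis by (simp add: \<kappa>_def[abs_def] comp_def)
  qed
  have "\<phi> (- (\<i> / 2)) = 0"
  proof (rule strip_zero[where \<phi> = \<phi> and d = "1 / 2"])
    have "continuous_on {z. - (1 / 2) \<le> Im z \<and> Im z \<le> 0} \<beta>"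
      unfolding \<beta>_def comp_def
      by (intro continuous_intros continuous_on_compose2[OF \<kappa>c]) auto
    moreover have "continuous_on {z. - (1 / 2) \<le> Im z \<and> Im z \<le> 0} (\<lambda>z. cinner v (f z))"
      by (rule continuous_on_subset[OF strip_holomorphic_cinner(1)[OF f(1)]]) auto
    ultimately show "continuous_on {z. - (1 / 2) \<le> Im z \<and> Im z \<le> 0} \<phi>"
      unfolding \<phi>_def by (intro continuous_on_diff)
    have "open {z. - (1 / 2) < Im z \<and> Im z < 0}"
      by (simp only: Collect_conj_eq) (intro open_Int open_halfspace_Im_gt open_halfspace_Im_lt)
    moreover have "cnj ` {z. - (1 / 2) < Im z \<and> Im z < 0} \<subseteq> {z. 0 < Im z \<and> Im z < 1 / 2}" by auto
    ultimately have "\<beta> holomorphic_on {z. - (1 / 2) < Im z \<and> Im z < 0}"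
      unfolding \<beta>_def by (intro holomorphic_on_compose_cnj_cnj holomorphic_on_subset[OF \<kappa>h])
    moreover have "(\<lambda>z. cinner v (f z)) holomorphic_on {z. - (1 / 2) < Im z \<and> Im z < 0}"
      by (rule holomorphic_on_subset[OF strip_holomorphic_cinner(2)[OF f(1)]]) auto
    ultimately show "\<phi> holomorphic_on {z. - (1 / 2) < Im z \<and> Im z < 0}"
      unfolding \<phi>_def by (intro holomorphic_intros)
    fix t
    have "\<beta> (of_real t) = cinner (f (of_real (- t) + - (\<i> / 2))) x"
      unfolding \<beta>_def \<kappa>_def comp_def by (subst cinner_commute) (simp add: add.commute)
    also have "\<dots> = cinner v (V t x)"
      unfolding flow by (rule V_minus_cinner)
    finally show "\<phi> (of_real t) = 0" by (simp add: \<phi>_def f(2))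
  qed auto
  moreover have "\<beta> (- (\<i> / 2)) = cinner y x"
  proof -
    have "- (\<i> / 2) + of_real (- 1) * cnj (- (\<i> / 2)) = - \<i>" by (simp add: complex_eq_iff)
    then show ?thesis
      unfolding \<beta>_def \<kappa>_def comp_def using f(3) by (metis cinner_commute)
  qed
  ultimately have "cinner y x = cinner v v" by (simp add: \<phi>_def v_def)
  then show ?thesis by blast
qed

lemma G_no_minus_one: "(x, - x) \<in> G \<Longrightarrow> x = 0"
proof -
  assume "(x, - x) \<in> G"
  then obtain v :: 'c where "cinner (- x) x = cinner v v" using G_positive by blast
  then have "complex_of_real (- ((norm x)\<^sup>2)) = of_real ((norm v)\<^sup>2)"
    by (simp add: cinner_minus_left cinner_self)
  then have "- ((norm x)\<^sup>2) = (norm v)\<^sup>2" using of_real_eq_iff by blast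
  then have "(norm x)\<^sup>2 \<le> 0" using zero_le_power2[of "norm v"] by linarith
  then show "x = 0" by simp
qed

text \<open>Conjugation by \<open>cc\<close> turns the generator A into its inverse, because
  \<open>cc\<close> is antilinear and commutes with V t = A^(it).\<close>

lemma G_conj:
  assumes "(x, y) \<in> G"
  shows "(cc y, cc x) \<in> G"
proof -
  obtain f where f: "strip_holomorphic 1 f" "\<And>t. f (complex_of_real t) = V t x" "f (- \<i>) = y"
    using assms unfolding G_iff by blast
  define g where "g z = cc (f (- \<i> + cnj z))" for z
  have "strip_holomorphic 1 g"
    unfolding strip_holomorphic_def
  proof (intro conjI allI impI)
    show "continuous_on {z. - 1 \<le> Im z \<and> Im z \<le> 0} g"
      unfolding g_def using f(1) unfolding strip_holomorphic_def
      by (intro bounded_linear.continuous_on[OF bounded_linear_cc])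
        (auto intro!: continuous_on_compose2[of "{z. - 1 \<le> Im z \<and> Im z \<le> 0}" f] continuous_intros)
    fix z assume z: "- 1 < Im z \<and> Im z < 0"
    then obtain D where D: "(f has_derivative (\<lambda>h. h *\<^sub>C D)) (at (- \<i> + cnj z))"
    proof -
      have "- 1 < Im (- \<i> + cnj z) \<and> Im (- \<i> + cnj z) < 0" using z by simp
      then show ?thesis using f(1) that unfolding strip_holomorphic_def by blast
    qed
    have "((\<lambda>z. - \<i> + cnj z) has_derivative (\<lambda>h. cnj h)) (at z)"
      by (auto intro!: derivative_eq_intros)
    from bounded_linear.has_derivative[OF bounded_linear_cc has_derivative_compose[OF this D]]
    have "(g has_derivative (\<lambda>h. h *\<^sub>C cc D)) (at z)"
      by (simp add: g_def[abs_def] cc_scaleC)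
    then show "\<exists>D. (g has_derivative (\<lambda>h. h *\<^sub>C D)) (at z)" by blast
  qed
  moreover have "g (of_real t) = V t (cc y)" for t
    using G_flow[OF f(1,2), of "- \<i>" t] by (simp add: g_def f(3) cc_V add.commute)
  moreover have "g (- \<i>) = cc x"
    using f(2)[of 0] by (simp add: g_def V_0)
  ultimately show ?thesis unfolding G_iff by blast
qed

lemma G_eigen:
  assumes "\<And>t. V t x = exp (\<i> * of_real (t * \<theta>)) *\<^sub>C x"
  shows "(x, of_real (exp \<theta>) *\<^sub>C x) \<in> G"
proof -
  define f where "f z = exp (\<i> * of_real \<theta> * z) *\<^sub>C x" for z
  have bl: "bounded_linear (\<lambda>c. c *\<^sub>C x)"
    by (rule bounded_linear_intro[of _ "norm x"])
      (auto simp: scaleC_add_left norm_scaleC scaleR_scaleC scaleC_scaleC scaleR_conv_of_real)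
  have "strip_holomorphic 1 f"
    unfolding strip_holomorphic_def
  proof (intro conjI allI impI)
    show "continuous_on {z. - 1 \<le> Im z \<and> Im z \<le> 0} f"
      unfolding f_def by (intro bounded_linear.continuous_on[OF bl] continuous_intros)
    fix z
    have "((\<lambda>z. exp (\<i> * of_real \<theta> * z)) has_field_derivative (\<i> * of_real \<theta>) * exp (\<i> * of_real \<theta> * z)) (at z)"
      by (auto intro!: derivative_eq_intros)
    then have "((\<lambda>z. exp (\<i> * of_real \<theta> * z)) has_derivative (\<lambda>h. h * ((\<i> * of_real \<theta>) * exp (\<i> * of_real \<theta> * z)))) (at z)"
      unfolding has_field_derivative_def by (simp add: mult_commute_abs)
    from bounded_linear.has_derivative[OF bl this]
    have "(f has_derivative (\<lambda>h. h *\<^sub>C (((\<i> * of_real \<theta>) * exp (\<i> * of_real \<theta> * z)) *\<^sub>C x))) (at z)"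
      by (simp add: f_def[abs_def] scaleC_scaleC)
    then show "\<exists>D. (f has_derivative (\<lambda>h. h *\<^sub>C D)) (at z)" by blast
  qed
  moreover have "f (of_real t) = V t x" for t
    unfolding f_def assms by (simp add: mult_ac)
  moreover have "f (- \<i>) = of_real (exp \<theta>) *\<^sub>C x"
  proof -
    have "\<i> * of_real \<theta> * - \<i> = complex_of_real \<theta>" by (simp add: complex_eq_iff)
    then show ?thesis by (simp add: f_def exp_of_real)
  qed
  ultimately show ?thesis unfolding G_iff by blast
qed

section \<open>The operator 2 / (1 + 1/A) without spectral calculus\<close>

definition B :: "'c \<Rightarrow> 'c" where "B = two_over_one_plus (G\<inverse>)"

text \<open>Here v is the inverse of 1 + A applied to x, and y = A v. Both parts are recorded
  because \<open>cc\<close> exchanges them.\<close>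

definition sol :: "'c \<Rightarrow> 'c \<Rightarrow> 'c \<Rightarrow> bool" where
  "sol x y v \<longleftrightarrow> (v, y) \<in> G \<and> y + v = x"

text \<open>Two solutions would differ by an eigenvector of A for the eigenvalue -1, which
  positivity excludes.\<close>

lemma sol_unique:
  assumes "sol x y v" "sol x y' v'"
  shows "y = y'"
proof -
  have "(v - v', y - y') \<in> G" using assms by (auto simp: sol_def intro: G_diff)
  moreover have "y - y' = - (v - v')" using assms by (auto simp: sol_def algebra_simps)
  ultimately have "v - v' = 0" using G_no_minus_one by metis
  then show ?thesis using assms by (auto simp: sol_def)
qed

lemma B_eq: "B x = 2 *\<^sub>R (THE y. \<exists>v. sol x y v)"
  by (simp add: B_def two_over_one_plus_def sol_def)

lemma B_sol: "sol x y v \<Longrightarrow> B x = 2 *\<^sub>C y"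
proof -
  assume "sol x y v"
  then have "(THE y. \<exists>v. sol x y v) = y"
    by (intro the_equality) (auto intro: sol_unique)
  then show ?thesis by (simp add: B_eq scaleR_scaleC)
qed

lemma sol_add: "sol x y v \<Longrightarrow> sol x' y' v' \<Longrightarrow> sol (x + x') (y + y') (v + v')"
  by (auto simp: sol_def intro: G_add)

lemma sol_scaleC: "sol x y v \<Longrightarrow> sol (c *\<^sub>C x) (c *\<^sub>C y) (c *\<^sub>C v)"
  by (auto simp: sol_def scaleC_add_right intro: G_scaleC)

lemma sol_conj: "sol x y v \<Longrightarrow> sol (cc x) (cc v) (cc y)"
  by (auto simp: sol_def cc_add intro: G_conj)

lemma cc_minus: "cc (- x) = - cc x"
  using cc_scaleC[of "-1" x] by (simp add: scaleC_minus_left)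

lemma cc_diff: "cc (x - y) = cc x - cc y"
  using cc_add[of x "- y"] by (simp add: cc_minus)

lemma cinner_cc_left: "cinner (cc x) y = cinner (cc y) x"
  by (metis cc_cc cc_cinner cinner_commute)

end

locale deformation = one_parameter_group V cc for V :: "real \<Rightarrow> 'c::chilbert_space \<Rightarrow> 'c" and cc +
  fixes j :: "'c \<Rightarrow> 'h::chilbert_space" and z :: 'c and \<theta> :: real
  assumes j_linear: "clinear j"
    and j_cinner: "cinner (j x) (j y) = cinner (B x) y"
    and j_dense: "closure (range j) = UNIV"
    and z: "\<And>t. V t z = exp (\<i> * of_real (t * \<theta>)) *\<^sub>C z" "z \<noteq> 0" "cinner z (cc z) = 0" and theta_pos: "\<theta> > 0"
begin

lemma j_add: "j (x + y) = j x + j y" and j_scaleC: "j (c *\<^sub>C x) = c *\<^sub>C j x"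
  using j_linear by (auto simp: clinear_def)

text \<open>The eigenvalue of B at z, where A has eigenvalue exp \<theta>; at \<open>cc z\<close> it
  is 2 - \<beta>. That \<beta> > 1 makes \<open>j (cc z)\<close> shorter than
  \<open>j z\<close>.\<close>

definition \<beta> :: real where "\<beta> = 2 * (exp \<theta> / (1 + exp \<theta>))"

lemma beta: "1 < \<beta>" "\<beta> < 2"
proof -
  have "exp \<theta> > 1" using theta_pos by simp
  moreover have "1 + exp \<theta> > 0" by (simp add: add_pos_pos)
  ultimately show "1 < \<beta>" "\<beta> < 2" by (simp_all add: \<beta>_def field_simps)
qed

lemma sol_z: "sol z (of_real (\<beta> / 2) *\<^sub>C z) (of_real (1 / (1 + exp \<theta>)) *\<^sub>C z)"
proof -
  have p: "1 + exp \<theta> > 0" by (simp add: add_pos_pos)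
  have half: "\<beta> / 2 = exp \<theta> / (1 + exp \<theta>)"
    unfolding \<beta>_def by (rule nonzero_mult_div_cancel_left) simp
  then have "(1 / (1 + exp \<theta>)) * exp \<theta> = \<beta> / 2"
    unfolding half by simp
  then have "of_real (1 / (1 + exp \<theta>)) *\<^sub>C of_real (exp \<theta>) *\<^sub>C z = of_real (\<beta> / 2) *\<^sub>C z"
    by (simp only: scaleC_scaleC of_real_mult[symmetric])
  then have "(of_real (1 / (1 + exp \<theta>)) *\<^sub>C z, of_real (\<beta> / 2) *\<^sub>C z) \<in> G"
    using G_scaleC[OF G_eigen[OF z(1)], of "of_real (1 / (1 + exp \<theta>))"] by (simp only:)
  moreover have "\<beta> / 2 + 1 / (1 + exp \<theta>) = 1"
    using p unfolding half by (simp flip: add_divide_distrib add: add.commute)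
  then have "of_real (\<beta> / 2) *\<^sub>C z + of_real (1 / (1 + exp \<theta>)) *\<^sub>C z = z"
    by (simp only: scaleC_add_left[symmetric] of_real_add[symmetric]) simp
  ultimately show ?thesis by (simp add: sol_def)
qed

lemma B_z: "B z = of_real \<beta> *\<^sub>C z"
  by (simp add: B_sol[OF sol_z] scaleC_scaleC)

text \<open>If some \<open>x\<close> had no solution, then \<open>B\<close> would take the same arbitrary value at all such
  vectors. A sesquilinear form cannot do this unless \<open>j\<close> vanishes.\<close>

lemma sol_exists: "\<exists>y v. sol x y v"
proof (rule ccontr)
  assume nx: "\<not> ?thesis"
  have junk: "B a = B b" if "\<not> (\<exists>y v. sol a y v)" "\<not> (\<exists>y v. sol b y v)" for a b
  proof -
    have "(\<lambda>y. \<exists>v. sol a y v) = (\<lambda>y. \<exists>v. sol b y v)" using that by auto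
    then show ?thesis by (simp only: B_eq)
  qed
  have no: "j a = 0" if a: "\<not> (\<exists>y v. sol a y v)" for a
  proof -
    have "\<not> (\<exists>y v. sol (2 *\<^sub>C a) y v)"
    proof
      assume "\<exists>y v. sol (2 *\<^sub>C a) y v"
      then obtain y v where "sol (2 *\<^sub>C a) y v" by blast
      from sol_scaleC[OF this, of "1/2"] show False using a by (auto simp: scaleC_scaleC)
    qed
    then have "B (2 *\<^sub>C a) = B a" using a by (rule junk)
    then have "cinner (j (2 *\<^sub>C a)) (j a) = cinner (j a) (j a)" by (simp add: j_cinner)
    then show ?thesis by (simp add: j_scaleC cinner_scaleC_left)
  qed
  \<comment> \<open>As z is solvable and x is not, z + x is not. Hence j kills both x and z + x, so
    also z, against B z = \<beta> z.\<close>
  have "\<not> (\<exists>y v. sol (z + x) y v)"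
  proof
    assume "\<exists>y v. sol (z + x) y v"
    then obtain y v where "sol (z + x) y v" by blast
    from sol_add[OF this sol_scaleC[OF sol_z, of "-1"]] show False
      using nx by (auto simp: scaleC_minus_left)
  qed
  then have "j z = 0" using no[OF nx] no[of "z + x"] by (simp add: j_add)
  then have "cinner (B z) z = 0" using j_cinner[of z z] by simp
  then show False using beta z(2) by (simp add: B_z cinner_scaleC_left)
qed

lemma B_add: "B (x + y) = B x + B y"
proof -
  obtain a b c d where "sol x a b" "sol y c d" using sol_exists by metis
  then show ?thesis using B_sol[OF sol_add] by (simp add: B_sol scaleC_add_right)
qed

lemma B_scaleC: "B (c *\<^sub>C x) = c *\<^sub>C B x"
proof -
  obtain a b where "sol x a b" using sol_exists by metis
  then show ?thesis using B_sol[OF sol_scaleC] by (simp add: B_sol scaleC_scaleC mult.commute)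
qed

lemma B_diff: "B (x - y) = B x - B y"
  using B_add[of "x - y" y] by simp

text \<open>The identity 2/(1+A) = 2 - 2/(1+1/A), since \<open>cc\<close> inverts A.\<close>

lemma B_cc: "B (cc x) = 2 *\<^sub>C cc x - cc (B x)"
proof -
  obtain a b where s: "sol x a b" using sol_exists by metis
  then have x: "cc x = cc a + cc b" by (auto simp: sol_def cc_add)
  have "B (cc x) = 2 *\<^sub>C cc b" by (rule B_sol[OF sol_conj[OF s]])
  then show ?thesis
    by (simp add: B_sol[OF s] cc_scaleC) (simp add: x scaleC_add_right)
qed

lemma cc_B: "cc (B x) = 2 *\<^sub>C cc x - B (cc x)"
  by (simp add: B_cc)

lemma B_zero_imp: "B x = 0 \<Longrightarrow> x = 0"
proof -
  assume "B x = 0"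
  obtain a b where s: "sol x a b" using sol_exists by metis
  then have "a = 0" using \<open>B x = 0\<close> by (simp add: B_sol)
  then show ?thesis using s G_injective by (auto simp: sol_def)
qed

lemma B_two_imp: "B x = 2 *\<^sub>C x \<Longrightarrow> x = 0"
proof -
  assume "B x = 2 *\<^sub>C x"
  obtain a b where s: "sol x a b" using sol_exists by metis
  then have "2 *\<^sub>C (a - x) = 0" using \<open>B x = _\<close> by (simp add: B_sol scaleC_diff_right)
  then have "b = 0" using s by (auto simp: sol_def)
  then show ?thesis using s G_single by (auto simp: sol_def)
qed

lemma B_symmetric: "cinner (B x) y = cinner x (B y)"
proof -
  have "cinner (B x) y = cnj (cinner (B y) x)"
    unfolding j_cinner[symmetric] by (rule cinner_commute)
  then show ?thesis by (metis cinner_commute)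
qed

text \<open>B and its conjugate by \<open>cc\<close> add up to 2, hence |j x|^2 + |j (cc x)|^2 = 2
  |x|^2.\<close>

lemma norm_j: "norm (j x) \<le> sqrt 2 * norm x"
proof -
  have 1: "Re (cinner (B a) a) = (norm (j a))\<^sup>2" for a
    unfolding j_cinner[symmetric] cinner_self by simp
  have "cinner (B (cc x)) (cc x) = of_real (2 * (norm x)\<^sup>2) - cnj (cinner (B x) x)"
    unfolding B_cc by (simp add: cinner_simps cc_cinner) (simp add: cinner_self)
  then have "(norm (j (cc x)))\<^sup>2 = 2 * (norm x)\<^sup>2 - (norm (j x))\<^sup>2"
    using 1[of "cc x"] 1[of x] by (simp flip: of_real_power)
  then have "(norm (j x))\<^sup>2 \<le> 2 * (norm x)\<^sup>2" using zero_le_power2[of "norm (j (cc x))"] by linarith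
  then have "(norm (j x))\<^sup>2 \<le> (sqrt 2 * norm x)\<^sup>2" by (simp add: power_mult_distrib)
  then show ?thesis by (rule power2_le_imp_le) simp
qed

text \<open>The graphs of the operators \<open>S\<close> and \<open>S\<^sup>*\<close> of modular theory on the one-particle space.\<close>

definition Lp where "Lp = range (\<lambda>x. (j x, j (cc x)))"
definition Rp where "Rp = range (\<lambda>y. (j (2 *\<^sub>C y - B y), j (cc (B y))))"

text \<open>The relation between S and its adjoint, in the form that
  \<open>lgen_rgen_commute\<close> asks for. Since 2 - B = 2/(1+A), every vector (2 - B) y lies in
  the domain of A, and A maps it to B y; so the adjoint, \<open>cc\<close> after A, takes the value
  \<open>cc (B y)\<close> there.\<close>

lemma Lp_Rp: "(x, x') \<in> Lp \<Longrightarrow> (y, y') \<in> Rp \<Longrightarrow> cinner x' y = cinner y' x"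
proof -
  assume "(x, x') \<in> Lp" "(y, y') \<in> Rp"
  then obtain a b where ab: "x = j a" "x' = j (cc a)" "y = j (2 *\<^sub>C b - B b)" "y' = j (cc (B b))"
    by (auto simp: Lp_def Rp_def)
  have "cinner x' y = cinner (cc a) (B (2 *\<^sub>C b - B b))"
    unfolding ab j_cinner by (rule B_symmetric)
  also have "\<dots> = cinner (cc (2 *\<^sub>C B b - B (B b))) a"
    by (simp add: cinner_cc_left B_diff B_scaleC)
  also have "cc (2 *\<^sub>C B b - B (B b)) = B (cc (B b))"
    by (simp add: cc_diff cc_scaleC cc_B)
  finally show ?thesis unfolding ab j_cinner .
qed

lemma dense_Lp: "closure (cspan (fst ` Lp)) = UNIV"
proof -
  have "range j \<subseteq> cspan (fst ` Lp)" by (auto simp: Lp_def image_image intro!: cspan_base)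
  then have "closure (range j) \<subseteq> closure (cspan (fst ` Lp))" by (rule closure_mono)
  then show ?thesis using j_dense by auto
qed

text \<open>A vector v orthogonal to the span defines a bounded functional <v, j y> = <g, y>.
  Symmetry of B gives B g = 2 g, so g = 0 and v is orthogonal to the range of j.\<close>

lemma dense_Rp: "closure (cspan (fst ` Rp)) = UNIV"
proof (rule ccontr)
  let ?W = "closure (cspan (fst ` Rp))"
  assume "?W \<noteq> UNIV"
  then obtain x where x: "x \<notin> ?W" by blast
  obtain p where p: "p \<in> ?W" "\<And>v. v \<in> ?W \<Longrightarrow> cinner v (x - p) = 0"
    using orthogonal_projection[of ?W x] csubspace_closure[OF csubspace_cspan] by auto
  define v where "v = x - p"
  have "v \<noteq> 0" using x p(1) by (auto simp: v_def)
  have "\<exists>g. \<forall>y. cinner v (j y) = cinner g y"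
  proof (rule riesz_representation[of _ "norm v * sqrt 2"])
    show "cmod (cinner v (j y)) \<le> norm y * (norm v * sqrt 2)" for y
      using cinner_cauchy_schwarz[of v "j y"] mult_left_mono[OF norm_j[of y], of "norm v"]
      by (simp add: mult_ac)
  qed (simp_all add: j_add j_scaleC cinner_simps)
  then obtain g where g: "\<And>y. cinner v (j y) = cinner g y" by blast
  have "cinner (2 *\<^sub>C g - B g) y = 0" for y
  proof -
    have "j (2 *\<^sub>C y - B y) \<in> cspan (fst ` Rp)"
      by (intro cspan_base) (auto simp: Rp_def image_image)
    then have "j (2 *\<^sub>C y - B y) \<in> ?W" using closure_subset by blast
    then have "cinner (j (2 *\<^sub>C y - B y)) v = 0" unfolding v_def by (rule p(2))
    then have "cinner v (j (2 *\<^sub>C y - B y)) = 0" by (metis cinner_commute complex_cnj_zero)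
    then show ?thesis by (simp add: g cinner_simps B_symmetric)
  qed
  then have "2 *\<^sub>C g - B g = 0" by (metis cinner_eq_0_iff)
  then have "g = 0" using B_two_imp[of g] by simp
  then have "cinner v y = 0" if "y \<in> closure (cspan (range j))" for y
    by (intro orthogonal_closure_cspan(1)[OF _ that]) (auto simp: g)
  moreover have "v \<in> closure (cspan (range j))"
    using j_dense closure_mono[of "range j" "cspan (range j)"] by (auto intro: cspan_base)
  ultimately show False using \<open>v \<noteq> 0\<close> cinner_eq_0_iff by blast
qed

section \<open>The two eigenvectors and their orthogonal complement\<close>

lemma B_ccz: "B (cc z) = of_real (2 - \<beta>) *\<^sub>C cc z"
  by (simp add: B_cc B_z cc_scaleC scaleC_diff_left)

lemma ccz: "cinner (cc z) z = 0" "cinner (cc z) (cc z) = cinner z z"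
  using z(3) by (metis cinner_commute complex_cnj_zero) (metis cc_cinner cinner_commute)

lemma norm_jz: "(norm (j z))\<^sup>2 = \<beta> * (norm z)\<^sup>2" "(norm (j (cc z)))\<^sup>2 = (2 - \<beta>) * (norm z)\<^sup>2"
proof -
  have "complex_of_real ((norm (j z))\<^sup>2) = of_real (\<beta> * (norm z)\<^sup>2)"
    unfolding cinner_self[symmetric] j_cinner by (simp add: B_z cinner_simps cinner_self)
  then show "(norm (j z))\<^sup>2 = \<beta> * (norm z)\<^sup>2" using of_real_eq_iff by blast
  have "complex_of_real ((norm (j (cc z)))\<^sup>2) = of_real ((2 - \<beta>) * (norm z)\<^sup>2)"
    unfolding cinner_self[symmetric] j_cinner by (simp add: B_ccz cinner_simps ccz(2) cinner_self[of z])
  then show "(norm (j (cc z)))\<^sup>2 = (2 - \<beta>) * (norm z)\<^sup>2" using of_real_eq_iff by blast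
qed

definition Orth where "Orth = {u. cinner z u = 0 \<and> cinner (cc z) u = 0}"

lemma Orth_B: "u \<in> Orth \<Longrightarrow> B u \<in> Orth"
  by (simp add: Orth_def B_symmetric[symmetric] B_z B_ccz cinner_simps)

lemma Orth_cc: "u \<in> Orth \<Longrightarrow> cc u \<in> Orth"
  unfolding Orth_def by (auto simp: cc_cinner) (metis cc_cc cc_cinner complex_cnj_zero)

lemma Orth_two: "u \<in> Orth \<Longrightarrow> 2 *\<^sub>C u - B u \<in> Orth"
  using Orth_B[of u] by (auto simp: Orth_def cinner_simps)

lemma Orth_j: "u \<in> Orth \<Longrightarrow> cinner (j u) (j z) = 0 \<and> cinner (j u) (j (cc z)) = 0"
proof -
  assume u: "u \<in> Orth"
  have "cinner (B u) z = 0" "cinner (B u) (cc z) = 0"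
    using Orth_B[OF u] unfolding Orth_def by (auto, (metis cinner_commute complex_cnj_zero)+)
  then show ?thesis by (simp add: j_cinner)
qed

theorem central_operator_scalar:
  assumes y: "y \<noteq> 0" "cc y = y" "y \<in> Orth"
    and F: "q_fock q w"
    and T: "\<And>x x'. (x, x') \<in> Lp \<Longrightarrow> T * q_fock.lgen q w x x' = q_fock.lgen q w x x' * T"
      "\<And>y y'. (y, y') \<in> Rp \<Longrightarrow> T * q_fock.rgen q w y y' = q_fock.rgen q w y y' * T"
  shows "\<exists>c. T = c *\<^sub>C 1"
proof -
  interpret q_fock q w by (rule F)
  have nz2: "(norm z)\<^sup>2 > 0" using z(2) by simp
  have jz: "j (cc z) \<noteq> 0"
    using norm_jz(2) beta nz2 by auto
  have "(norm (j (cc z)))\<^sup>2 < (norm (j z))\<^sup>2"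
    unfolding norm_jz using beta nz2 by (intro mult_strict_right_mono) auto
  then have lt: "norm (j (cc z)) < norm (j z)"
    by (rule power2_less_imp_less) simp
  define mu where "mu = \<beta> / (2 - \<beta>)"
  have mu: "mu = (norm (j z))\<^sup>2 / (norm (j (cc z)))\<^sup>2"
    unfolding norm_jz mu_def using nz2 by simp
  have b: "\<beta> \<noteq> 0" "2 - \<beta> \<noteq> 0" using beta by auto
  have orth: "cinner (j z) (j (cc z)) = 0"
    by (simp add: j_cinner B_z cinner_simps z(3))
  have R1: "(j z, of_real mu *\<^sub>C j (cc z)) \<in> Rp"
  proof -
    \<comment> \<open>The solution of (2 - B) y = z, as 2 - B is the scalar 2 - \<beta> on
      z.\<close>
    let ?y = "of_real (1 / (2 - \<beta>)) *\<^sub>C z"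
    have "2 *\<^sub>C ?y - B ?y = of_real (2 * (1 / (2 - \<beta>)) - 1 / (2 - \<beta>) * \<beta>) *\<^sub>C z"
      by (simp only: B_scaleC B_z scaleC_scaleC scaleC_diff_left of_real_diff of_real_mult of_real_numeral)
    also have "2 * (1 / (2 - \<beta>)) - 1 / (2 - \<beta>) * \<beta> = 1"
      using b by (simp add: divide_simps) (simp add: algebra_simps)?
    finally have 1: "2 *\<^sub>C ?y - B ?y = z" by simp
    have "cc (B ?y) = of_real (1 / (2 - \<beta>) * \<beta>) *\<^sub>C cc z"
      by (simp only: B_scaleC B_z scaleC_scaleC cc_scaleC of_real_mult complex_cnj_mult complex_cnj_complex_of_real)
    then have 2: "cc (B ?y) = of_real mu *\<^sub>C cc z" by (simp add: mu_def)
    show ?thesis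
      unfolding Rp_def by (rule range_eqI[of _ _ ?y]) (simp only: 1 2 j_scaleC)
  qed
  have R2: "(j (cc z), of_real (1 / mu) *\<^sub>C j z) \<in> Rp"
  proof -
    \<comment> \<open>On \<open>cc z\<close> the operator 2 - B is the scalar \<beta>.\<close>
    let ?y = "of_real (1 / \<beta>) *\<^sub>C cc z"
    have "2 *\<^sub>C ?y - B ?y = of_real (2 * (1 / \<beta>) - 1 / \<beta> * (2 - \<beta>)) *\<^sub>C cc z"
      by (simp only: B_scaleC B_ccz scaleC_scaleC scaleC_diff_left[symmetric] of_real_diff of_real_mult of_real_numeral)
    also have "2 * (1 / \<beta>) - 1 / \<beta> * (2 - \<beta>) = 1"
      using b by (simp add: divide_simps) (simp add: algebra_simps)?
    finally have 1: "2 *\<^sub>C ?y - B ?y = cc z" by simp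
    have "cc (B ?y) = of_real (1 / \<beta> * (2 - \<beta>)) *\<^sub>C z"
      by (simp only: B_scaleC B_ccz scaleC_scaleC cc_scaleC cc_cc of_real_mult complex_cnj_mult complex_cnj_complex_of_real)
    then have 2: "cc (B ?y) = of_real (1 / mu) *\<^sub>C z" by (simp add: mu_def)
    show ?thesis
      unfolding Rp_def by (rule range_eqI[of _ _ ?y]) (simp only: 1 2 j_scaleC)
  qed
  \<comment> \<open>In the range of 2 - B, so that \<open>j ?u\<close> occurs as a first component
    in \<open>Rp\<close> as well as in \<open>Lp\<close>: one letter f serves both sides.\<close>
  let ?u = "2 *\<^sub>C y - B y"
  have "?u \<noteq> 0" using B_two_imp[of y] y(1) by auto
  then have "B ?u \<noteq> 0" using B_zero_imp by blast
  then have "cinner (B ?u) (B ?u) \<noteq> 0" by simp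
  then have f: "j ?u \<noteq> 0"
    unfolding j_cinner[symmetric] by auto
  show ?thesis
  proof (rule central_is_scalar[OF Lp_Rp dense_Lp dense_Rp orth jz lt mu _ _ R1 R2 f _ _ _ T])
    show "(j z, j (cc z)) \<in> Lp" unfolding Lp_def by blast
    show "(j (cc z), j z) \<in> Lp" unfolding Lp_def by (rule range_eqI[of _ _ "cc z"]) simp
    show "(j ?u, j (cc ?u)) \<in> Lp" unfolding Lp_def by blast
    show "(j ?u, j (cc (B y))) \<in> Rp" unfolding Rp_def by blast
    show "cinner a (j z) = 0 \<and> cinner a (j (cc z)) = 0" if "a \<in> {j ?u, j (cc ?u), j (cc (B y))}" for a
      using that Orth_j Orth_cc Orth_two[OF y(3)] Orth_B[OF y(3)] by blast
  qed
qed

end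

section \<open>Factors and bicommutants\<close>

definition bop_commutant :: "'a::chilbert_space bop set \<Rightarrow> 'a bop set" where
  "bop_commutant A = {T. \<forall>X\<in>A. T * X = X * T}"

lemma commutant_app: "commutant (app ` A) = app ` bop_commutant A"
proof
  have eq: "app a \<circ> app b = app b \<circ> app a \<longleftrightarrow> a * b = b * a" for a b :: "'a bop"
  proof -
    have "app a \<circ> app b = app (a * b)" for a b :: "'a bop" by auto
    then show ?thesis by (simp add: app_inject)
  qed
  show "app ` bop_commutant A \<subseteq> commutant (app ` A)"
    using eq by (auto simp: bop_commutant_def commutant_def app_clinear)
  show "commutant (app ` A) \<subseteq> app ` bop_commutant A"
  proof
    fix T assume T: "T \<in> commutant (app ` A)"
    then have 1: "T = app (Bop T)" by (simp add: commutant_def app_Bop)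
    have "app (Bop T) \<circ> app X = app X \<circ> app (Bop T)" if "X \<in> A" for X
      using T that unfolding 1[symmetric] by (simp add: commutant_def)
    then have "Bop T \<in> bop_commutant A" by (simp add: eq bop_commutant_def)
    then show "T \<in> app ` bop_commutant A" using 1 by blast
  qed
qed

lemma bop_commutant_triple: "bop_commutant (bop_commutant (bop_commutant A)) = bop_commutant A"
  unfolding bop_commutant_def by auto

lemma star_in_bop_commutant:
  assumes "\<And>X. X \<in> A \<Longrightarrow> star X \<in> A" and "T \<in> bop_commutant A"
  shows "star T \<in> bop_commutant A"
  unfolding bop_commutant_def
proof (intro CollectI ballI)
  fix X assume "X \<in> A"
  then have "T * star X = star X * T" using assms by (simp add: bop_commutant_def)
  then have "star (T * star X) = star (star X * T)" by simp
  then show "star T * X = X * star T" by (simp add: star_mult)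
qed

theorem factor_bicommutant:
  assumes star: "\<And>X. X \<in> A \<Longrightarrow> star X \<in> A"
    and scalar: "\<And>T. T \<in> bop_commutant A \<Longrightarrow> T \<in> bop_commutant (bop_commutant A) \<Longrightarrow> \<exists>c. T = c *\<^sub>C 1"
  shows "factor (commutant (commutant (app ` A)))"
  unfolding factor_def von_neumann_algebra_def
proof (intro conjI ballI)
  let ?M = "commutant (commutant (app ` A))"
  have M: "?M = app ` bop_commutant (bop_commutant A)" by (simp add: commutant_app)
  show "commutant (commutant ?M) = ?M"
    by (simp add: commutant_app bop_commutant_triple)
  show "bounded_clinear T" if "T \<in> ?M" for T
    using that by (simp add: commutant_def)
  show "cadjoint T \<in> ?M" if T: "T \<in> ?M" for T
  proof -
    obtain X where X: "T = app X" "X \<in> bop_commutant (bop_commutant A)" using T M by auto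
    have "star X \<in> bop_commutant (bop_commutant A)"
      by (intro star_in_bop_commutant[OF _ X(2)]) (rule star_in_bop_commutant[OF star])
    moreover have "cadjoint T = app (star X)"
      unfolding X by (rule cadjoint_eqI) (rule cinner_star_left)
    ultimately show ?thesis using M by auto
  qed
  have "?M \<inter> commutant ?M = app ` (bop_commutant (bop_commutant A) \<inter> bop_commutant A)"
    by (auto simp: commutant_app bop_commutant_triple app_inject)
  also have "bop_commutant (bop_commutant A) \<inter> bop_commutant A = range (\<lambda>c. c *\<^sub>C 1)"
  proof
    show "bop_commutant (bop_commutant A) \<inter> bop_commutant A \<subseteq> range (\<lambda>c. c *\<^sub>C 1)"
      using scalar by blast
  qed (auto simp: bop_commutant_def)
  also have "app ` range (\<lambda>c. c *\<^sub>C 1) = range (\<lambda>c x. c *\<^sub>C x)"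
    unfolding image_image by (intro image_cong refl ext) (simp add: app_scaleC)
  finally show "?M \<inter> commutant ?M = range (\<lambda>c x. c *\<^sub>C x)" .
qed

section \<open>The algebraic Fock space\<close>



lemma algebraic_fock_span: "x \<in> cspan (range tensor)"
proof (induction x rule: algebraic_fock.abs_induct)
  fix a :: "'a list \<Rightarrow>\<^sub>0 complex"
  have zero: "abs_algebraic_fock 0 = 0" by (simp add: zero_algebraic_fock_def)
  have single: "abs_algebraic_fock (Poly_Mapping.single k v) = v *\<^sub>C tensor k" for k v
  proof -
    have "Poly_Mapping.single k v = free_scale v (Poly_Mapping.single k 1)"
      by (rule poly_mapping_eqI) (simp add: lookup_single when_def)
    then show ?thesis by (simp add: tensor.abs_eq scaleC_algebraic_fock.abs_eq)
  qed
  show "abs_algebraic_fock a \<in> cspan (range tensor)"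
  proof (induction a rule: update_induct)
    case const
    show ?case unfolding zero by (rule cspan_zero)
  next
    case (update f k v)
    then have "Poly_Mapping.update k v f = f + Poly_Mapping.single k v"
      by (intro poly_mapping_eqI) (auto simp: lookup_update lookup_add lookup_single when_def in_keys_iff)
    then have "abs_algebraic_fock (Poly_Mapping.update k v f) = abs_algebraic_fock f + v *\<^sub>C tensor k"
      by (simp add: single flip: plus_algebraic_fock.abs_eq)
    also have "\<dots> \<in> cspan (range tensor)"
      by (intro cspan_add[OF update(3)] cspan_scale cspan_base rangeI)
    finally show ?case .
  qed
qed

lemma q_fock_completion:
  assumes "-1 < q" "q < 1" and jF: "is_completion (q_inner q) jF"
  shows "q_fock q (\<lambda>xs. jF (tensor xs))"
proof
  have lin: "jF (x + y) = jF x + jF y" "jF (c *\<^sub>C x) = c *\<^sub>C jF x" for x y c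
    using jF by (auto simp: is_completion_def clinear_def)
  show "cinner (jF (tensor xs)) (jF (tensor ys)) = q_gram q xs ys" for xs ys
    using jF by (simp add: is_completion_def q_inner_tensor)
  have "jF x \<in> cspan (range (\<lambda>xs. jF (tensor xs)))" for x
    using algebraic_fock_span[of x]
  proof induction
    case cspan_zero
    show ?case using lin(2)[of 0 0] by (simp add: cspan.cspan_zero)
  next
    case (cspan_base x)
    then show ?case by (auto intro: cspan.cspan_base)
  next
    case (cspan_add x y)
    then show ?case by (simp add: lin cspan.cspan_add)
  next
    case (cspan_scale x c)
    then show ?case by (simp add: lin cspan.cspan_scale)
  qed
  then have "closure (range jF) \<subseteq> closure (cspan (range (\<lambda>xs. jF (tensor xs))))"
    by (intro closure_mono) auto
  then show "closure (cspan (range (\<lambda>xs. jF (tensor xs)))) = UNIV"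
    using jF by (auto simp: is_completion_def)
qed (use assms in auto)

lemma q_gaussian_eq:
  assumes F: "q_fock q (\<lambda>xs. jF (tensor xs))"
  shows "q_gaussian jF \<xi> = app (q_fock.lgen q (\<lambda>xs. jF (tensor xs)) \<xi> \<xi>)"
proof -
  interpret q_fock q "\<lambda>xs. jF (tensor xs)" by (rule F)
  have "creation jF \<xi> = app (cr \<xi>)"
    unfolding creation_def
  proof (rule the_equality)
    show "bounded_clinear (app (cr \<xi>)) \<and> (\<forall>xs. app (cr \<xi>) (jF (tensor xs)) = jF (tensor (\<xi> # xs)))"
      by (simp add: app_clinear cr_w)
    fix C assume C: "bounded_clinear C \<and> (\<forall>xs. C (jF (tensor xs)) = jF (tensor (\<xi> # xs)))"
    then have "Bop C = cr \<xi>" by (intro w_bop_eqI) (simp add: app_Bop cr_w)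
    then show "C = app (cr \<xi>)" using C app_Bop by metis
  qed
  moreover have "cadjoint (app (cr \<xi>)) = app (an \<xi>)"
    by (rule cadjoint_eqI) (rule cinner_star_left)
  ultimately show ?thesis by (intro ext) (simp add: q_gaussian_def lgen_def app_add)
qed

section \<open>The complexified representation\<close>

definition cconj :: "'a::real_inner complexification \<Rightarrow> 'a complexification" where
  "cconj x = Complexify (re x) (- im x)"

lemma one_parameter_group_complexify:
  fixes U :: "real \<Rightarrow> 'a::{real_inner, complete_space} \<Rightarrow> 'a"
  assumes "strongly_continuous_orthogonal_rep U"
  shows "one_parameter_group (\<lambda>t. complexify_map (U t)) cconj"
proof -
  have orth: "orthogonal_transformation (U t)" for t
    using assms by (simp add: strongly_continuous_orthogonal_rep_def)
  have inner: "inner (U t x) (U t y) = inner x y" for t x y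
    using orth by (simp add: orthogonal_transformation_def)
  have lin: "linear (U t)" for t
    using orth by (simp add: orthogonal_transformation_def)
  note lin_simps = linear_add[OF lin] linear_diff[OF lin] linear_scale[OF lin] linear_neg[OF lin]
  note defs = complexify_map_def cconj_def complexification_defs
  show ?thesis
  proof
    fix t s x y c
    show "complexify_map (U t) (x + y) = complexify_map (U t) x + complexify_map (U t) y"
      "complexify_map (U t) (c *\<^sub>C x) = c *\<^sub>C complexify_map (U t) x"
      "cinner (complexify_map (U t) x) (complexify_map (U t) y) = cinner x y"
      "cconj (x + y) = cconj x + cconj y"
      "cconj (c *\<^sub>C x) = cnj c *\<^sub>C cconj x"
      "cconj (cconj x) = x"
      "cinner (cconj x) (cconj y) = cnj (cinner x y)"
      "cconj (complexify_map (U t) x) = complexify_map (U t) (cconj x)"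
      by (simp_all add: defs lin_simps inner complex_eq_iff)
    show "complexify_map (U 0) x = x"
      "complexify_map (U (s + t)) x = complexify_map (U s) (complexify_map (U t) x)"
      using assms by (simp_all add: strongly_continuous_orthogonal_rep_def defs)
  qed
qed

text \<open>The vector (1, i) of the complexified plane. For \<theta> = ln lam the generator has the
  eigenvalue 1 / lam > 1 on it.\<close>

lemma rotation_eigenvector:
  fixes U :: "real \<Rightarrow> (real^2) \<times> 'k::{real_inner, complete_space} \<Rightarrow> (real^2) \<times> 'k"
  assumes "\<And>t v. U t (v, 0) =
      (vector [vector [cos (t * \<theta>), - sin (t * \<theta>)], vector [sin (t * \<theta>), cos (t * \<theta>)]] *v v, 0)"
  shows "complexify_map (U t) (Complexify (vector [1, 0], 0) (vector [0, 1], 0)) =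
    exp (\<i> * of_real (t * - \<theta>)) *\<^sub>C Complexify (vector [1, 0], 0) (vector [0, 1], 0)"
proof -
  have e: "exp (\<i> * of_real (t * - \<theta>)) = Complex (cos (t * \<theta>)) (- sin (t * \<theta>))"
    by (simp add: exp_eq_polar complex_eq_iff)
  show ?thesis
    unfolding e complexify_map_def scaleC_complexification_def complexification.sel assms
    by (simp add: vec_eq_iff forall_2 matrix_vector_mult_def sum_2)
qed

theorem theorem4p3:
  fixes q lam :: real
    and U :: "real \<Rightarrow> (real^2) \<times> 'k::{real_inner, complete_space} \<Rightarrow> (real^2) \<times> 'k"
    and jH :: "((real^2) \<times> 'k) complexification \<Rightarrow> 'h::chilbert_space"
    and jF :: "'h algebraic_fock \<Rightarrow> 'f::chilbert_space"
  assumes "-1 < q" and "q < 1"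
    and "separable_space (euclidean :: 'k topology)"
    and "\<exists>x::'k. x \<noteq> 0"
    and "strongly_continuous_orthogonal_rep U"
    and "0 < lam" and "lam < 1"
    and "\<And>t v. U t (v, 0) =
      (vector [vector [cos (t * ln lam), - sin (t * ln lam)],
               vector [sin (t * ln lam), cos (t * ln lam)]] *v v, 0)"
    and "is_completion (inner_U U) jH"
    and "is_completion (q_inner q) jF"
  shows "factor (q_araki_woods jH jF)"
proof -
  define z :: "((real^2) \<times> 'k) complexification"
    where "z = Complexify (vector [1, 0], 0) (vector [0, 1], 0)"
  obtain k :: 'k where k: "k \<noteq> 0" using assms(4) by blast
  \<comment> \<open>A vector orthogonal to the plane, from which the letter f is made.\<close>
  define y :: "((real^2) \<times> 'k) complexification" where "y = Complexify (0, k) 0"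
  interpret one_parameter_group "\<lambda>t. complexify_map (U t)" cconj
    by (rule one_parameter_group_complexify[OF assms(5)])
  have inner_U: "inner_U U \<xi> \<eta> = cinner (B \<xi>) \<eta>" for \<xi> \<eta>
    by (simp add: inner_U_def B_def G_def)
  interpret deformation "\<lambda>t. complexify_map (U t)" cconj jH z "- ln lam"
  proof
    show "clinear jH" "closure (range jH) = UNIV" "cinner (jH x) (jH y) = cinner (B x) y" for x y
      using assms(9) by (simp_all add: is_completion_def inner_U)
    show "complexify_map (U t) z = exp (\<i> * of_real (t * - ln lam)) *\<^sub>C z" for t
      unfolding z_def by (rule rotation_eigenvector[OF assms(8)])
    show "z \<noteq> 0" by (auto simp: z_def zero_complexification_def zero_prod_def vec_eq_iff forall_2)
    show "cinner z (cconj z) = 0"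
      by (simp add: z_def cconj_def cinner_complexification_def inner_vec_def sum_2 complex_eq_iff)
    show "- ln lam > 0" using assms(6,7) by simp
  qed
  let ?w = "\<lambda>xs. jF (tensor xs)"
  have F: "q_fock q ?w" by (rule q_fock_completion[OF assms(1,2,10)])
  interpret q_fock q ?w by (rule F)
  define s where "s \<xi> = lgen (jH (Complexify \<xi> 0)) (jH (Complexify \<xi> 0))" for \<xi>
  \<comment> \<open>Creation is linear and annihilation antilinear in its letter, so conjugating the
    second argument makes the generator complex linear in x.\<close>
  have lgen_eq: "lgen (jH x) (jH (cconj x)) = s (re x) + \<i> *\<^sub>C s (im x)" for x
  proof -
    have "x = Complexify (re x) 0 + \<i> *\<^sub>C Complexify (im x) 0"
      "cconj x = Complexify (re x) 0 + (- \<i>) *\<^sub>C Complexify (im x) 0"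
      by (simp_all add: complexification_defs cconj_def)
    then have "lgen (jH x) (jH (cconj x)) = lgen (jH (Complexify (re x) 0) + \<i> *\<^sub>C jH (Complexify (im x) 0))
        (jH (Complexify (re x) 0) + (- \<i>) *\<^sub>C jH (Complexify (im x) 0))"
      by (simp only: j_add j_scaleC flip: j_add j_scaleC)
    then show ?thesis
      by (simp add: s_def lgen_def cr_add cr_scaleC star_add star_scaleC scaleC_add_right add_ac)
  qed
  have "q_araki_woods jH jF = commutant (commutant (app ` range s))"
    unfolding q_araki_woods_def q_gaussian_eq[OF F] by (simp add: image_image s_def)
  moreover have "factor (commutant (commutant (app ` range s)))"
  proof (rule factor_bicommutant)
    show "star X \<in> range s" if "X \<in> range s" for X
      using that by (auto simp: s_def star_lgen)
    fix T assume T: "T \<in> bop_commutant (range s)" "T \<in> bop_commutant (bop_commutant (range s))"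
    \<comment> \<open>Right generators from \<open>Rp\<close> commute with all Gaussians, so T,
      taken from the bicommutant, commutes with them.\<close>
    have s_rgen: "s \<xi> * rgen v v' = rgen v v' * s \<xi>" if "(v, v') \<in> Rp" for v v' \<xi>
    proof -
      have "cconj (Complexify \<xi> 0) = Complexify \<xi> 0" by (simp add: cconj_def)
      then have "(jH (Complexify \<xi> 0), jH (Complexify \<xi> 0)) \<in> Lp"
        unfolding Lp_def by (intro range_eqI[of _ _ "Complexify \<xi> 0"]) simp
      then show ?thesis unfolding s_def by (intro lgen_rgen_commute Lp_Rp that)
    qed
    show "\<exists>c. T = c *\<^sub>C 1"
    proof (rule central_operator_scalar[OF _ _ _ F])
      show "y \<noteq> 0" using k by (simp add: y_def zero_complexification_def zero_prod_def)
      show "cconj y = y" by (simp add: y_def cconj_def)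
      show "y \<in> Orth"
        unfolding Orth_def
        by (simp add: y_def z_def cconj_def cinner_complexification_def complex_eq_iff zero_complexification_def)
      show "T * lgen x x' = lgen x x' * T" if "(x, x') \<in> Lp" for x x'
      proof -
        have "T * s \<xi> = s \<xi> * T" for \<xi> using T(1) unfolding bop_commutant_def by blast
        moreover obtain u where "x = jH u" "x' = jH (cconj u)" using \<open>(x, x') \<in> Lp\<close> by (auto simp: Lp_def)
        ultimately show ?thesis by (simp add: lgen_eq distrib_left distrib_right)
      qed
      show "T * rgen v v' = rgen v v' * T" if "(v, v') \<in> Rp" for v v'
        using T(2) s_rgen[OF that] by (simp add: bop_commutant_def)
    qed
  qed
  ultimately show ?thesis by simp
qed

end
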